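(* Let $k$ be a field of characteristic $p>0$, and let $K$ be a function field over $k$. Let $d\ge2$ and $e\le d-2$ be nonnegative integers such that $p$ does not divide $d$. Define \[ f_t(z)=\frac{z^d-t}{z^e}. \] Then the Strong Uniform Boundedness Principle over $K$ holds for the family $f_t$.
   Context: A function field over a field $k$ is any finite extension of the rational function field $k(t)$. For a field $L$ and a rational function $f$, $\mathrm{PrePer}(f,L)$ denotes the set of points $x\in\mathbb{P}^1(L)$ having finite forward orbit under $f$. A set $\mathcal{F}\subset \bar K(z)$ of rational functions of degree $d>1$ satisfies the Strong Uniform Boundedness Principle (SUBP) over $K$ if for every $D\ge1$ there is a bound $B=B(\mathcal{F},D)$ such that $\#\mathrm{PrePer}(f,L)\le B$ for every extension $L/K$ of degree $D$ and every $f\in\mathcal{F}$ with coefficients in $L$. "The SUBP over $K$ holds for the family $f_t$" means that the SUBP over $K$ holds for the set $\mathcal{F}=\{f_s : s\in\bar K,\ f_s \text{ is not } \bar K\text{-conjugate (by an element of } \mathrm{PGL}_2(\bar K)) \text{ to an element of } \bar k(z)\}$, where $f_s$ is obtained by specializing $t=s$. *)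

theory Defs
  imports "HOL-Algebra.Algebra" "HOL-Algebra.Algebraic_Closure_Type"
begin

text \<open>
  A field \<open>K\<close> is a type \<open>'K\<close> of class \<^class>\<open>field\<close>, its algebraic closure is the type
  \<open>'K alg_closure\<close> with the embedding \<^const>\<open>to_ac\<close>, and subfields of either are carrier
  sets with respect to \<^const>\<open>ring_of_type_algebra\<close>.  Since every finite extension
  of \<open>K\<close> embeds over \<open>K\<close> into the algebraic closure, extensions are taken inside it.
\<close>

definition function_field_over :: "'K::field set \<Rightarrow> bool" where
  "function_field_over k \<longleftrightarrow>
     subfield k (ring_of_type_algebra :: 'K ring) \<and>
     (\<exists>t. ring.transcendental ring_of_type_algebra k t \<and>
          ring.finite_dimension ring_of_type_algebra
            (generate_field ring_of_type_algebra (insert t k)) UNIV)"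

definition extension_of_degree :: "'K::field alg_closure set \<Rightarrow> nat \<Rightarrow> bool" where
  "extension_of_degree L D \<longleftrightarrow>
     subfield L ring_of_type_algebra \<and> range to_ac \<subseteq> L \<and>
     ring.dimension ring_of_type_algebra D (range to_ac) L"

definition algebraic_closure_in :: "'K::field set \<Rightarrow> 'K alg_closure set" where
  "algebraic_closure_in k = {x. ring.algebraic ring_of_type_algebra (to_ac ` k) x}"


subsection \<open>Rational functions\<close>

text \<open>
  The field of rational functions over \<open>F\<close> is the fraction field of \<open>F[z]\<close>;
  \<^const>\<open>quot_of_fract\<close> picks numerator and denominator in lowest terms.
\<close>

type_synonym 'F ratfun = "'F poly fract"

definition rat_num :: "'K::field alg_closure ratfun \<Rightarrow> 'K alg_closure poly" where
  "rat_num f = fst (quot_of_fract f)"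

definition rat_den :: "'K::field alg_closure ratfun \<Rightarrow> 'K alg_closure poly" where
  "rat_den f = snd (quot_of_fract f)"

definition rat_degree :: "'K::field alg_closure ratfun \<Rightarrow> nat" where
  "rat_degree f = max (Polynomial.degree (rat_num f)) (Polynomial.degree (rat_den f))"

definition ratfuns_over :: "'F::field set \<Rightarrow> 'F ratfun set" where
  "ratfuns_over S =
     {Fract p q | p q. q \<noteq> 0 \<and> (\<forall>i. Polynomial.coeff p i \<in> S) \<and> (\<forall>i. Polynomial.coeff q i \<in> S)}"

text \<open>
  Substitution of \<open>g\<close> for \<open>z\<close>, computed in the field of rational functions.  This is the usual
  composition whenever the denominator of \<open>f\<close> does not vanish at \<open>g\<close>, in particular
  for all nonconstant \<open>g\<close>.
\<close>

definition rat_comp ::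
    "'K::field alg_closure ratfun \<Rightarrow> 'K alg_closure ratfun \<Rightarrow> 'K alg_closure ratfun" where
  "rat_comp f g =
     poly (map_poly (\<lambda>c. to_fract [:c:]) (rat_num f)) g /
     poly (map_poly (\<lambda>c. to_fract [:c:]) (rat_den f)) g"

definition mobius :: "'F::field \<Rightarrow> 'F \<Rightarrow> 'F \<Rightarrow> 'F \<Rightarrow> 'F ratfun" where
  "mobius a b c d = Fract [:b, a:] [:d, c:]"

text \<open>\<open>g = \<mu>\<^sup>-\<^sup>1 \<circ> f \<circ> \<mu>\<close> where \<open>\<mu>(z) = (a z + b) / (c z + d)\<close>\<close>

definition pgl2_conjugate ::
    "'K::field alg_closure ratfun \<Rightarrow> 'K alg_closure ratfun \<Rightarrow> bool" where
  "pgl2_conjugate f g \<longleftrightarrow>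
     (\<exists>a b c d. a * d - b * c \<noteq> 0 \<and>
        g = rat_comp (mobius d (- b) (- c) a) (rat_comp f (mobius a b c d)))"


subsection \<open>Preperiodic points on the projective line\<close>

datatype 'F proj_line = Aff 'F | Infty

definition proj_line_over :: "'F set \<Rightarrow> 'F proj_line set" where
  "proj_line_over L = insert Infty (Aff ` L)"

text \<open>
  At \<open>\<infinity> = [1 : 0]\<close> the homogenisations of numerator and denominator in degree
  \<open>n = rat_degree f\<close> take the values of their coefficients of index \<open>n\<close>.
\<close>

fun rat_eval :: "'K::field alg_closure ratfun \<Rightarrow> 'K alg_closure proj_line \<Rightarrow> 'K alg_closure proj_line"
  where
    "rat_eval f (Aff x) =
       (if poly (rat_den f) x = 0 then Infty else Aff (poly (rat_num f) x / poly (rat_den f) x))"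
  | "rat_eval f Infty =
       (let n = rat_degree f in
        if Polynomial.coeff (rat_den f) n = 0 then Infty
        else Aff (Polynomial.coeff (rat_num f) n / Polynomial.coeff (rat_den f) n))"

definition PrePer ::
    "'K::field alg_closure ratfun \<Rightarrow> 'K alg_closure set \<Rightarrow> 'K alg_closure proj_line set" where
  "PrePer f L = {x \<in> proj_line_over L. finite (range (\<lambda>n. (rat_eval f ^^ n) x))}"


subsection \<open>The Strong Uniform Boundedness Principle\<close>

text \<open>
  The first conjunct is the requirement that the principle is only formulated for sets of rational
  functions of a common degree greater than 1.
\<close>

definition SUBP :: "'K::field alg_closure ratfun set \<Rightarrow> bool" where
  "SUBP \<F> \<longleftrightarrow>
     (\<exists>d>1. \<forall>f\<in>\<F>. rat_degree f = d) \<and>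
     (\<forall>D\<ge>1. \<exists>B::nat. \<forall>L f.
        extension_of_degree L D \<longrightarrow> f \<in> \<F> \<longrightarrow> f \<in> ratfuns_over L \<longrightarrow>
        finite (PrePer f L) \<and> card (PrePer f L) \<le> B)"

definition SUBP_family ::
    "'K::field set \<Rightarrow> ('K alg_closure \<Rightarrow> 'K alg_closure ratfun) \<Rightarrow> bool" where
  "SUBP_family k f \<longleftrightarrow>
     SUBP {f s | s. \<not> (\<exists>g \<in> ratfuns_over (algebraic_closure_in k). pgl2_conjugate (f s) g)}"

end

theory Submission
  imports Defs "HOL-Number_Theory.Residues"
begin

text \<open>
  Let \<open>\<kappa>\<close> be the algebraic closure of \<open>k\<close> in \<open>\<Omega> = K alg_closure\<close>, and let \<open>q\<close> be a power of \<open>p\<close> with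
  \<open>d | q - 1\<close>.  A member \<open>f = (z\<^sup>d - s) / z\<^sup>e\<close> of the family has \<open>s \<notin> \<kappa>\<close>.  Let \<open>x \<noteq> 0\<close> be a finite preperiodic
  point.  At a place where \<open>s\<close> is finite, so is \<open>x\<close>.  At a pole of \<open>s\<close>, put \<open>s = u\<^sup>d\<close> and \<open>t = 1/u\<close>; the relation
  \<open>x\<^sup>d - s = x\<^sup>e f(x)\<close> shows that \<open>x = \<zeta> u + O(1)\<close> with \<open>\<zeta>\<^sup>d = 1\<close>, and that \<open>x\<close> lies in \<open>\<bbbF>\<^sub>q((t))\<close>.

  Hence \<open>E = \<kappa>(s, x\<^sub>1, \<dots>, x\<^sub>N)\<close> has an automorphism \<open>\<sigma>\<close> that is the \<open>q\<close>-Frobenius on \<open>\<kappa>\<close>, fixes \<open>s\<close> and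
  all \<open>x\<^sub>i\<close>, and satisfies \<open>\<sigma>(g) \<equiv> g\<^sup>q\<close> modulo every pole of \<open>s\<close>.  The field \<open>E\<close> contains a nonconstant \<open>g\<close>
  whose degree is at most \<open>G = [L\<kappa> : \<kappa>(h)]\<close>, namely a norm of \<open>c - h\<close>, where \<open>h\<close> is a transcendental element
  of \<open>K\<close>.  After a Moebius change of \<open>g\<close>, the function \<open>\<sigma>(g) / g\<^sup>q\<close> is nonconstant of degree at most \<open>(q + 1) G\<close>
  and takes the value \<open>1\<close> at any given finite set of poles of \<open>s\<close>.  So at most \<open>(q + 1) G\<close> vectors
  \<open>(\<zeta>\<^sub>i / \<zeta>\<^sub>1)\<^sub>i\<close> arise from the poles of \<open>s\<close>.  If \<open>x\<^sub>i\<close> and \<open>x\<^sub>j\<close> have the same entries in all of these vectors,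
  then \<open>x\<^sub>i - x\<^sub>j\<close> has no pole at all and is a constant fixed by \<open>\<sigma>\<close>, that is, an element of \<open>\<bbbF>\<^sub>q\<close>.  Therefore
  \<open>N \<le> q d\<^bsup>(q + 1) G\<^esup>\<close>.
\<close>

text \<open>The number of poles of \<open>s\<close> is unbounded over the family, so a bound per
  pole is useless. What stays bounded is the degree \<open>G\<close> of \<open>E(h)\<close> over
  \<open>\<kappa>(h)\<close>, but \<open>\<sigma>\<close> acts on \<open>E\<close> only: a function
  of small degree has to be brought down from \<open>E(h)\<close> to \<open>E\<close>, and this is
  the purpose of the norm. The quotient \<open>\<sigma>(g) / g^q\<close> then takes the value 1 at
  all poles at once, however many there are, while its degree depends on \<open>q\<close> and
  \<open>G\<close> only; it is not constant, since \<open>\<sigma>(g) = g^q\<close> would force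
  \<open>g\<close> into \<open>\<kappa>\<close>. The condition \<open>d | q - 1\<close> puts all
  d-th roots of unity into \<open>F_q\<close>; Newton approximation divides by \<open>d\<close>,
  which is where \<open>p\<close> not dividing \<open>d\<close> enters, and so keeps every digit in
  \<open>F_q\<close>. The condition \<open>e \<le> d - 2\<close> makes infinity attracting at every
  place and the Newton perturbation small. Ratios of the roots of unity are recorded because
  \<open>u\<close> need not lie in \<open>E\<close>, whereas \<open>x_i / x_1\<close> does. The
  automorphism is never built as a map: it is a relation holding at all poles simultaneously.
  Divisors are avoided too: degrees are field degrees, and zeros are counted by linear
  independence.\<close>

hide_const (open) Polynomials.degree Polynomials.lead_coeff

section \<open>Subfields of a type of class \<open>field\<close>, as carrier sets\<close>

interpretation TA: Ring.cring "ring_of_type_algebra :: 'a::field ring"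
  by (rule cring_from_type_algebra)

abbreviation sfd :: "'a::field set \<Rightarrow> bool" where
  "sfd F \<equiv> subfield F ring_of_type_algebra"

lemma TA_simps [simp]:
  "carrier ring_of_type_algebra = (UNIV :: 'a::field set)"
  "x \<oplus>\<^bsub>ring_of_type_algebra\<^esub> y = x + (y :: 'a)"
  "x \<otimes>\<^bsub>ring_of_type_algebra\<^esub> y = x * (y :: 'a)"
  "\<zero>\<^bsub>ring_of_type_algebra\<^esub> = (0 :: 'a)"
  "\<one>\<^bsub>ring_of_type_algebra\<^esub> = (1 :: 'a)"
  by (simp_all add: ring_of_type_algebra_def)

lemma TA_minus [simp]: "\<ominus>\<^bsub>ring_of_type_algebra\<^esub> x = - (x :: 'a::field)"
  by (metis TA.add.inv_equality TA_simps(1,2,4) UNIV_I add.left_inverse)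

lemma TA_inv [simp]: "x \<noteq> 0 \<Longrightarrow> inv\<^bsub>ring_of_type_algebra\<^esub> x = inverse (x :: 'a::field)"
  by (metis TA.comm_inv_char TA_simps(1,3,5) UNIV_I right_inverse)

lemma sfdI:
  assumes "(1 :: 'a::field) \<in> F" "\<And>x y. x \<in> F \<Longrightarrow> y \<in> F \<Longrightarrow> x - y \<in> F"
    "\<And>x y. x \<in> F \<Longrightarrow> y \<in> F \<Longrightarrow> x * y \<in> F" "\<And>x. x \<in> F \<Longrightarrow> x \<noteq> 0 \<Longrightarrow> inverse x \<in> F"
  shows "sfd F"
proof -
  have 0: "0 \<in> F" using assms(2)[OF assms(1) assms(1)] by simp
  have m: "- x \<in> F" if "x \<in> F" for x using assms(2)[OF 0 that] by simp
  have a: "x + y \<in> F" if "x \<in> F" "y \<in> F" for x y using assms(2)[OF that(1) m[OF that(2)]] by simp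
  have "subring F ring_of_type_algebra"
    by (rule TA.subringI) (use assms m a in auto)
  thus ?thesis
    by (rule field.subfieldI'[OF field_from_type_algebra]) (use assms in auto)
qed

lemma
  assumes "sfd (F :: 'a::field set)"
  shows sfd_0: "0 \<in> F" and sfd_1: "1 \<in> F"
    and sfd_add: "\<And>x y. x \<in> F \<Longrightarrow> y \<in> F \<Longrightarrow> x + y \<in> F"
    and sfd_mult: "\<And>x y. x \<in> F \<Longrightarrow> y \<in> F \<Longrightarrow> x * y \<in> F"
    and sfd_uminus: "\<And>x. x \<in> F \<Longrightarrow> - x \<in> F"
    and sfd_inverse: "\<And>x. x \<in> F \<Longrightarrow> inverse x \<in> F"
proof -
  note s = subringE[OF subfieldE(1)[OF assms]]
  show "0 \<in> F" "1 \<in> F" using s(2,3) by auto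
  show "x + y \<in> F" "x * y \<in> F" if "x \<in> F" "y \<in> F" for x y
    using s(6,7)[of x y] that by auto
  show "- x \<in> F" if "x \<in> F" for x using s(5)[of x] that by auto
  show "inverse x \<in> F" if "x \<in> F" for x
    using TA.subfield_m_inv(1)[OF assms, of x] that \<open>0 \<in> F\<close> by (cases "x = 0") auto
qed

lemma sfd_diff: "sfd F \<Longrightarrow> x \<in> F \<Longrightarrow> y \<in> F \<Longrightarrow> x - y \<in> (F :: 'a::field set)"
  by (metis sfd_add sfd_uminus add_uminus_conv_diff)

lemma sfd_divide: "sfd F \<Longrightarrow> x \<in> F \<Longrightarrow> y \<in> F \<Longrightarrow> x / y \<in> (F :: 'a::field set)"
  by (simp add: field_class.field_divide_inverse sfd_mult sfd_inverse)

lemma sfd_power: "sfd F \<Longrightarrow> x \<in> F \<Longrightarrow> x ^ n \<in> (F :: 'a::field set)"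
  by (induction n) (auto simp: sfd_1 sfd_mult)

lemma sfd_sum: "sfd F \<Longrightarrow> (\<And>i. i \<in> A \<Longrightarrow> f i \<in> F) \<Longrightarrow> sum f A \<in> (F :: 'a::field set)"
  by (induction A rule: infinite_finite_induct) (auto simp: sfd_0 sfd_add)

lemma sfd_prod: "sfd F \<Longrightarrow> (\<And>i. i \<in> A \<Longrightarrow> f i \<in> F) \<Longrightarrow> prod f A \<in> (F :: 'a::field set)"
  by (induction A rule: infinite_finite_induct) (auto simp: sfd_1 sfd_mult)

lemmas sfd_closed = sfd_0 sfd_1 sfd_add sfd_mult sfd_uminus sfd_inverse sfd_diff sfd_divide
  sfd_power sfd_sum sfd_prod


subsection \<open>Dimension over a subfield\<close>

definition fin_over :: "'a::field set \<Rightarrow> 'a set \<Rightarrow> bool" where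
  "fin_over F V \<longleftrightarrow> ring.finite_dimension ring_of_type_algebra F V"

definition field_deg :: "'a::field set \<Rightarrow> 'a set \<Rightarrow> nat" where
  "field_deg F V = (ring.dim ring_of_type_algebra over F) V"

lemma field_deg_dimension:
  "sfd F \<Longrightarrow> fin_over F V \<Longrightarrow> ring.dimension ring_of_type_algebra (field_deg F V) F V"
  unfolding fin_over_def field_deg_def by (rule TA.finite_dimensionE)

lemma field_degI:
  "sfd F \<Longrightarrow> ring.dimension ring_of_type_algebra n F V \<Longrightarrow> fin_over F V \<and> field_deg F V = n"
  unfolding fin_over_def field_deg_def by (auto intro: TA.dimI TA.finite_dimensionI)

lemma TA_combine_map:
  "ring.combine ring_of_type_algebra (map a [0..<m]) (map b [0..<m])
     = (\<Sum>i<m. a i * (b i :: 'a::field))"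
proof -
  have "ring.combine ring_of_type_algebra (map a xs) (map b xs) = (\<Sum>i\<leftarrow>xs. a i * b i)" for xs
    by (induction xs) (auto simp: TA.combine.simps)
  thus ?thesis by (simp add: interv_sum_list_conv_sum_set_nat atLeast0LessThan)
qed

lemma TA_combine_nth:
  "length Ks = m \<Longrightarrow> length Us = m \<Longrightarrow> ring.combine ring_of_type_algebra Ks Us
     = (\<Sum>i<m. Ks ! i * (Us ! i :: 'a::field))"
  by (metis TA_combine_map map_nth)

lemma dependent_family:
  fixes b :: "nat \<Rightarrow> 'a::field"
  assumes F: "sfd F" and fin: "fin_over F V" and m: "field_deg F V < m" and b: "\<And>i. i < m \<Longrightarrow> b i \<in> V"
  obtains a where "\<forall>i. a i \<in> F" "\<exists>i<m. a i \<noteq> 0" "(\<Sum>i<m. a i * b i) = 0"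
proof -
  have "TA.dependent F (map b [0..<m])"
    using TA.independent_length_le_dimension[OF F field_deg_dimension[OF F fin], of "map b [0..<m]"] b m
    by (auto simp: image_subset_iff)
  then obtain Ks where Ks: "length Ks = m" "TA.combine Ks (map b [0..<m]) = 0" "set Ks \<subseteq> F" "set Ks \<noteq> {0}"
    using TA.dependent_imp_non_trivial_combine[OF F, of "map b [0..<m]"] by auto
  define a where "a = (\<lambda>i. if i < m then Ks ! i else 0)"
  show ?thesis
  proof
    show "\<forall>i. a i \<in> F" using Ks(1,3) sfd_0[OF F] by (auto simp: a_def subset_iff)
    show "\<exists>i<m. a i \<noteq> 0"
    proof (rule ccontr)
      assume "\<not> ?thesis"
      hence "set Ks \<subseteq> {0}" using Ks(1) by (auto simp: a_def in_set_conv_nth)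
      moreover have "Ks \<noteq> []" using m Ks(1) by auto
      ultimately show False using Ks(4) by (cases Ks) auto
    qed
    show "(\<Sum>i<m. a i * b i) = 0"
      using Ks(2) TA_combine_nth[OF Ks(1), of "map b [0..<m]"] by (simp add: a_def)
  qed
qed

definition vspan :: "'a::field set \<Rightarrow> (nat \<Rightarrow> 'a) \<Rightarrow> nat \<Rightarrow> 'a set" where
  "vspan F b m = {\<Sum>i<m. a i * b i | a. \<forall>i. a i \<in> F}"

lemma TA_Span_vspan:
  assumes F: "sfd F" shows "ring.Span ring_of_type_algebra F (map b [0..<m]) = vspan F b m"
proof -
  have "TA.Span F (map b [0..<m]) = {TA.combine Ks (map b [0..<m]) | Ks. length Ks = m \<and> set Ks \<subseteq> F}"
    using TA.Span_eq_combine_set_length_version[OF F, of "map b [0..<m]"] by simp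
  also have "\<dots> = vspan F b m"
  proof (safe)
    fix Ks assume Ks: "m = length Ks" "set Ks \<subseteq> F"
    show "TA.combine Ks (map b [0..<length Ks]) \<in> vspan F b (length Ks)"
      unfolding vspan_def using Ks TA_combine_nth[of Ks "length Ks" "map b [0..<length Ks]"] sfd_0[OF F]
      by (auto intro!: exI[of _ "\<lambda>i. if i < length Ks then Ks ! i else 0"] simp: subset_iff)
  next
    fix x assume "x \<in> vspan F b m"
    then obtain a where "\<forall>i. a i \<in> F" "x = (\<Sum>i<m. a i * b i)" by (auto simp: vspan_def)
    thus "\<exists>Ks. x = TA.combine Ks (map b [0..<m]) \<and> length Ks = m \<and> set Ks \<subseteq> F"
      by (intro exI[of _ "map a [0..<m]"]) (auto simp: TA_combine_map)
  qed
  finally show ?thesis .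
qed

lemma TA_Span_deg:
  assumes F: "sfd F"
  shows "fin_over F (ring.Span ring_of_type_algebra F Us)"
    "field_deg F (ring.Span ring_of_type_algebra F Us) \<le> length Us"
proof -
  have "\<exists>n\<le>length Us. TA.dimension n F (TA.Span F Us)"
  proof (induction Us)
    case Nil thus ?case by (auto intro: TA.zero_dim[simplified])
  next
    case (Cons u Us)
    show ?case
    proof (cases "u \<in> TA.Span F Us")
      case True
      hence "TA.Span F (u # Us) = TA.Span F Us"
        using TA.Span_base_incl[OF F, of Us] TA.mono_Span_subset[OF F, of "u # Us" Us] TA.mono_Span[OF F, of Us u]
        by auto
      thus ?thesis using Cons by (metis le_SucI length_Cons)
    next
      case False
      thus ?thesis using Cons TA.Suc_dim[of u "TA.Span F Us" _ F] by auto
    qed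
  qed
  thus "fin_over F (TA.Span F Us)" "field_deg F (TA.Span F Us) \<le> length Us"
    using field_degI[OF F] by auto
qed

lemma vspan_deg:
  assumes "sfd F" shows "fin_over F (vspan F b m)" "field_deg F (vspan F b m) \<le> m"
  using TA_Span_deg[OF assms, of "map b [0..<m]"] unfolding TA_Span_vspan[OF assms] by simp_all

definition subspc :: "'a::field set \<Rightarrow> 'a set \<Rightarrow> bool" where
  "subspc F V \<longleftrightarrow> 0 \<in> V \<and> (\<forall>x\<in>V. \<forall>y\<in>V. x + y \<in> V) \<and> (\<forall>c\<in>F. \<forall>x\<in>V. c * x \<in> V)"

lemma subspc_sfd: "sfd L \<Longrightarrow> F \<subseteq> L \<Longrightarrow> subspc F L"
  by (auto simp: subspc_def sfd_closed)

lemma subspc_sum: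
  "subspc F V \<Longrightarrow> (\<And>i. i \<in> A \<Longrightarrow> a i \<in> F \<and> b i \<in> V) \<Longrightarrow> (\<Sum>i\<in>A. a i * b i) \<in> V"
  by (induction A rule: infinite_finite_induct) (auto simp: subspc_def)

lemma subspc_vspan:
  assumes F: "sfd F" shows "subspc F (vspan F b m)"
  unfolding subspc_def
proof (intro conjI ballI)
  show "0 \<in> vspan F b m" unfolding vspan_def using sfd_0[OF F] by (auto intro!: exI[of _ "\<lambda>_. 0"])
next
  fix x y assume "x \<in> vspan F b m" "y \<in> vspan F b m"
  then obtain a a' where "\<forall>i. a i \<in> F" "x = (\<Sum>i<m. a i * b i)" "\<forall>i. a' i \<in> F" "y = (\<Sum>i<m. a' i * b i)"
    by (auto simp: vspan_def)
  thus "x + y \<in> vspan F b m" unfolding vspan_def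
    by (auto intro!: exI[of _ "\<lambda>i. a i + a' i"] simp: sfd_add[OF F] sum.distrib algebra_simps)
next
  fix c x assume "c \<in> F" "x \<in> vspan F b m"
  then obtain a where "\<forall>i. a i \<in> F" "x = (\<Sum>i<m. a i * b i)" by (auto simp: vspan_def)
  thus "c * x \<in> vspan F b m" using \<open>c \<in> F\<close> unfolding vspan_def
    by (auto intro!: exI[of _ "\<lambda>i. c * a i"] simp: sfd_mult[OF F] sum_distrib_left mult.assoc)
qed

text \<open>A longest independent list in \<open>V\<close> exists because of the bound, and it spans
  \<open>V\<close>; so finiteness comes out together with the bound. The criterion serves where
  linear relations are carried from one field to another and no spanning family is at hand.\<close>

lemma field_deg_leI:
  fixes V :: "'a::field set"
  assumes F: "sfd F" and V: "subspc F V"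
    and dep: "\<And>b. (\<And>i. i \<le> m \<Longrightarrow> b i \<in> V) \<Longrightarrow>
      \<exists>a. (\<forall>i\<le>m. a i \<in> F) \<and> (\<exists>i\<le>m. a i \<noteq> 0) \<and> (\<Sum>i\<le>m. a i * b i) = 0"
  shows "fin_over F V \<and> field_deg F V \<le> m"
proof -
  let ?P = "\<lambda>Us. TA.independent F Us \<and> set Us \<subseteq> V"
  have bound: "length Us \<le> m" if "?P Us" for Us
  proof (rule ccontr)
    assume "\<not> length Us \<le> m"
    hence l: "m < length Us" by simp
    have "Us ! i \<in> V" if "i \<le> m" for i using that l \<open>?P Us\<close> by (auto simp: subset_iff)
    from dep[of "\<lambda>i. Us ! i", OF this] obtain a where a: "\<forall>i\<le>m. a i \<in> F" "\<exists>i\<le>m. a i \<noteq> 0" "(\<Sum>i\<le>m. a i * Us ! i) = 0"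
      by auto
    define a' where "a' = (\<lambda>i. if i \<le> m then a i else 0)"
    have "TA.combine (map a' [0..<length Us]) Us = (\<Sum>i<length Us. a' i * Us ! i)"
      by (subst TA_combine_nth[of _ "length Us"]) auto
    also have "\<dots> = (\<Sum>i\<le>m. a i * Us ! i)"
      by (rule sum.mono_neutral_cong_right) (use l in \<open>auto simp: a'_def\<close>)
    finally have "TA.combine (map a' [0..<length Us]) Us = 0" using a by simp
    hence "set (take (length Us) (map a' [0..<length Us])) \<subseteq> {0}"
      using TA.independent_imp_trivial_combine[OF F, of Us "map a' [0..<length Us]"] that a(1) sfd_0[OF F]
      by (auto simp: a'_def)
    moreover obtain i where "i \<le> m" "a i \<noteq> 0" using a by auto
    ultimately show False using l by (auto simp: a'_def image_subset_iff split: if_splits)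
  qed
  define Q where "Q = (\<lambda>n. \<exists>Us. ?P Us \<and> length Us = n)"
  define n where "n = Greatest Q"
  have ex: "Q 0" unfolding Q_def by (auto intro: exI[of _ "[]"])
  have le: "k \<le> m" if "Q k" for k using that bound by (auto simp: Q_def)
  have "Q n" unfolding n_def by (rule GreatestI_nat[where P = Q, OF ex le])
  hence "\<exists>Us. ?P Us \<and> length Us = n" by (simp add: Q_def)
  then obtain Us where Us: "?P Us" "length Us = n" by auto
  \<comment> \<open>A vector outside the span could be prepended to \<open>Us\<close>, against its
    maximal length.\<close>
  have "u \<in> TA.Span F Us" if "u \<in> V" for u
  proof (rule ccontr)
    assume "u \<notin> TA.Span F Us"
    hence "?P (u # Us)" using Us that by (auto intro: TA.li_Cons)
    hence "Q (Suc n)" unfolding Q_def using Us by (intro exI[of _ "u # Us"]) auto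
    hence "Suc n \<le> n" unfolding n_def using le by (rule Greatest_le_nat)
    thus False by simp
  qed
  moreover have "TA.Span F Us \<subseteq> V"
  proof
    fix x assume "x \<in> TA.Span F Us"
    then obtain Ks where Ks: "set Ks \<subseteq> F" "length Ks = length Us" "x = TA.combine Ks Us"
      using TA.Span_mem_iff_length_version[OF F, of Us x] by auto
    have "x = (\<Sum>i<length Us. Ks ! i * Us ! i)" using Ks by (simp add: TA_combine_nth)
    also have "\<dots> \<in> V" by (rule subspc_sum[OF V]) (use Ks Us in \<open>auto simp: subset_iff\<close>)
    finally show "x \<in> V" .
  qed
  ultimately have "V = TA.Span F Us" by auto
  thus ?thesis using TA_Span_deg[OF F, of Us] bound Us by fastforce
qed

lemma field_deg_mono:
  fixes V :: "'a::field set"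
  assumes F: "sfd F" and V: "subspc F V" "V \<subseteq> W" and W: "fin_over F W"
  shows "fin_over F V" "field_deg F V \<le> field_deg F W"
proof -
  have "fin_over F V \<and> field_deg F V \<le> field_deg F W"
  proof (rule field_deg_leI[OF F V(1)])
    fix b assume "\<And>i. i \<le> field_deg F W \<Longrightarrow> b i \<in> V"
    hence "\<And>i. i < Suc (field_deg F W) \<Longrightarrow> b i \<in> W" using V(2) by auto
    then obtain a where
      "\<forall>i. a i \<in> F" "\<exists>i<Suc (field_deg F W). a i \<noteq> 0" "(\<Sum>i<Suc (field_deg F W). a i * b i) = 0"
      by (rule dependent_family[OF F W lessI])
    thus "\<exists>a. (\<forall>i\<le>field_deg F W. a i \<in> F) \<and> (\<exists>i\<le>field_deg F W. a i \<noteq> 0) \<and> (\<Sum>i\<le>field_deg F W. a i * b i) = 0"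
      by (intro exI[of _ a]) (auto simp: lessThan_Suc_atMost less_Suc_eq_le)
  qed
  thus "fin_over F V" "field_deg F V \<le> field_deg F W" by auto
qed

lemma field_deg_tower:
  assumes "sfd F" "sfd M" "fin_over F M" "fin_over M L"
  shows "fin_over F L" "field_deg F L = field_deg F M * field_deg M L"
  using TA.telescopic_base_dim[OF assms(1,2)] assms(3,4) unfolding fin_over_def field_deg_def by auto

lemma fin_over_spanning:
  assumes F: "sfd F" and fin: "fin_over F V"
  obtains b where "V = vspan F b (field_deg F V)"
proof -
  from TA.exists_base[OF F field_deg_dimension[OF F fin]] obtain Vs where
    Vs: "length Vs = field_deg F V" "TA.Span F Vs = V" by auto
  show ?thesis
    by (rule that[of "\<lambda>i. Vs ! i"]) (metis Vs TA_Span_vspan[OF F] map_nth)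
qed

lemma field_deg_pos:
  assumes F: "sfd F" and fin: "fin_over F V" and x: "x \<in> V" "x \<noteq> 0"
  shows "field_deg F V > 0"
proof (rule ccontr)
  assume "\<not> ?thesis"
  moreover obtain b where "V = vspan F b (field_deg F V)" using fin_over_spanning[OF F fin] .
  ultimately show False using x by (auto simp: vspan_def)
qed

lemma vspan_mem: "sfd F \<Longrightarrow> i < m \<Longrightarrow> b i \<in> vspan F b m"
  unfolding vspan_def
  by (auto intro!: exI[of _ "\<lambda>j. if j = i then 1 else 0"] simp: sfd_closed if_distrib [of "\<lambda>x. x * _"] cong: if_cong)


subsection \<open>Polynomials over a subfield\<close>

definition Pol :: "'a::field set \<Rightarrow> 'a poly set" where
  "Pol F = {P. \<forall>i. coeff P i \<in> F}"

lemma Pol_coeff: "P \<in> Pol F \<Longrightarrow> coeff P i \<in> F" by (simp add: Pol_def)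

lemma Pol_mono: "F \<subseteq> F' \<Longrightarrow> Pol F \<subseteq> Pol F'" by (auto simp: Pol_def)

lemma
  assumes F: "sfd (F :: 'a::field set)"
  shows Pol_0: "0 \<in> Pol F" and Pol_1: "1 \<in> Pol F"
    and Pol_pCons: "\<And>c P. c \<in> F \<Longrightarrow> P \<in> Pol F \<Longrightarrow> pCons c P \<in> Pol F"
    and Pol_add: "\<And>P Q. P \<in> Pol F \<Longrightarrow> Q \<in> Pol F \<Longrightarrow> P + Q \<in> Pol F"
    and Pol_diff: "\<And>P Q. P \<in> Pol F \<Longrightarrow> Q \<in> Pol F \<Longrightarrow> P - Q \<in> Pol F"
    and Pol_uminus: "\<And>P. P \<in> Pol F \<Longrightarrow> - P \<in> Pol F"
    and Pol_mult: "\<And>P Q. P \<in> Pol F \<Longrightarrow> Q \<in> Pol F \<Longrightarrow> P * Q \<in> Pol F"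
    and Pol_smult: "\<And>c P. c \<in> F \<Longrightarrow> P \<in> Pol F \<Longrightarrow> smult c P \<in> Pol F"
    and Pol_monom: "\<And>c n. c \<in> F \<Longrightarrow> Polynomial.monom c n \<in> Pol F"
    and Pol_poly: "\<And>P x. P \<in> Pol F \<Longrightarrow> x \<in> F \<Longrightarrow> poly P x \<in> F"
  using F by (auto simp: Pol_def coeff_pCons coeff_mult poly_altdef sfd_closed split: nat.splits)

lemma Pol_power: "sfd F \<Longrightarrow> P \<in> Pol F \<Longrightarrow> P ^ n \<in> Pol F"
  by (induction n) (auto simp: Pol_1 Pol_mult)

lemma Pol_sum: "sfd F \<Longrightarrow> (\<And>i. i \<in> A \<Longrightarrow> f i \<in> Pol F) \<Longrightarrow> sum f A \<in> Pol F"
  by (induction A rule: infinite_finite_induct) (auto simp: Pol_0 Pol_add)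

lemma Pol_prod: "sfd F \<Longrightarrow> (\<And>i. i \<in> A \<Longrightarrow> f i \<in> Pol F) \<Longrightarrow> prod f A \<in> Pol F"
  by (induction A rule: infinite_finite_induct) (auto simp: Pol_1 Pol_mult)

lemmas Pol_closed = Pol_0 Pol_1 Pol_pCons Pol_add Pol_diff Pol_uminus Pol_mult Pol_smult Pol_monom
  Pol_power Pol_sum Pol_prod

lemma Pol_divmod:
  assumes F: "sfd F" and P: "P \<in> Pol F" "P \<noteq> 0" and Q: "Q \<in> Pol F"
  obtains A B where "A \<in> Pol F" "B \<in> Pol F" "Q = A * P + B" "B = 0 \<or> degree B < degree P"
proof -
  have "\<exists>A\<in>Pol F. \<exists>B\<in>Pol F. Q = A * P + B \<and> (B = 0 \<or> degree B < degree P)"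
    using Q
  proof (induction "degree Q" arbitrary: Q rule: less_induct)
    case less
    show ?case
    proof (cases "degree Q < degree P \<or> Q = 0")
      case True thus ?thesis using less.prems by (intro bexI[of _ 0] bexI[of _ Q]) (auto simp: Pol_0[OF F])
    next
      case False
      define c where "c = lead_coeff Q / lead_coeff P"
      define M where "M = Polynomial.monom c (degree Q - degree P)"
      have c: "c \<in> F" unfolding c_def by (intro sfd_divide F Pol_coeff less.prems P)
      have M: "M \<in> Pol F" unfolding M_def by (intro Pol_closed F c)
      define Q' where "Q' = Q - M * P"
      have Q': "Q' \<in> Pol F" unfolding Q'_def by (intro Pol_closed F M P less.prems)
      have c0: "c \<noteq> 0" using False P by (simp add: c_def)
      have dM: "degree (M * P) = degree Q"
        using False P c0 by (simp add: M_def degree_mult_eq degree_monom_eq monom_eq_0_iff)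
      have "lead_coeff (M * P) = lead_coeff M * lead_coeff P" by (rule lead_coeff_mult)
      also have "\<dots> = lead_coeff Q" using P by (simp add: M_def c0 degree_monom_eq, simp add: c_def)
      finally have dM: "degree (M * P) = degree Q" "lead_coeff (M * P) = lead_coeff Q" using dM by auto
      show ?thesis
      proof (cases "degree Q = 0")
        case True
        hence "M * P = Q" using dM
          by (intro poly_eqI) (metis coeff_eq_0 gr0I)
        hence "Q' = 0" unfolding Q'_def by simp
        thus ?thesis by (intro bexI[OF _ M] bexI[of _ 0]) (auto simp: Q'_def Pol_0[OF F])
      next
        case False
        have "degree Q' < degree Q"
        proof (rule degree_lessI)
          show "Q' \<noteq> 0 \<or> 0 < degree Q" using False by simp
          show "\<forall>k\<ge>degree Q. coeff Q' k = 0"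
          proof (intro allI impI)
            fix k assume "k \<ge> degree Q"
            thus "coeff Q' k = 0" using dM unfolding Q'_def
              by (cases "k = degree Q") (auto simp: coeff_eq_0)
          qed
        qed
        from less.hyps[OF this Q'] obtain A B where "A \<in> Pol F" "B \<in> Pol F" "Q' = A * P + B"
          "B = 0 \<or> degree B < degree P" by auto
        thus ?thesis by (intro bexI[of _ "A + M"] bexI[of _ B])
            (auto simp: Q'_def algebra_simps Pol_add[OF F] M)
      qed
    qed
  qed
  thus ?thesis using that by blast
qed

definition alg_over :: "'a::field set \<Rightarrow> 'a \<Rightarrow> bool" where
  "alg_over F x \<longleftrightarrow> (\<exists>P\<in>Pol F. P \<noteq> 0 \<and> poly P x = 0)"

lemma alg_over_mono: "alg_over F x \<Longrightarrow> F \<subseteq> F' \<Longrightarrow> alg_over F' x"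
  using Pol_mono unfolding alg_over_def by blast

lemma poly_sum_lessThan: "coeff (\<Sum>i<m. Polynomial.monom (a i) i) j = (if j < m then a j else 0)"
  by (simp add: coeff_sum if_distrib cong: if_cong)

lemma fin_over_poly:
  assumes F: "sfd F" and fin: "fin_over F V" and x: "\<And>i. x ^ i \<in> V"
  obtains P where "P \<in> Pol F" "P \<noteq> 0" "degree P \<le> field_deg F V" "poly P x = 0"
proof -
  let ?n = "field_deg F V"
  obtain a where a: "\<forall>i. a i \<in> F" "\<exists>i<Suc ?n. a i \<noteq> 0" "(\<Sum>i<Suc ?n. a i * x ^ i) = 0"
    by (rule dependent_family[OF F fin lessI, of "\<lambda>i. x ^ i"]) (use x in auto)
  define P where "P = (\<Sum>i<Suc ?n. Polynomial.monom (a i) i)"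
  have c: "coeff P j = (if j < Suc ?n then a j else 0)" for j unfolding P_def by (rule poly_sum_lessThan)
  show ?thesis
  proof
    show "P \<in> Pol F" unfolding P_def by (intro Pol_closed F a(1)[rule_format])
    from a(2) obtain i where "i < Suc ?n" "a i \<noteq> 0" by blast
    hence "coeff P i \<noteq> 0" by (simp add: c)
    thus "P \<noteq> 0" by auto
    show "degree P \<le> ?n" by (rule degree_le) (auto simp: c)
    show "poly P x = 0" using a(3) by (simp add: P_def poly_sum poly_monom del: sum.lessThan_Suc)
  qed
qed

lemma fin_over_alg:
  assumes "sfd F" "fin_over F V" "\<And>i. x ^ i \<in> V" shows "alg_over F x"
proof -
  obtain P where "P \<in> Pol F" "P \<noteq> 0" "poly P x = 0" using fin_over_poly[OF assms] by metis
  thus ?thesis by (auto simp: alg_over_def)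
qed

text \<open>A relation of least degree for \<open>x \<noteq> 0\<close> has a nonzero constant term,
  since otherwise it could be divided by \<open>x\<close>; solving it for that term expresses the
  inverse of \<open>x\<close> as a polynomial in \<open>x\<close>.\<close>

lemma sfd_of_fin_over:
  fixes A :: "'a::field set"
  assumes F: "sfd F" "F \<subseteq> A" and A: "\<And>x y. x \<in> A \<Longrightarrow> y \<in> A \<Longrightarrow> x + y \<in> A"
    "\<And>x y. x \<in> A \<Longrightarrow> y \<in> A \<Longrightarrow> x * y \<in> A" and alg: "\<And>x. x \<in> A \<Longrightarrow> alg_over F x"
  shows "sfd A"
proof (rule sfdI)
  have m1: "-1 \<in> A" "1 \<in> A" "0 \<in> A" using F sfd_closed[OF F(1)] by auto
  have m: "- x \<in> A" if "x \<in> A" for x using A(2)[OF m1(1) that] by simp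
  show "1 \<in> A" by fact
  show "x - y \<in> A" if "x \<in> A" "y \<in> A" for x y using A(1)[OF that(1) m[OF that(2)]] by simp
  show "x * y \<in> A" if "x \<in> A" "y \<in> A" for x y using A(2) that .
  have pw: "x ^ n \<in> A" if "x \<in> A" for x n using that by (induction n) (auto intro: A m1)
  have ev: "poly P x \<in> A" if "P \<in> Pol F" "x \<in> A" for P x
  proof -
    have "(\<Sum>i\<in>I. coeff P i * x ^ i) \<in> A" for I
      using that by (induction I rule: infinite_finite_induct)
        (auto intro!: A pw m1 simp: Pol_def subsetD[OF F(2)])
    thus ?thesis by (simp add: poly_altdef)
  qed
  show "inverse x \<in> A" if x: "x \<in> A" "x \<noteq> 0" for x
  proof -
    have "\<exists>P. P \<in> Pol F \<and> P \<noteq> 0 \<and> poly P x = 0" using alg[OF x(1)] by (auto simp: alg_over_def)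
    from ex_has_least_nat[of "\<lambda>P. P \<in> Pol F \<and> P \<noteq> 0 \<and> poly P x = 0", OF someI_ex[OF this], of degree]
    obtain P where P: "P \<in> Pol F" "P \<noteq> 0" "poly P x = 0"
      and min: "\<And>Q. Q \<in> Pol F \<Longrightarrow> Q \<noteq> 0 \<Longrightarrow> poly Q x = 0 \<Longrightarrow> degree P \<le> degree Q" by auto
    obtain c Q where PQ: "P = pCons c Q" by (cases P)
    have Q: "Q \<in> Pol F" "c \<in> F"
      using Pol_coeff[OF P(1), of "Suc i" for i] Pol_coeff[OF P(1), of 0] by (auto simp: PQ Pol_def)
    have c: "c \<noteq> 0"
    proof
      assume "c = 0"
      hence "poly Q x = 0" "Q \<noteq> 0" using P x PQ by auto
      with min[OF Q(1)] have "degree P \<le> degree Q" by auto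
      thus False using PQ \<open>Q \<noteq> 0\<close> by simp
    qed
    have "c + x * poly Q x = 0" using P(3) PQ by simp
    hence "x * (- poly Q x / c) = 1" using c by (simp add: field_simps add_eq_0_iff)
    hence "inverse x = - inverse c * poly Q x"
      using inverse_unique[of x "- poly Q x / c"] by (simp add: divide_inverse)
    also have "\<dots> \<in> A" by (intro A ev Q x m subsetD[OF F(2)] sfd_inverse F)
    finally show ?thesis .
  qed
qed


subsection \<open>Generated subfields\<close>

definition gen :: "'a::field set \<Rightarrow> 'a set \<Rightarrow> 'a set" where
  "gen F S = generate_field ring_of_type_algebra (F \<union> S)"

lemma gen_sfd: "sfd (gen F S)"
  unfolding gen_def by (rule field.generate_field_is_subfield[OF field_from_type_algebra]) simp

lemma gen_base: "F \<subseteq> gen F S" and gen_gens: "S \<subseteq> gen F S"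
  unfolding gen_def by (auto intro: generate_field.incl)

lemma gen_min: "sfd M \<Longrightarrow> F \<subseteq> M \<Longrightarrow> S \<subseteq> M \<Longrightarrow> gen F S \<subseteq> M"
  unfolding gen_def by (rule field.generate_field_min_subfield1[OF field_from_type_algebra]) auto

lemma gen_mono: "F \<subseteq> gen F' S' \<Longrightarrow> S \<subseteq> gen F' S' \<Longrightarrow> gen F S \<subseteq> gen F' S'"
  by (rule gen_min[OF gen_sfd])

lemma gen_gen: "gen (gen F S) T = gen F (S \<union> T)"
proof
  show "gen (gen F S) T \<subseteq> gen F (S \<union> T)"
    using gen_base[of F "S \<union> T"] gen_gens[of "S \<union> T" F] by (intro gen_mono) auto
  show "gen F (S \<union> T) \<subseteq> gen (gen F S) T"
    using gen_base[of "gen F S" T] gen_gens[of T "gen F S"] gen_base[of F S] gen_gens[of S F]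
    by (intro gen_mono) auto
qed

lemma gen_empty: "sfd F \<Longrightarrow> gen F {} = F"
  using gen_base gen_min[of F F "{}"] by auto

lemma gen_eqI: "S \<subseteq> gen F T \<Longrightarrow> T \<subseteq> gen F S \<Longrightarrow> gen F S = gen F T"
  by (intro equalityI gen_mono gen_base)

text \<open>The polynomial values at \<open>x\<close> form a ring, which division by
  \<open>P\<close> places inside a finite-dimensional span. Its elements are therefore algebraic
  over \<open>F\<close>, so the ring is already a field.\<close>

lemma simple_extension:
  assumes F: "sfd F" and P: "P \<in> Pol F" "P \<noteq> 0" "poly P x = 0"
  shows "gen F {x} \<subseteq> {poly Q x | Q. Q \<in> Pol F}" "gen F {x} \<subseteq> vspan F (\<lambda>i. x ^ i) (degree P)"
proof -
  define A where "A = {poly Q x | Q. Q \<in> Pol F}"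
  have A: "A \<subseteq> vspan F (\<lambda>i. x ^ i) (degree P)"
  proof
    fix y assume "y \<in> A"
    then obtain Q where Q: "Q \<in> Pol F" "y = poly Q x" by (auto simp: A_def)
    obtain R S where RS: "R \<in> Pol F" "S \<in> Pol F" "Q = R * P + S" "S = 0 \<or> degree S < degree P"
      using Pol_divmod[OF F P(1,2) Q(1)] by metis
    have "y = poly S x" using Q RS P by simp
    also have "\<dots> = (\<Sum>i\<le>degree S. coeff S i * x ^ i)" by (simp add: poly_altdef)
    also have "\<dots> = (\<Sum>i<degree P. coeff S i * x ^ i)"
    proof (cases "S = 0")
      case False
      thus ?thesis using RS(4) by (intro sum.mono_neutral_left) (auto simp: coeff_eq_0)
    qed simp
    finally show "y \<in> vspan F (\<lambda>i. x ^ i) (degree P)" using RS(2) by (auto simp: vspan_def Pol_def)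
  qed
  have FA: "F \<subseteq> A"
  proof
    fix c assume "c \<in> F"
    thus "c \<in> A" unfolding A_def by (auto intro!: exI[of _ "[:c:]"] Pol_closed F)
  qed
  have Aadd: "a + b \<in> A" and Amul: "a * b \<in> A" if ab: "a \<in> A" "b \<in> A" for a b
  proof -
    obtain P Q where PQ: "P \<in> Pol F" "Q \<in> Pol F" "a = poly P x" "b = poly Q x" using ab by (auto simp: A_def)
    show "a + b \<in> A" using PQ Pol_add[OF F PQ(1,2)] unfolding A_def by (metis (mono_tags, lifting) mem_Collect_eq poly_add)
    show "a * b \<in> A" using PQ Pol_mult[OF F PQ(1,2)] unfolding A_def by (metis (mono_tags, lifting) mem_Collect_eq poly_mult)
  qed
  have sub: "subspc F A" unfolding subspc_def using FA Aadd Amul sfd_0[OF F] by blast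
  have xA: "x \<in> A" unfolding A_def by (auto intro!: exI[of _ "[:0, 1:]"] Pol_closed F sfd_closed)
  note dA = field_deg_mono[OF F sub A vspan_deg(1)[OF F]]
  have pw: "a ^ n \<in> A" if "a \<in> A" for a n
    using that by (induction n) (use FA sfd_1[OF F] Amul in auto)
  have "sfd A" by (rule sfd_of_fin_over[OF F FA Aadd Amul fin_over_alg[OF F dA(1) pw]])
  hence g: "gen F {x} \<subseteq> A" using FA xA by (intro gen_min) auto
  show "gen F {x} \<subseteq> {poly Q x | Q. Q \<in> Pol F}" "gen F {x} \<subseteq> vspan F (\<lambda>i. x ^ i) (degree P)"
    using g A by (auto simp: A_def)
qed

lemma simple_deg:
  assumes F: "sfd F" and P: "P \<in> Pol F" "P \<noteq> 0" "poly P x = 0"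
  shows "fin_over F (gen F {x})" "field_deg F (gen F {x}) \<le> degree P"
  using field_deg_mono[OF F subspc_sfd[OF gen_sfd gen_base] simple_extension(2)[OF F P] vspan_deg(1)[OF F]]
    vspan_deg(2)[OF F] le_trans by blast+

lemma simple_alg_elem:
  assumes F: "sfd F" and x: "alg_over F x" and y: "y \<in> gen F {x}"
  obtains P where "P \<in> Pol F" "y = poly P x"
proof -
  obtain P where "P \<in> Pol F" "P \<noteq> 0" "poly P x = 0" using x by (auto simp: alg_over_def)
  from simple_extension(1)[OF F this] y that show ?thesis by blast
qed

lemma fin_over_gen:
  assumes F: "sfd F" and S: "finite S" "\<And>x. x \<in> S \<Longrightarrow> alg_over F x"
  shows "fin_over F (gen F S)"
  using S
proof (induction S)
  case empty
  have "fin_over F F" using field_degI[OF F TA.dimension_one[OF F]] by simp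
  thus ?case by (simp add: gen_empty F)
next
  case (insert x S)
  have "alg_over (gen F S) x" by (rule alg_over_mono[OF _ gen_base]) (use insert in auto)
  then obtain P where "P \<in> Pol (gen F S)" "P \<noteq> 0" "poly P x = 0" by (auto simp: alg_over_def)
  from simple_deg(1)[OF gen_sfd this] have "fin_over (gen F S) (gen F (S \<union> {x}))" by (simp add: gen_gen)
  with field_deg_tower(1)[OF F gen_sfd _ this] insert show ?case by simp
qed

text \<open>A basis of \<open>L\<close> over \<open>F\<close> also spans a ring over
  \<open>F'\<close>, because products of basis elements stay in \<open>L\<close>. This ring is a
  field and contains the compositum.\<close>

lemma compositum_deg:
  assumes F: "sfd F" and L: "sfd L" "F \<subseteq> L" "fin_over F L" and F': "sfd F'" "F \<subseteq> F'" and S: "S \<subseteq> L"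
  shows "fin_over F' (gen F' S)" "field_deg F' (gen F' S) \<le> field_deg F L"
proof -
  let ?m = "field_deg F L"
  obtain b where b: "L = vspan F b ?m" using fin_over_spanning[OF F L(3)] .
  define A where "A = vspan F' b ?m"
  have LA: "L \<subseteq> A" unfolding A_def by (subst b) (use F'(2) in \<open>fastforce simp: vspan_def\<close>)
  have sub: "subspc F' A" unfolding A_def by (rule subspc_vspan[OF F'(1)])
  have bL: "b i \<in> L" if "i < ?m" for i by (subst b) (rule vspan_mem[OF F that])
  have "1 \<in> A" using LA sfd_1[OF L(1)] by auto
  hence FA: "F' \<subseteq> A" using sub unfolding subspc_def by (metis mult.right_neutral subsetI)
  have Aadd: "x + y \<in> A" if "x \<in> A" "y \<in> A" for x y using sub that by (auto simp: subspc_def)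
  have Amul: "x * y \<in> A" if xy: "x \<in> A" "y \<in> A" for x y
  proof -
    obtain a a' where a: "\<forall>i. a i \<in> F'" "x = (\<Sum>i<?m. a i * b i)" "\<forall>i. a' i \<in> F'" "y = (\<Sum>i<?m. a' i * b i)"
      using xy by (auto simp: A_def vspan_def)
    have "x * y = (\<Sum>i<?m. a i * (\<Sum>j<?m. a' j * (b i * b j)))"
      unfolding a sum_product by (simp add: sum_distrib_left algebra_simps)
    also have "\<dots> \<in> A"
      by (intro subspc_sum[OF sub] conjI a(1)[rule_format] a(3)[rule_format])
        (use a bL LA sfd_mult[OF L(1)] in auto)
    finally show ?thesis .
  qed
  note dA = vspan_deg[OF F'(1), of b ?m, folded A_def]
  have pw: "a ^ n \<in> A" if "a \<in> A" for a n
    using that by (induction n) (use \<open>1 \<in> A\<close> Amul in auto)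
  have "sfd A" by (rule sfd_of_fin_over[OF F'(1) FA Aadd Amul fin_over_alg[OF F'(1) dA(1) pw]])
  hence g: "gen F' S \<subseteq> A" using FA S LA by (intro gen_min) auto
  note sub' = subspc_sfd[OF gen_sfd[of F' S] gen_base]
  show "fin_over F' (gen F' S)" by (rule field_deg_mono(1)[OF F'(1) sub' g dA(1)])
  show "field_deg F' (gen F' S) \<le> ?m"
    using field_deg_mono(2)[OF F'(1) sub' g dA(1)] dA(2) by simp
qed

lemma coeff_pair_sum:
  fixes A :: "nat \<Rightarrow> nat \<Rightarrow> 'a::field"
  shows "i0 \<le> a \<Longrightarrow> j0 \<le> b \<Longrightarrow> (\<Sum>i\<le>a. \<Sum>j\<le>b. if i = i0 \<and> j = j0 then A i j else 0) = A i0 j0"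
proof -
  assume *: "i0 \<le> a" "j0 \<le> b"
  have "(\<Sum>j\<le>b. if i = i0 \<and> j = j0 then A i j else 0) = (if i = i0 then A i0 j0 else 0)" for i
    using * by (cases "i = i0") auto
  thus ?thesis using * by simp
qed

subsection \<open>Bivariate polynomials\<close>

text \<open>A bivariate polynomial \<open>A(X, Y)\<close> is a polynomial in \<open>Y\<close> whose coefficients are
  polynomials in \<open>X\<close>, and \<open>spec A x\<close> is \<open>A(x, Y)\<close>.\<close>

definition spec :: "'a::field poly poly \<Rightarrow> 'a \<Rightarrow> 'a poly" where
  "spec A x = map_poly (\<lambda>p. poly p x) A"

lemma coeff_spec: "coeff (spec A x) i = poly (coeff A i) x"
  by (simp add: spec_def coeff_map_poly)

lemma spec_simps [simp]:
  "spec 0 x = 0"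
  "spec (pCons p A) x = pCons (poly p x) (spec A x)"
  "spec (smult p A) x = smult (poly p x) (spec A x)"
  "spec (A * B) x = spec A x * spec B x"
proof -
  show "spec 0 x = 0" by (simp add: spec_def)
  show "spec (pCons p A) x = pCons (poly p x) (spec A x)"
    by (rule poly_eqI) (simp add: coeff_spec coeff_pCons split: nat.splits)
  show "spec (smult p A) x = smult (poly p x) (spec A x)"
    by (rule poly_eqI) (simp add: coeff_spec)
  show "spec (A * B) x = spec A x * spec B x"
    by (rule poly_eqI) (simp add: coeff_spec coeff_mult poly_sum)
qed

definition BiPol :: "'a::field set \<Rightarrow> 'a poly poly set" where
  "BiPol F = {A. \<forall>i. coeff A i \<in> Pol F}"

lemma smult_linear_dvd:
  assumes "spec A c = (0 :: 'a::field poly)"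
  obtains A' where "A = smult [:- c, 1:] A'"
proof -
  have "[:[:- c, 1:]:] dvd A"
    by (simp add: const_poly_dvd_iff) (metis assms coeff_0 coeff_spec poly_eq_0_iff_dvd)
  then obtain A' where "A = [:[:- c, 1:]:] * A'" by (elim dvdE)
  thus ?thesis using that[of A'] by simp
qed

text \<open>Degrees in the inner variable add up under multiplication. In each factor take the last
  coefficient of maximal inner degree; the product of their leading terms cannot be
  cancelled.\<close>

lemma inner_degree_factor:
  fixes Q C :: "'a::field poly poly"
  assumes "Q \<noteq> 0" and a: "\<And>i. degree (coeff (Q * C) i) \<le> a"
  shows "degree (coeff C i) \<le> a"
proof (cases "C = 0")
  case False
  have top: "\<exists>m j. degree (coeff A j) = m \<and> coeff A j \<noteq> 0 \<and> (\<forall>i. degree (coeff A i) \<le> m) \<and>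
      (\<forall>i>j. coeff A i = 0 \<or> degree (coeff A i) < m)" if "A \<noteq> 0" for A :: "'a poly poly"
  proof -
    let ?S = "(\<lambda>i. degree (coeff A i)) ` {..degree A}"
    define m where "m = Max ?S"
    have le: "degree (coeff A i) \<le> m" for i
      unfolding m_def by (cases "i \<le> degree A") (auto intro!: Max_ge simp: coeff_eq_0)
    have "m \<in> ?S" unfolding m_def by (rule Max_in) auto
    then obtain i0 where i0: "degree (coeff A i0) = m" by auto
    have ex: "\<exists>i. coeff A i \<noteq> 0 \<and> degree (coeff A i) = m"
    proof (cases "coeff A i0 = 0")
      case True
      hence "m = 0" using i0 by simp
      thus ?thesis using le[of "degree A"] that by (intro exI[of _ "degree A"]) auto
    qed (use i0 in auto)
    define Q where "Q = (\<lambda>i. coeff A i \<noteq> 0 \<and> degree (coeff A i) = m)"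
    have bd: "y \<le> degree A" if "Q y" for y using that by (auto simp: Q_def le_degree)
    obtain i1 where "Q i1" using ex by (auto simp: Q_def)
    have Q: "Q (Greatest Q)" by (rule GreatestI_nat[where P = Q, OF \<open>Q i1\<close> bd])
    have gr: "y \<le> Greatest Q" if "Q y" for y using that bd by (rule Greatest_le_nat)
    show ?thesis
    proof (intro exI conjI allI impI)
      show "degree (coeff A (Greatest Q)) = m" "coeff A (Greatest Q) \<noteq> 0" using Q by (auto simp: Q_def)
      show "degree (coeff A i) \<le> m" for i by (rule le)
      show "coeff A i = 0 \<or> degree (coeff A i) < m" if "Greatest Q < i" for i
      proof (rule ccontr)
        assume "\<not> ?thesis"
        hence "Q i" using le[of i] by (auto simp: Q_def)
        from gr[OF this] that show False by simp
      qed
    qed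
  qed
  obtain m j where m: "degree (coeff Q j) = m" "coeff Q j \<noteq> 0" "\<And>i. degree (coeff Q i) \<le> m"
      "\<And>i. i > j \<Longrightarrow> coeff Q i = 0 \<or> degree (coeff Q i) < m" using top[OF \<open>Q \<noteq> 0\<close>] by blast
  obtain n l where n: "degree (coeff C l) = n" "coeff C l \<noteq> 0" "\<And>i. degree (coeff C i) \<le> n"
      "\<And>i. i > l \<Longrightarrow> coeff C i = 0 \<or> degree (coeff C i) < n" using top[OF False] by blast
  have "coeff (coeff (Q * C) (j + l)) (m + n)
      = (\<Sum>i\<le>j + l. coeff (coeff Q i * coeff C (j + l - i)) (m + n))"
    by (simp add: coeff_mult coeff_sum)
  \<comment> \<open>For \<open>i \<noteq> j\<close> one of the two indices lies beyond
    \<open>j\<close> or \<open>l\<close>, where the inner degree is below the maximum, so the term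
    does not reach degree \<open>m + n\<close>.\<close>
  also have "\<dots> = (\<Sum>i\<le>j + l. if i = j then coeff (coeff Q j * coeff C l) (m + n) else 0)"
  proof (rule sum.cong[OF refl])
    fix i assume i: "i \<in> {..j + l}"
    show "coeff (coeff Q i * coeff C (j + l - i)) (m + n) = (if i = j then coeff (coeff Q j * coeff C l) (m + n) else 0)"
    proof (cases "i = j")
      case ne: False
      have "coeff Q i * coeff C (j + l - i) = 0 \<or> degree (coeff Q i * coeff C (j + l - i)) < m + n"
      proof (cases "i > j")
        case True
        thus ?thesis using m(4)[OF True] n(3)[of "j + l - i"]
          by (auto intro: le_less_trans[OF degree_mult_le])
      next
        case False
        hence "j + l - i > l" using ne i by auto
        thus ?thesis using n(4)[of "j + l - i"] m(3)[of i]
          by (auto intro: le_less_trans[OF degree_mult_le])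
      qed
      thus ?thesis using ne by (auto simp: coeff_eq_0)
    qed simp
  qed
  also have "\<dots> = lead_coeff (coeff Q j) * lead_coeff (coeff C l)"
    using coeff_mult_degree_sum[of "coeff Q j" "coeff C l"] m(1) n(1) by simp
  finally have "coeff (coeff (Q * C) (j + l)) (m + n) \<noteq> 0" using m(2) n(2) by simp
  hence "m + n \<le> a" using a[of "j + l"] le_degree le_trans by blast
  thus ?thesis using n(3)[of i] by simp
qed simp


lemma sfd_gen_simple_elem:
  assumes K: "sfd F" and y: "y \<in> gen F {x}"
  obtains P Q where "P \<in> Pol F" "Q \<in> Pol F" "poly Q x \<noteq> 0" "y = poly P x / poly Q x"
proof -
  define A where "A = {poly P x / poly Q x | P Q. P \<in> Pol F \<and> Q \<in> Pol F \<and> poly Q x \<noteq> 0}"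
  have AI: "poly P x / poly Q x \<in> A" if "P \<in> Pol F" "Q \<in> Pol F" "poly Q x \<noteq> 0" for P Q
    using that by (auto simp: A_def)
  have "sfd A"
  proof (rule sfdI)
    show "1 \<in> A" using AI[of 1 1] by (simp add: Pol_closed[OF K])
  next
    fix a b assume "a \<in> A" "b \<in> A"
    then obtain P Q P' Q' where *: "P \<in> Pol F" "Q \<in> Pol F" "poly Q x \<noteq> 0" "a = poly P x / poly Q x"
      "P' \<in> Pol F" "Q' \<in> Pol F" "poly Q' x \<noteq> 0" "b = poly P' x / poly Q' x" by (auto simp: A_def)
    have "a - b = poly (P * Q' - P' * Q) x / poly (Q * Q') x" using * by (simp add: diff_frac_eq)
    also have "\<dots> \<in> A" using * by (intro AI Pol_closed K) auto
    finally show "a - b \<in> A" .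
    have "a * b = poly (P * P') x / poly (Q * Q') x" using * by simp
    also have "\<dots> \<in> A" using * by (intro AI Pol_closed K) auto
    finally show "a * b \<in> A" .
  next
    fix a assume "a \<in> A" "a \<noteq> 0"
    then obtain P Q where *: "P \<in> Pol F" "Q \<in> Pol F" "poly Q x \<noteq> 0" "a = poly P x / poly Q x"
      by (auto simp: A_def)
    thus "inverse a \<in> A" using AI[of Q P] \<open>a \<noteq> 0\<close> by simp
  qed
  moreover have "c \<in> A" if "c \<in> F" for c using AI[of "[:c:]" 1] that by (simp add: Pol_closed[OF K])
  moreover have "x \<in> A" using AI[of "[:0, 1:]" 1] by (simp add: Pol_closed[OF K] sfd_closed[OF K])
  ultimately have "gen F {x} \<subseteq> A" by (intro gen_min) auto
  thus ?thesis using y that by (auto simp: A_def)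
qed

text \<open>Turns relations over \<open>F(x)\<close> into bivariate polynomials over
  \<open>F\<close>, where the roles of the two variables can be exchanged.\<close>

lemma sfd_clear_denominators:
  assumes K: "sfd F" and P: "P \<in> Pol (gen F {x})"
  obtains D Q where "D \<in> Pol F" "poly D x \<noteq> 0" "Q \<in> BiPol F" "smult (poly D x) P = spec Q x"
proof -
  have "\<exists>D Q. D \<in> Pol F \<and> poly D x \<noteq> 0 \<and> Q \<in> BiPol F \<and> smult (poly D x) P = spec Q x"
    using P
  proof (induction P)
    case 0
    show ?case by (rule exI[of _ 1], rule exI[of _ 0]) (auto simp: BiPol_def Pol_closed[OF K])
  next
    case (pCons c P)
    have c: "c \<in> gen F {x}" using Pol_coeff[OF pCons.prems, of 0] by simp
    have "P \<in> Pol (gen F {x})" using Pol_coeff[OF pCons.prems, of "Suc i" for i] by (simp add: Pol_def)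
    from pCons.IH[OF this] obtain D Q where IH: "D \<in> Pol F" "poly D x \<noteq> 0" "Q \<in> BiPol F"
      "smult (poly D x) P = spec Q x" by blast
    obtain N M where NM: "N \<in> Pol F" "M \<in> Pol F" "poly M x \<noteq> 0" "c = poly N x / poly M x"
      by (rule sfd_gen_simple_elem[OF K c])
    have "pCons (N * D) (smult M Q) \<in> BiPol F"
      using IH NM by (auto simp: BiPol_def coeff_pCons Pol_mult[OF K] split: nat.splits)
    moreover have "smult (poly (M * D) x) (pCons c P) = spec (pCons (N * D) (smult M Q)) x"
      using NM IH(4)[symmetric] by (simp add: mult_ac)
    ultimately show ?case using IH NM
      by (intro exI[of _ "M * D"] exI[of _ "pCons (N * D) (smult M Q)"]) (auto simp: Pol_mult[OF K])
  qed
  thus ?thesis using that by blast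
qed

subsection \<open>Function fields in one variable over an algebraically closed constant field\<close>

text \<open>\<open>closed\<close> makes \<open>\<kappa>\<close> algebraically closed, because the
  ambient field is, and \<open>trdeg\<close> bounds the transcendence degree over it by one. No
  function field is fixed: the fields \<open>gen \<kappa> S\<close> with finite \<open>S\<close>
  take this role.\<close>

locale const_field =
  fixes \<kappa> :: "'a::alg_closed_field set"
  assumes K: "sfd \<kappa>"
    and closed: "\<And>P x. P \<in> Pol \<kappa> \<Longrightarrow> P \<noteq> 0 \<Longrightarrow> poly P x = 0 \<Longrightarrow> x \<in> \<kappa>"
    and trdeg: "\<And>x y. x \<notin> \<kappa> \<Longrightarrow> alg_over (gen \<kappa> {x}) y"
begin

lemma nonzero_at: "P \<in> Pol \<kappa> \<Longrightarrow> x \<notin> \<kappa> \<Longrightarrow> poly P x = 0 \<longleftrightarrow> P = 0"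
  using closed by auto

text \<open>Euclid's argument: one plus the product of all \<open>z - a\<close> has a root, which
  lies in \<open>\<kappa>\<close> but is none of the \<open>a\<close>.\<close>

lemma infinite_K: "infinite \<kappa>"
proof
  assume fin: "finite \<kappa>"
  define P where "P = (\<Prod>a\<in>\<kappa>. [:- a, 1:]) + 1"
  have "degree (\<Prod>a\<in>\<kappa>. [:- a, 1:]) = (\<Sum>a\<in>\<kappa>. 1)"
    by (subst degree_prod_eq_sum_degree) auto
  moreover have "card \<kappa> > 0" using fin sfd_0[OF K] by (auto simp: card_gt_0_iff)
  ultimately have "degree P > 0"
    unfolding P_def by (subst degree_add_eq_left) auto
  then obtain x where x: "poly P x = 0" using alg_closed_imp_poly_has_root by blast
  have "P \<in> Pol \<kappa>" unfolding P_def by (intro Pol_closed K sfd_closed)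
  hence "x \<in> \<kappa>" using x \<open>degree P > 0\<close> by (intro closed[of P]) auto
  hence "poly (\<Prod>a\<in>\<kappa>. [:- a, 1:]) x = 0" using fin by (auto simp: poly_prod)
  thus False using x by (simp add: P_def)
qed

lemma avoid_finite: "finite T \<Longrightarrow> \<exists>c\<in>\<kappa>. c \<notin> T"
  using infinite_K by (meson finite_subset subsetI)

text \<open>Subtracting the value at some \<open>c0\<close> and dividing by \<open>z - c0\<close>
  lowers the degree and preserves the hypothesis, with \<open>c0\<close> joining the exceptional
  set.\<close>

lemma Pol_of_values:
  assumes "finite T" "\<And>c. c \<in> \<kappa> - T \<Longrightarrow> poly F c \<in> \<kappa>"
  shows "F \<in> Pol \<kappa>"
  using assms
proof (induction "degree F" arbitrary: F T rule: less_induct)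
  case less
  obtain c0 where c0: "c0 \<in> \<kappa>" "c0 \<notin> T" using avoid_finite[OF less.prems(1)] by auto
  define F1 where "F1 = synthetic_div F c0"
  have F: "F = [:poly F c0:] + [:- c0, 1:] * F1"
    unfolding F1_def using synthetic_div_correct[of F c0] by (simp add: algebra_simps)
  show ?case
  proof (cases "degree F = 0")
    case True
    then obtain a where "F = [:a:]" by (metis degree_eq_zeroE)
    thus ?thesis using less.prems(2)[of c0] c0 by (auto intro!: Pol_closed K)
  next
    case False
    have "degree F1 < degree F" using False by (simp add: F1_def degree_synthetic_div)
    moreover have "poly F1 c \<in> \<kappa>" if "c \<in> \<kappa> - insert c0 T" for c
    proof -
      have "poly F c = poly F c0 + (c - c0) * poly F1 c" by (subst F) (simp add: algebra_simps)
      hence "poly F1 c = (poly F c - poly F c0) / (c - c0)" using that by (simp add: field_simps)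
      thus ?thesis using less.prems(2)[of c] less.prems(2)[of c0] that c0
        by (auto intro!: sfd_closed K)
    qed
    ultimately have "F1 \<in> Pol \<kappa>" using less.prems(1) by (intro less.hyps[of F1 "insert c0 T"]) auto
    thus ?thesis using less.prems(2)[of c0] c0
      by (subst F) (auto intro!: Pol_closed K sfd_closed)
  qed
qed

lemma Pol_factor: "[:- c, 1:] * p \<in> Pol \<kappa> \<Longrightarrow> c \<in> \<kappa> \<Longrightarrow> p \<in> Pol \<kappa>"
proof (rule Pol_of_values[of "{c}"])
  fix d assume *: "[:- c, 1:] * p \<in> Pol \<kappa>" "c \<in> \<kappa>" "d \<in> \<kappa> - {c}"
  have "poly ([:- c, 1:] * p) d = (d - c) * poly p d" by (simp add: algebra_simps)
  hence "poly p d = poly ([:- c, 1:] * p) d / (d - c)" using *(3) by simp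
  also have "\<dots> \<in> \<kappa>" using * by (intro sfd_closed Pol_poly K) auto
  finally show "poly p d \<in> \<kappa>" .
qed simp

lemmas clear_denominators = sfd_clear_denominators[OF K]

lemma spec_eq_0_iff: "A \<in> BiPol \<kappa> \<Longrightarrow> x \<notin> \<kappa> \<Longrightarrow> spec A x = 0 \<longleftrightarrow> A = 0"
  by (auto simp: poly_eq_iff[of "spec A x"] poly_eq_iff[of A] coeff_spec BiPol_def nonzero_at)

lemma degree_spec: assumes "A \<in> BiPol \<kappa>" "x \<notin> \<kappa>" shows "degree (spec A x) = degree A"
proof (rule antisym)
  show "degree (spec A x) \<le> degree A" by (rule degree_le) (auto simp: coeff_spec coeff_eq_0)
  show "degree A \<le> degree (spec A x)"
  proof (cases "A = 0")
    case False
    have "coeff (spec A x) (degree A) \<noteq> 0"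
      using assms False nonzero_at[of "lead_coeff A" x] by (auto simp: coeff_spec BiPol_def)
    thus ?thesis by (rule le_degree)
  qed simp
qed

lemma poly_spec: "poly (spec A x) y = (\<Sum>j\<le>degree A. poly (coeff A j) x * y ^ j)"
proof -
  have "degree (spec A x) \<le> degree A" by (rule degree_le) (auto simp: coeff_spec coeff_eq_0)
  hence "(\<Sum>j\<le>degree (spec A x). coeff (spec A x) j * y ^ j) = (\<Sum>j\<le>degree A. coeff (spec A x) j * y ^ j)"
    by (intro sum.mono_neutral_left) (auto simp: coeff_eq_0)
  thus ?thesis by (simp add: poly_altdef coeff_spec)
qed

text \<open>The relations \<open>P\<close> and \<open>Q\<close> bound the degree in one variable
  each; the point is a single relation that obeys both bounds. The irreducible relation between
  \<open>x\<close> and \<open>y\<close> does, since by Gauss's lemma it divides every other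
  one.\<close>

lemma bidegree_relation:
  assumes x: "x \<notin> \<kappa>" and y: "y \<notin> \<kappa>"
    and P: "P \<in> Pol (gen \<kappa> {y})" "P \<noteq> 0" "poly P x = 0" "degree P \<le> a"
    and Q: "Q \<in> Pol (gen \<kappa> {x})" "Q \<noteq> 0" "poly Q y = 0" "degree Q \<le> b"
  obtains A where "\<And>i j. A i j \<in> \<kappa>" "\<exists>i\<le>a. \<exists>j\<le>b. A i j \<noteq> 0"
    "(\<Sum>i\<le>a. \<Sum>j\<le>b. A i j * x ^ i * y ^ j) = 0"
proof -
  have K': "sfd (gen \<kappa> {x})" by (rule gen_sfd)
  define Z where "Z = (\<lambda>C. C \<in> BiPol \<kappa> \<and> C \<noteq> 0 \<and> poly (spec C x) y = 0)"
  have ZI: "\<exists>C. Z C \<and> degree C = degree S" if S: "S \<in> Pol (gen \<kappa> {x})" "S \<noteq> 0" "poly S y = 0" for S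
  proof -
    obtain D C where DC: "D \<in> Pol \<kappa>" "poly D x \<noteq> 0" "C \<in> BiPol \<kappa>" "smult (poly D x) S = spec C x"
      by (rule clear_denominators[OF S(1)])
    have "degree C = degree S" using degree_spec[OF DC(3) x] DC(2) by (simp add: DC(4)[symmetric])
    moreover have "poly (spec C x) y = 0" "spec C x \<noteq> 0" using S DC by (auto simp: DC(4)[symmetric])
    ultimately show ?thesis using DC(3) by (auto simp: Z_def)
  qed
  define ib where "ib = (\<lambda>C n. \<forall>i. degree (coeff C i :: 'a poly) \<le> n)"
  have ib_ex: "\<exists>n. ib C n" for C
  proof -
    have "degree (coeff C i) \<le> Max ((\<lambda>i. degree (coeff C i)) ` {..degree C})" for i
      by (cases "i \<le> degree C") (auto intro!: Max_ge simp: coeff_eq_0)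
    thus ?thesis by (auto simp: ib_def)
  qed
  \<comment> \<open>\<open>C\<close> is chosen with the least degree \<open>m\<close> in
    \<open>Y\<close> and, among such relations, with the least bound \<open>n\<close> on the degrees
    in \<open>X\<close>. The second choice makes it primitive.\<close>
  define m where "m = (LEAST m. \<exists>C. Z C \<and> degree C = m)"
  have "\<exists>C. Z C \<and> degree C = degree Q" by (rule ZI[OF Q(1-3)])
  from LeastI[of "\<lambda>m. \<exists>C. Z C \<and> degree C = m", OF this] Least_le[of "\<lambda>m. \<exists>C. Z C \<and> degree C = m", OF this]
  have m: "\<exists>C. Z C \<and> degree C = m" "m \<le> b" using Q(4) by (auto simp: m_def)
  have mmin: "m \<le> degree C" if "Z C" for C unfolding m_def by (rule Least_le) (use that in auto)
  define n where "n = (LEAST n. \<exists>C. Z C \<and> degree C = m \<and> ib C n)"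
  have "\<exists>n C. Z C \<and> degree C = m \<and> ib C n" using m(1) ib_ex by blast
  from LeastI_ex[OF this] obtain C where C: "Z C" "degree C = m" "ib C n" by (auto simp: n_def)
  have nmin: "n \<le> n'" if "Z C'" "degree C' = m" "ib C' n'" for C' n'
    unfolding n_def by (rule Least_le) (use that in auto)
  have CB: "C \<in> BiPol \<kappa>" "C \<noteq> 0" "poly (spec C x) y = 0" using C(1) by (auto simp: Z_def)
  obtain D P' where DP: "D \<in> Pol \<kappa>" "poly D y \<noteq> 0" "P' \<in> BiPol \<kappa>" "smult (poly D y) P = spec P' y"
    by (rule clear_denominators[OF P(1)])
  have dP': "degree P' \<le> a" using degree_spec[OF DP(3) y] DP(2) P(4) by (simp add: DP(4)[symmetric])
  define e where "e = Max ((\<lambda>i. degree (coeff P' i)) ` {..degree P'})"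
  have e: "degree (coeff P' i) \<le> e" for i
    unfolding e_def by (cases "i \<le> degree P'") (auto intro!: Max_ge simp: coeff_eq_0)
  \<comment> \<open>\<open>B(X, Y) = P'(Y, X)\<close>\<close>
  define B where "B = (\<Sum>j\<le>e. Polynomial.monom (\<Sum>i\<le>degree P'. Polynomial.monom (coeff (coeff P' i) j) i) j)"
  have cB: "coeff (coeff B j) i = coeff (coeff P' i) j" for i j
  proof -
    have "coeff B j = (if j \<le> e then (\<Sum>i\<le>degree P'. Polynomial.monom (coeff (coeff P' i) j) i) else 0)"
      by (simp add: B_def coeff_sum if_distrib cong: if_cong)
    moreover have "coeff (\<Sum>i\<le>degree P'. Polynomial.monom (coeff (coeff P' i) j) i) i = coeff (coeff P' i) j"
      by (cases "i \<le> degree P'") (auto simp: coeff_sum coeff_eq_0 if_distrib cong: if_cong)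
    moreover have "coeff (coeff P' i) j = 0" if "\<not> j \<le> e" using e[of i] that by (auto intro: coeff_eq_0)
    ultimately show ?thesis by simp
  qed
  have BB: "B \<in> BiPol \<kappa>" using DP(3) by (simp add: BiPol_def Pol_def cB)
  have B0: "B \<noteq> 0"
  proof
    assume "B = 0"
    hence "P' = 0" using cB by (intro poly_eqI) (metis coeff_0)
    thus False using DP(2,4) P(2) by simp
  qed
  have Bdeg: "degree (coeff B j) \<le> a" for j
    using dP' by (intro degree_le) (auto simp: cB coeff_eq_0)
  have Bxy: "poly (spec B x) y = 0"
  proof -
    have "degree B \<le> e" by (rule degree_le) (auto intro!: poly_eqI simp: cB coeff_eq_0 le_less_trans[OF e])
    have "poly (spec B x) y = (\<Sum>j\<le>degree B. poly (coeff B j) x * y ^ j)" by (rule poly_spec)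
    also have "\<dots> = (\<Sum>j\<le>e. poly (coeff B j) x * y ^ j)"
      by (rule sum.mono_neutral_left) (use \<open>degree B \<le> e\<close> in \<open>auto simp: coeff_eq_0\<close>)
    also have "\<dots> = (\<Sum>j\<le>e. \<Sum>i\<le>degree P'. coeff (coeff P' i) j * x ^ i * y ^ j)"
      by (intro sum.cong refl) (simp add: B_def coeff_sum if_distrib poly_sum poly_monom sum_distrib_right cong: if_cong)
    also have "\<dots> = (\<Sum>i\<le>degree P'. \<Sum>j\<le>e. coeff (coeff P' i) j * x ^ i * y ^ j)" by (rule sum.swap)
    also have "\<dots> = (\<Sum>i\<le>degree P'. poly (coeff P' i) y * x ^ i)"
    proof (intro sum.cong refl)
      fix i
      have "poly (coeff P' i) y = (\<Sum>j\<le>e. coeff (coeff P' i) j * y ^ j)"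
        unfolding poly_altdef by (rule sum.mono_neutral_left) (use e in \<open>auto simp: coeff_eq_0\<close>)
      thus "(\<Sum>j\<le>e. coeff (coeff P' i) j * x ^ i * y ^ j) = poly (coeff P' i) y * x ^ i"
        by (simp add: sum_distrib_right sum_distrib_left mult_ac)
    qed
    also have "\<dots> = poly (spec P' y) x" by (simp add: poly_spec)
    also have "\<dots> = 0" using P(3) by (simp add: DP(4)[symmetric])
    finally show ?thesis .
  qed
  \<comment> \<open>\<open>C(x, Y)\<close> divides \<open>B(x, Y)\<close>, as it has minimal degree among the relations for \<open>y\<close>\<close>
  have specPol: "spec A x \<in> Pol (gen \<kappa> {x})" if "A \<in> BiPol \<kappa>" for A
  proof -
    have "poly (coeff A i) x \<in> gen \<kappa> {x}" for i
      using that Pol_mono[OF gen_base[of \<kappa> "{x}"]] gen_gens[of "{x}" \<kappa>]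
      by (intro Pol_poly[OF K']) (auto simp: BiPol_def)
    thus ?thesis by (simp add: Pol_def coeff_spec)
  qed
  have "spec C x \<noteq> 0" using spec_eq_0_iff[OF CB(1) x] CB(2) by simp
  obtain R S where RS: "R \<in> Pol (gen \<kappa> {x})" "S \<in> Pol (gen \<kappa> {x})" "spec B x = R * spec C x + S"
      "S = 0 \<or> degree S < degree (spec C x)"
    by (rule Pol_divmod[OF K' specPol[OF CB(1)] \<open>spec C x \<noteq> 0\<close> specPol[OF BB]])
  have "poly S y = 0" using RS(3) Bxy CB(3) by simp
  have "S = 0"
  proof (rule ccontr)
    assume "S \<noteq> 0"
    from ZI[OF RS(2) this \<open>poly S y = 0\<close>] obtain C' where "Z C'" "degree C' = degree S" by blast
    with mmin have "m \<le> degree S" by fastforce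
    thus False using RS(4) \<open>S \<noteq> 0\<close> C(2) degree_spec[OF CB(1) x] by simp
  qed
  obtain D1 R1 where DR: "D1 \<in> Pol \<kappa>" "poly D1 x \<noteq> 0" "R1 \<in> BiPol \<kappa>" "smult (poly D1 x) R = spec R1 x"
    by (rule clear_denominators[OF RS(1)])
  have "spec (smult D1 B) x = spec (R1 * C) x"
    using RS(3) \<open>S = 0\<close> by (simp add: DR(4)[symmetric])
  have biC: "smult D1 B \<in> BiPol \<kappa>" "R1 * C \<in> BiPol \<kappa>"
    using BB DR CB by (auto simp: BiPol_def coeff_mult intro!: Pol_closed K)
  have DBRC: "smult D1 B = R1 * C"
  proof -
    have "spec (smult D1 B - R1 * C) x = spec (smult D1 B) x - spec (R1 * C) x"
      by (rule poly_eqI) (simp only: coeff_spec coeff_diff poly_diff)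
    hence "spec (smult D1 B - R1 * C) x = 0" using \<open>spec (smult D1 B) x = _\<close> by simp
    moreover have "smult D1 B - R1 * C \<in> BiPol \<kappa>" using biC by (simp add: BiPol_def Pol_diff[OF K] del: coeff_smult)
    ultimately show ?thesis using spec_eq_0_iff[OF _ x] by simp
  qed
  \<comment> \<open>Gauss's lemma: \<open>C\<close> has no root \<open>X = c\<close>, so the linear factors of \<open>D1\<close> divide \<open>R1\<close>\<close>
  have "\<exists>R c. smult [:c:] B = R * C \<and> c \<noteq> 0"
    if "smult D B = R * C" "D \<noteq> 0" "\<And>z. poly D z = 0 \<Longrightarrow> z \<in> \<kappa>" for D R
    using that
  proof (induction "degree D" arbitrary: D R)
    case 0
    then obtain c where "D = [:c:]" by (metis degree_eq_zeroE)
    thus ?case using 0 by auto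
  next
    case (Suc k)
    then obtain c where c: "poly D c = 0" using alg_closed_imp_poly_has_root[of D] by auto
    hence cK: "c \<in> \<kappa>" using Suc.prems by auto
    \<comment> \<open>Otherwise \<open>X - c\<close> splits off from \<open>C\<close>, and the
      quotient is a relation with a smaller bound than \<open>n\<close>.\<close>
    have "spec C c \<noteq> 0"
    proof
      assume "spec C c = 0"
      then obtain C' where C': "C = smult [:- c, 1:] C'" by (rule smult_linear_dvd)
      have C'c: "coeff C i = [:- c, 1:] * coeff C' i" for i by (simp add: C')
      have C'0: "C' \<noteq> 0" using CB(2) C' by auto
      have "coeff C' i \<in> Pol \<kappa>" for i
        by (rule Pol_factor[OF _ cK]) (use CB(1) in \<open>simp only: BiPol_def mem_Collect_eq flip: C'c\<close>)
      moreover have "poly (spec C' x) y = 0" using CB(3) x cK by (auto simp: C')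
      ultimately have "Z C'" using C'0 by (simp add: Z_def BiPol_def)
      have dd: "degree (coeff C i) = Suc (degree (coeff C' i))" if "coeff C' i \<noteq> 0" for i
        unfolding C'c using that by (subst degree_mult_eq) auto
      have "n > 0" using dd[of "degree C'"] C'0 C(3) by (auto simp: ib_def) (metis Suc_le_D leading_coeff_0_iff zero_less_Suc)
      have "ib C' (n - 1)" unfolding ib_def
      proof
        fix i
        show "degree (coeff C' i) \<le> n - 1" using dd[of i] C(3)
          by (cases "coeff C' i = 0") (auto simp: ib_def dest!: spec[of _ i])
      qed
      moreover have "degree C' = m" using C(2) by (simp add: C')
      ultimately have "n \<le> n - 1" using nmin \<open>Z C'\<close> by blast
      thus False using \<open>n > 0\<close> by simp
    qed
    moreover have "spec R c * spec C c = 0" using Suc.prems(1) c by (metis spec_simps(3,4) smult_0_left)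
    ultimately have "spec R c = 0" by simp
    then obtain R' where R': "R = smult [:- c, 1:] R'" by (rule smult_linear_dvd)
    obtain D' where D': "D = [:- c, 1:] * D'" using c by (auto simp: poly_eq_0_iff_dvd elim: dvdE)
    have "smult [:- c, 1:] (smult D' B) = smult [:- c, 1:] (R' * C)"
      using Suc.prems(1) by (simp add: R' D')
    hence "smult D' B = R' * C"
      by (metis (no_types, lifting) pCons_eq_0_iff smult_eq_iff smult_cancel zero_neq_one one_neq_zero)
    moreover have "D' \<noteq> 0" using Suc.prems(2) D' by auto
    moreover from this have "degree D' = k" using Suc.hyps(2) unfolding D' by (subst (asm) degree_mult_eq) auto
    moreover have "z \<in> \<kappa>" if "poly D' z = 0" for z using Suc.prems(3)[of z] that by (simp add: D')
    ultimately show ?case using Suc.hyps(1)[of D' R'] by blast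
  qed
  from this[OF DBRC] obtain R2 c where R2: "smult [:c:] B = R2 * C" "c \<noteq> 0"
    using DR(1,2) closed by (metis poly_0)
  have "R2 \<noteq> 0" using R2 B0 by auto
  have Cdeg: "degree (coeff C i) \<le> a" for i
  proof (rule inner_degree_factor[OF \<open>R2 \<noteq> 0\<close>])
    fix i show "degree (coeff (R2 * C) i) \<le> a" using Bdeg[of i] R2(2) by (simp add: R2(1)[symmetric])
  qed
  show ?thesis
  proof (rule that[of "\<lambda>i j. coeff (coeff C j) i"])
    show "coeff (coeff C j) i \<in> \<kappa>" for i j using CB(1) by (simp add: BiPol_def Pol_def)
    have "lead_coeff (coeff C m) \<noteq> 0" using C(2) CB(2) by auto
    thus "\<exists>i\<le>a. \<exists>j\<le>b. coeff (coeff C j) i \<noteq> 0" using Cdeg[of m] m(2) by blast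
    have "0 = (\<Sum>j\<le>m. poly (coeff C j) x * y ^ j)" using CB(3) C(2) by (simp add: poly_spec)
    also have "\<dots> = (\<Sum>j\<le>b. poly (coeff C j) x * y ^ j)"
      by (rule sum.mono_neutral_left) (use m(2) C(2) in \<open>auto simp: coeff_eq_0\<close>)
    also have "\<dots> = (\<Sum>j\<le>b. \<Sum>i\<le>a. coeff (coeff C j) i * x ^ i * y ^ j)"
    proof (intro sum.cong refl)
      fix j
      have "poly (coeff C j) x = (\<Sum>i\<le>a. coeff (coeff C j) i * x ^ i)"
        unfolding poly_altdef by (rule sum.mono_neutral_left) (use Cdeg[of j] in \<open>auto simp: coeff_eq_0\<close>)
      thus "poly (coeff C j) x * y ^ j = (\<Sum>i\<le>a. coeff (coeff C j) i * x ^ i * y ^ j)"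
        by (simp add: sum_distrib_right)
    qed
    finally show "(\<Sum>i\<le>a. \<Sum>j\<le>b. coeff (coeff C j) i * x ^ i * y ^ j) = 0"
      by (subst sum.swap) simp
  qed
qed

end

section \<open>The degree of a function, under products and norms\<close>

context const_field
begin

lemma finite_over_simple:
  assumes S: "finite S" and x: "x \<notin> \<kappa>" "x \<in> gen \<kappa> S"
  shows "fin_over (gen \<kappa> {x}) (gen \<kappa> S)"
proof -
  have "gen \<kappa> S = gen (gen \<kappa> {x}) S"
    unfolding gen_gen using x by (intro gen_eqI) (auto simp: gen_gens[THEN subsetD])
  thus ?thesis using fin_over_gen[OF gen_sfd S, of \<kappa> "{x}"] trdeg[OF x(1)] by simp
qed

lemma dependent_polys:
  assumes S: "finite S" and x: "x \<notin> \<kappa>" "x \<in> gen \<kappa> S"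
    and m: "field_deg (gen \<kappa> {x}) (gen \<kappa> S) < m" and b: "\<And>i. i < m \<Longrightarrow> b i \<in> gen \<kappa> S"
  obtains p where "\<And>i. p i \<in> Pol \<kappa>" "\<exists>i<m. p i \<noteq> 0" "(\<Sum>i<m. poly (p i) x * b i) = 0"
proof -
  obtain a where a: "\<forall>i. a i \<in> gen \<kappa> {x}" "\<exists>i<m. a i \<noteq> 0" "(\<Sum>i<m. a i * b i) = 0"
    by (rule dependent_family[OF gen_sfd finite_over_simple[OF S x] m b])
  define T where "T = (\<Sum>i<m. Polynomial.monom (a i) i)"
  have T: "coeff T i = (if i < m then a i else 0)" for i unfolding T_def by (rule poly_sum_lessThan)
  have "T \<in> Pol (gen \<kappa> {x})" unfolding T_def using a by (intro Pol_closed gen_sfd) auto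
  then obtain D Q where DQ: "D \<in> Pol \<kappa>" "poly D x \<noteq> 0" "Q \<in> BiPol \<kappa>" "smult (poly D x) T = spec Q x"
    by (rule clear_denominators)
  have cQ: "poly (coeff Q i) x = poly D x * a i" if "i < m" for i
    using that DQ(4) T[of i] by (metis coeff_smult coeff_spec)
  show ?thesis
  proof (rule that[of "coeff Q"])
    show "coeff Q i \<in> Pol \<kappa>" for i using DQ(3) by (simp add: BiPol_def)
    show "\<exists>i<m. coeff Q i \<noteq> 0" using a(2) cQ DQ(2) by fastforce
    have "(\<Sum>i<m. poly (coeff Q i) x * b i) = poly D x * (\<Sum>i<m. a i * b i)"
      unfolding sum_distrib_left by (intro sum.cong refl) (simp add: cQ)
    thus "(\<Sum>i<m. poly (coeff Q i) x * b i) = 0" using a(3) by simp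
  qed
qed

text \<open>The degree of \<open>x\<close> as a map from the curve with function field
  \<open>L\<close> to the projective line. Constants need the separate value 0, because
  \<open>gen \<kappa> {x}\<close> is then only \<open>\<kappa>\<close>.\<close>

definition dg :: "'a set \<Rightarrow> 'a \<Rightarrow> nat" where
  "dg L x = (if x \<in> \<kappa> then 0 else field_deg (gen \<kappa> {x}) L)"

lemma dg_cong: "gen \<kappa> {x} = gen \<kappa> {y} \<Longrightarrow> dg L x = dg L y"
proof -
  assume e: "gen \<kappa> {x} = gen \<kappa> {y}"
  have "z \<in> \<kappa> \<longleftrightarrow> gen \<kappa> {z} = \<kappa>" for z
    using gen_gens[of "{z}" \<kappa>] gen_min[OF K order.refl, of "{z}"] gen_base[of \<kappa> "{z}"] by auto
  thus ?thesis using e by (simp add: dg_def)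
qed

lemma gen_simple_eqI: "x \<in> gen \<kappa> {y} \<Longrightarrow> y \<in> gen \<kappa> {x} \<Longrightarrow> gen \<kappa> {x} = gen \<kappa> {y}"
  by (rule gen_eqI) auto

lemma in_gen1: "x \<in> gen \<kappa> {x}" "c \<in> \<kappa> \<Longrightarrow> c \<in> gen \<kappa> S" "x \<in> S \<Longrightarrow> x \<in> gen \<kappa> S"
  using gen_gens[of "{x}" \<kappa>] gen_gens[of S \<kappa>] gen_base[of \<kappa> S] by auto

lemma gen_incl: "S \<subseteq> gen \<kappa> T \<Longrightarrow> gen \<kappa> S \<subseteq> gen \<kappa> T"
  by (rule gen_mono[OF gen_base])

lemma alg_gen: "s \<in> gen \<kappa> S \<Longrightarrow> s \<notin> \<kappa> \<Longrightarrow> alg_over (gen \<kappa> S) z"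
  by (rule alg_over_mono[OF trdeg gen_incl]) auto

lemma dg_inverse: "dg L (inverse x) = dg L x"
proof (rule dg_cong, rule gen_simple_eqI)
  show "inverse x \<in> gen \<kappa> {x}" by (intro sfd_closed gen_sfd in_gen1)
  have "inverse (inverse x) \<in> gen \<kappa> {inverse x}" by (intro sfd_closed gen_sfd in_gen1)
  thus "x \<in> gen \<kappa> {inverse x}" by simp
qed

lemma dg_diff_const: "c \<in> \<kappa> \<Longrightarrow> dg L (x - c) = dg L x"
proof (rule dg_cong, rule gen_simple_eqI)
  assume c: "c \<in> \<kappa>"
  show "x - c \<in> gen \<kappa> {x}" by (intro sfd_closed gen_sfd in_gen1 c)
  have "(x - c) + c \<in> gen \<kappa> {x - c}" by (intro sfd_closed gen_sfd in_gen1 c)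
  thus "x \<in> gen \<kappa> {x - c}" by simp
qed

lemma dg_uminus: "dg L (- x) = dg L x"
proof (rule dg_cong, rule gen_simple_eqI)
  show "- x \<in> gen \<kappa> {x}" by (intro sfd_closed gen_sfd in_gen1)
  have "- (- x) \<in> gen \<kappa> {- x}" by (intro sfd_closed gen_sfd in_gen1)
  thus "x \<in> gen \<kappa> {- x}" by simp
qed

text \<open>Stands in for subadditivity of the divisor of poles. In
  \<open>M = \<kappa>(x, y)\<close> a relation of bidegree \<open>(a, b)\<close> between
  \<open>x\<close> and \<open>y\<close> becomes, with \<open>y = g / x\<close>, a relation for
  \<open>x\<close> over \<open>\<kappa>(g)\<close> of degree at most \<open>a + b\<close>, and
  \<open>x\<close> generates \<open>M\<close> over \<open>\<kappa>(g)\<close>. All degrees are then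
  multiplied by \<open>[gen \<kappa> S : M]\<close>.\<close>

lemma dg_mult:
  assumes S: "finite S" and x: "x \<in> gen \<kappa> S" "x \<noteq> 0" and y: "y \<in> gen \<kappa> S" "y \<noteq> 0"
  shows "dg (gen \<kappa> S) (x * y) \<le> dg (gen \<kappa> S) x + dg (gen \<kappa> S) y"
proof -
  let ?L = "gen \<kappa> S"
  have const: "dg ?L (c * z) = dg ?L z" if c: "c \<in> \<kappa>" "c \<noteq> 0" for c z
  proof (rule dg_cong, rule gen_simple_eqI)
    show "c * z \<in> gen \<kappa> {z}" by (intro sfd_closed gen_sfd in_gen1 c)
    have "(c * z) / c \<in> gen \<kappa> {c * z}" by (intro sfd_closed gen_sfd in_gen1 c)
    thus "z \<in> gen \<kappa> {c * z}" using c by simp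
  qed
  consider "x \<in> \<kappa>" | "y \<in> \<kappa>" | "x * y \<in> \<kappa>" | "x \<notin> \<kappa>" "y \<notin> \<kappa>" "x * y \<notin> \<kappa>" by blast
  thus ?thesis
  proof cases
    case 1 thus ?thesis using const[of x y] x by simp
  next
    case 2 thus ?thesis using const[of y x] y by (simp add: mult.commute)
  next
    case 3 thus ?thesis by (simp add: dg_def)
  next
    case 4
    let ?g = "x * y"
    define M where "M = gen \<kappa> {x, y}"
    have M: "sfd M" "x \<in> M" "y \<in> M" by (auto simp: M_def gen_sfd in_gen1)
    have fz: "fin_over (gen \<kappa> {z}) M" if "z \<notin> \<kappa>" "z \<in> M" for z
      using that unfolding M_def by (intro finite_over_simple) auto
    note fx = fz[OF 4(1) M(2)] and fy = fz[OF 4(2) M(3)] and fg = fz[OF 4(3) sfd_mult[OF M]]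
    define a where "a = field_deg (gen \<kappa> {y}) M"
    define b where "b = field_deg (gen \<kappa> {x}) M"
    obtain P where P: "P \<in> Pol (gen \<kappa> {y})" "P \<noteq> 0" "degree P \<le> a" "poly P x = 0"
      unfolding a_def by (rule fin_over_poly[OF gen_sfd fy sfd_power[OF M(1,2)]])
    obtain Q where Q: "Q \<in> Pol (gen \<kappa> {x})" "Q \<noteq> 0" "degree Q \<le> b" "poly Q y = 0"
      unfolding b_def by (rule fin_over_poly[OF gen_sfd fx sfd_power[OF M(1,3)]])
    obtain A where A: "\<And>i j. A i j \<in> \<kappa>" "\<exists>i\<le>a. \<exists>j\<le>b. A i j \<noteq> 0"
      "(\<Sum>i\<le>a. \<Sum>j\<le>b. A i j * x ^ i * y ^ j) = 0"
      by (rule bidegree_relation[OF 4(1,2) P(1,2,4,3) Q(1,2,4,3)]) blast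
    \<comment> \<open>\<open>W\<close> is \<open>X^b A(X, g / X)\<close>; the factor
      \<open>X^b\<close> clears the denominators.\<close>
    define W where "W = (\<Sum>i\<le>a. \<Sum>j\<le>b. Polynomial.monom (A i j * ?g ^ j) (i + b - j))"
    have W: "W \<in> Pol (gen \<kappa> {?g})"
      unfolding W_def by (intro Pol_closed gen_sfd sfd_closed in_gen1 A)
    have "poly W x = (\<Sum>i\<le>a. \<Sum>j\<le>b. x ^ b * (A i j * x ^ i * y ^ j))"
      unfolding W_def poly_sum
    proof (intro sum.cong refl)
      fix i j assume "j \<in> {..b}"
      hence "x ^ (i + b - j) * x ^ j = x ^ b * x ^ i" by (simp add: power_add[symmetric] add.commute)
      thus "poly (Polynomial.monom (A i j * ?g ^ j) (i + b - j)) x = x ^ b * (A i j * x ^ i * y ^ j)"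
        by (simp add: poly_monom power_mult_distrib mult_ac)
    qed
    hence W0: "poly W x = 0" using A(3) by (simp add: sum_distrib_left[symmetric])
    obtain i0 j0 where ij: "i0 \<le> a" "j0 \<le> b" "A i0 j0 \<noteq> 0" using A(2) by blast
    define m where "m = i0 + b - j0"
    \<comment> \<open>The coefficient of \<open>W\<close> at \<open>m\<close> is \<open>V\<close>
      evaluated at \<open>g\<close>. In \<open>V\<close> the exponent \<open>j0\<close> occurs for
      \<open>i = i0\<close> alone, so \<open>V\<close> is not zero, and \<open>g\<close> is
      transcendental over \<open>\<kappa>\<close>.\<close>
    define V where "V = (\<Sum>i\<le>a. \<Sum>j\<le>b. Polynomial.monom (if i + b - j = m then A i j else 0) j)"
    have "coeff V j0 = (\<Sum>i\<le>a. \<Sum>j\<le>b. if i = i0 \<and> j = j0 then A i j else 0)"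
      unfolding V_def coeff_sum using ij by (intro sum.cong refl) (auto simp: m_def)
    also have "\<dots> = A i0 j0" by (rule coeff_pair_sum[OF ij(1,2)])
    finally have "V \<noteq> 0" using ij(3) by auto
    moreover have "V \<in> Pol \<kappa>" unfolding V_def using A(1) by (intro Pol_closed K) (auto simp: sfd_0[OF K])
    ultimately have "poly V ?g \<noteq> 0" using nonzero_at 4(3) by auto
    moreover have "coeff W m = poly V ?g"
      unfolding W_def V_def coeff_sum poly_sum by (intro sum.cong refl) (auto simp: poly_monom)
    ultimately have Wn: "W \<noteq> 0" by auto
    have dW: "degree W \<le> a + b"
      unfolding W_def by (intro degree_sum_le) (auto intro!: order.trans[OF degree_monom_le])
    have "gen (gen \<kappa> {?g}) {x} = M" unfolding M_def gen_gen
    proof (rule gen_eqI)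
      have "?g \<in> gen \<kappa> {x, y}" "x \<in> gen \<kappa> {x, y}" using M sfd_mult[OF M] by (simp_all add: M_def)
      thus "{?g} \<union> {x} \<subseteq> gen \<kappa> {x, y}" by simp
      have "?g / x \<in> gen \<kappa> ({?g} \<union> {x})" by (intro sfd_divide gen_sfd in_gen1) auto
      thus "{x, y} \<subseteq> gen \<kappa> ({?g} \<union> {x})" using x(2) by (auto intro: in_gen1)
    qed
    hence gM: "field_deg (gen \<kappa> {?g}) M \<le> a + b" using simple_deg(2)[OF gen_sfd W Wn W0] dW by simp
    have fML: "fin_over M ?L"
    proof -
      have "gen \<kappa> S = gen M S" unfolding M_def gen_gen using x y by (intro gen_eqI) (auto intro: in_gen1)
      moreover have "alg_over M z" for z
        unfolding M_def by (rule alg_gen[OF _ 4(1)]) (simp add: in_gen1)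
      ultimately show ?thesis using fin_over_gen[OF M(1) S] by simp
    qed
    have t: "field_deg (gen \<kappa> {z}) ?L = field_deg (gen \<kappa> {z}) M * field_deg M ?L"
      if "fin_over (gen \<kappa> {z}) M" for z
      using field_deg_tower(2)[OF gen_sfd M(1) that fML] .
    have "dg ?L ?g = field_deg (gen \<kappa> {?g}) M * field_deg M ?L" using 4 t[OF fg] by (simp add: dg_def)
    also have "\<dots> \<le> (a + b) * field_deg M ?L" using gM by simp
    also have "\<dots> = dg ?L x + dg ?L y" using 4 t[OF fx] t[OF fy] by (simp add: dg_def a_def b_def algebra_simps)
    finally show ?thesis .
  qed
qed

lemma dg_prod_mset:
  assumes S: "finite S" and f: "\<And>x. x \<in># A \<Longrightarrow> f x \<in> gen \<kappa> S \<and> f x \<noteq> 0 \<and> dg (gen \<kappa> S) (f x) \<le> m"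
  shows "(\<Prod>x\<in>#A. f x) \<in> gen \<kappa> S \<and> (\<Prod>x\<in>#A. f x) \<noteq> 0 \<and> dg (gen \<kappa> S) (\<Prod>x\<in>#A. f x) \<le> size A * m"
  using f
proof (induction A)
  case empty
  show ?case by (auto simp: dg_def sfd_1[OF K] sfd_1[OF gen_sfd])
next
  case (add x A)
  let ?P = "\<Prod>x\<in>#A. f x"
  have IH: "?P \<in> gen \<kappa> S" "?P \<noteq> 0" "dg (gen \<kappa> S) ?P \<le> size A * m" using add by auto
  have x: "f x \<in> gen \<kappa> S" "f x \<noteq> 0" "dg (gen \<kappa> S) (f x) \<le> m" using add.prems[of x] by auto
  show ?case using dg_mult[OF S x(1,2) IH(1,2)] x IH sfd_mult[OF gen_sfd x(1) IH(1)] by simp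
qed

lemma dg_power:
  assumes "finite S" "x \<in> gen \<kappa> S" "x \<noteq> 0"
  shows "dg (gen \<kappa> S) (x ^ n) \<le> n * dg (gen \<kappa> S) x"
proof -
  have "y \<in> gen \<kappa> S \<and> y \<noteq> 0 \<and> dg (gen \<kappa> S) y \<le> dg (gen \<kappa> S) x" if "y \<in># replicate_mset n x" for y
    using that assms(2,3) by (auto split: if_splits)
  from dg_prod_mset[where f = "\<lambda>x. x" and A = "replicate_mset n x", OF assms(1) this] show ?thesis by simp
qed

text \<open>The norm from \<open>E(h)\<close> to \<open>E\<close> does not increase degrees.\<close>

lemma norm_degree:
  assumes S: "finite S" and s: "s \<in> S" "s \<notin> \<kappa>" and h: "h \<notin> \<kappa>"
    and G: "field_deg (gen \<kappa> {h}) (gen \<kappa> (insert h S)) \<le> G"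
  obtains g where "g \<in> gen \<kappa> S" "g \<notin> \<kappa>" "dg (gen \<kappa> S) g \<le> G"
proof -
  define E where "E = gen \<kappa> S"
  have E: "sfd E" "\<kappa> \<subseteq> E" "s \<in> E" using s by (auto simp: E_def gen_sfd in_gen1)
  have algE: "alg_over E z" for z
    unfolding E_def by (rule alg_gen[OF _ s(2)]) (simp add: in_gen1 s)
  define Z where "Z = (\<lambda>P. P \<in> Pol E \<and> P \<noteq> 0 \<and> poly P h = 0)"
  obtain P0 where P0: "Z P0" "\<And>Q. Z Q \<Longrightarrow> degree P0 \<le> degree Q"
    using ex_has_least_nat[of Z _ degree] algE[of h] by (auto simp: alg_over_def Z_def)
  \<comment> \<open>The minimal polynomial of \<open>h\<close> over \<open>E\<close>; its value at a
    constant \<open>c\<close> is the norm of \<open>c - h\<close>.\<close>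
  define F where "F = smult (inverse (lead_coeff P0)) P0"
  have F: "F \<in> Pol E" "F \<noteq> 0" "poly F h = 0" "lead_coeff F = 1"
    using P0(1) by (auto simp: F_def Z_def intro!: Pol_closed E sfd_closed Pol_coeff)
  define n where "n = degree F"
  have nmin: "n \<le> degree Q" if "Q \<in> Pol E" "Q \<noteq> 0" "poly Q h = 0" for Q
    using P0(2)[of Q] that by (simp add: Z_def n_def F_def)
  have n0: "n > 0"
  proof (rule ccontr)
    assume "\<not> n > 0"
    then obtain c where "F = [:c:]" by (metis degree_eq_zeroE n_def gr0I)
    thus False using F by auto
  qed
  \<comment> \<open>Conjugates are counted with multiplicity, so inseparable \<open>h\<close> is
    covered.\<close>
  obtain A where A: "size A = n" "F = (\<Prod>x\<in>#A. [:- x, 1:])"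
    using alg_closed_imp_factorization[OF F(2)] F(4) by (auto simp: n_def)
  have root: "poly F x = 0" if "x \<in># A" for x
    using that unfolding A(2) poly_prod_mset by (auto simp: prod_mset_zero_iff image_iff)
  \<comment> \<open>Irreducibility of \<open>F\<close>: the minimal polynomial \<open>M\<close> of
    \<open>x\<close> divides \<open>F\<close>, and \<open>h\<close> is a root of \<open>M\<close> or
    of the cofactor, which has too small a degree.\<close>
  have conj_min: "n \<le> degree Q" if Q: "Q \<in> Pol E" "Q \<noteq> 0" "poly Q x = 0" and x: "x \<in># A" for Q x
  proof -
    define Z' where "Z' = (\<lambda>P. P \<in> Pol E \<and> P \<noteq> 0 \<and> poly P x = 0)"
    obtain M where M: "Z' M" "\<And>Q. Z' Q \<Longrightarrow> degree M \<le> degree Q"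
      using ex_has_least_nat[of Z' Q degree] Q by (auto simp: Z'_def)
    have M': "M \<in> Pol E" "M \<noteq> 0" "poly M x = 0" using M(1) by (auto simp: Z'_def)
    obtain B R where BR: "B \<in> Pol E" "R \<in> Pol E" "F = B * M + R" "R = 0 \<or> degree R < degree M"
      by (rule Pol_divmod[OF E(1) M'(1,2) F(1)])
    have "poly R x = 0" using root[OF x] BR(3) M'(3) by simp
    hence "R = 0" using M(2)[of R] BR by (fastforce simp: Z'_def)
    hence BM: "F = B * M" using BR by simp
    hence "B \<noteq> 0" using F by auto
    have dF: "n = degree B + degree M" unfolding n_def BM using \<open>B \<noteq> 0\<close> M'(2) by (rule degree_mult_eq)
    have "degree M > 0"
    proof (rule ccontr)
      assume "\<not> degree M > 0"
      then obtain c where "M = [:c:]" by (metis degree_eq_zeroE gr0I)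
      thus False using M' by auto
    qed
    have "poly B h = 0 \<or> poly M h = 0" using F(3) BM by simp
    hence "n \<le> degree M" using nmin[of B] nmin[of M] BR M' \<open>B \<noteq> 0\<close> dF \<open>degree M > 0\<close> by auto
    also have "\<dots> \<le> degree Q" by (rule M(2)) (use Q in \<open>simp add: Z'_def\<close>)
    finally show ?thesis .
  qed
  have degx: "fin_over E (gen E {x})" "field_deg E (gen E {x}) = n" if x: "x \<in># A" for x
  proof -
    show f: "fin_over E (gen E {x})" by (rule simple_deg(1)[OF E(1) F(1,2) root[OF x]])
    show "field_deg E (gen E {x}) = n"
    proof (rule antisym)
      show "field_deg E (gen E {x}) \<le> n" unfolding n_def by (rule simple_deg(2)[OF E(1) F(1,2) root[OF x]])
      have "x \<in> gen E {x}" using gen_gens[of "{x}" E] by simp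
      then obtain Q where "Q \<in> Pol E" "Q \<noteq> 0" "degree Q \<le> field_deg E (gen E {x})" "poly Q x = 0"
        by (rule fin_over_poly[OF E(1) f sfd_power[OF gen_sfd]])
      thus "n \<le> field_deg E (gen E {x})" using conj_min[OF _ _ _ x] by (meson le_trans)
    qed
  qed
  have xK: "x \<notin> \<kappa>" if x: "x \<in># A" for x
  proof
    assume k: "x \<in> \<kappa>"
    have "n \<le> degree [:- x, 1:]"
      by (rule conj_min[OF _ _ _ x]) (use k E in \<open>auto intro!: Pol_closed sfd_closed\<close>)
    hence "n = 1" using n0 by simp
    then obtain z where "A = {#z#}" using A(1) by (metis size_1_singleton_mset)
    hence "F = [:- x, 1:]" using A(2) x by simp
    hence "h = x" using F(3) by (simp add: eq_neg_iff_add_eq_0)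
    thus False using k h by simp
  qed
  \<comment> \<open>Every conjugate inherits the bound of \<open>h\<close>. A relation over
    \<open>\<kappa>(h)\<close> between polynomial expressions in \<open>h\<close> is a polynomial
    over \<open>E\<close> that vanishes at \<open>h\<close>; it is divisible by \<open>F\<close> and
    hence vanishes at \<open>x\<close>.\<close>
  have conjG: "fin_over (gen \<kappa> {x}) (gen E {x}) \<and> field_deg (gen \<kappa> {x}) (gen E {x}) \<le> G" if x: "x \<in># A" for x
  proof (rule field_deg_leI[OF gen_sfd])
    show "subspc (gen \<kappa> {x}) (gen E {x})"
      by (rule subspc_sfd[OF gen_sfd gen_mono]) (use E gen_base[of E "{x}"] gen_gens[of "{x}" E] in auto)
    fix b assume b: "\<And>i. i \<le> G \<Longrightarrow> b i \<in> gen E {x}"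
    have "\<exists>P. P \<in> Pol E \<and> b i = poly P x" if "i \<le> G" for i
      using simple_alg_elem[OF E(1) algE b[OF that]] by metis
    then obtain P where P: "\<And>i. i \<le> G \<Longrightarrow> P i \<in> Pol E \<and> b i = poly (P i) x" by metis
    have "poly (P i) h \<in> gen \<kappa> (insert h S)" if "i < Suc G" for i
    proof -
      have sub: "E \<subseteq> gen \<kappa> (insert h S)" unfolding E_def by (rule gen_incl) (auto intro: in_gen1)
      have "P i \<in> Pol E" using P[of i] that by simp
      hence "P i \<in> Pol (gen \<kappa> (insert h S))" using Pol_mono[OF sub] by blast
      thus ?thesis by (rule Pol_poly[OF gen_sfd]) (auto intro: in_gen1)
    qed
    then obtain c where c: "\<And>i. c i \<in> Pol \<kappa>" "\<exists>i<Suc G. c i \<noteq> 0" "(\<Sum>i<Suc G. poly (c i) h * poly (P i) h) = 0"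
      using G S h by (elim dependent_polys[of "insert h S" h "Suc G" "\<lambda>i. poly (P i) h", rotated -1]) (auto intro: in_gen1)
    define Y where "Y = (\<Sum>i\<le>G. c i * P i)"
    have YE: "Y \<in> Pol E"
      unfolding Y_def using c(1) P Pol_mono[OF E(2)] by (intro Pol_closed E) auto
    have Yh: "poly Y h = 0" using c(3) by (simp add: Y_def poly_sum lessThan_Suc_atMost)
    obtain B R where BR: "B \<in> Pol E" "R \<in> Pol E" "Y = B * F + R" "R = 0 \<or> degree R < degree F"
      by (rule Pol_divmod[OF E(1) F(1,2) YE])
    have "poly R h = 0" using Yh BR(3) F(3) by simp
    hence "R = 0" using nmin[of R] BR by (fastforce simp: n_def)
    hence "poly Y x = 0" using BR(3) root[OF x] by simp
    hence "(\<Sum>i\<le>G. poly (c i) x * b i) = 0" using P by (simp add: Y_def poly_sum)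
    moreover have "poly (c i) x \<in> gen \<kappa> {x}" for i
      using c(1) Pol_mono[OF gen_base[of \<kappa> "{x}"]] by (intro Pol_poly[OF gen_sfd]) (auto intro: in_gen1)
    moreover obtain i where "i \<le> G" "c i \<noteq> 0" using c(2) by (auto simp: less_Suc_eq_le)
    moreover from this have "poly (c i) x \<noteq> 0" using nonzero_at[OF c(1) xK[OF x]] by simp
    ultimately show "\<exists>a. (\<forall>i\<le>G. a i \<in> gen \<kappa> {x}) \<and> (\<exists>i\<le>G. a i \<noteq> 0) \<and> (\<Sum>i\<le>G. a i * b i) = 0"
      by (intro exI[of _ "\<lambda>i. poly (c i) x"]) auto
  qed
  \<comment> \<open>The conjugates lie in different fields \<open>E(x)\<close>; their degrees are
    compared in the field \<open>L\<close> that contains all of them.\<close>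
  define S' where "S' = S \<union> set_mset A"
  define L where "L = gen \<kappa> S'"
  have S': "finite S'" using S by (simp add: S'_def)
  have L: "sfd L" "E \<subseteq> L" "\<kappa> \<subseteq> L"
    unfolding L_def E_def S'_def by (rule gen_sfd, rule gen_incl, auto intro: in_gen1)
  have LE: "L = gen E (set_mset A)" unfolding L_def E_def S'_def gen_gen ..
  have finEL: "fin_over E L" unfolding LE by (rule fin_over_gen[OF E(1)]) (auto intro: algE)
  define N where "N = field_deg E L"
  have "1 \<in> L" by (rule sfd_1[OF L(1)])
  hence Npos: "N > 0" unfolding N_def by (intro field_deg_pos[OF E(1) finEL, of 1]) auto
  \<comment> \<open>Since \<open>N = n [L : E(x)]\<close>, each conjugate has degree at most
    \<open>G N / n\<close> on \<open>L\<close>. The \<open>n\<close> factors of the norm together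
    give \<open>G N\<close>, and dividing by \<open>N = [L : E]\<close> returns to
    \<open>E\<close>.\<close>
  have dgx: "n * dg L x \<le> G * N" if x: "x \<in># A" for x
  proof -
    have Ex: "gen E {x} = gen \<kappa> (insert x S)" unfolding E_def gen_gen by simp
    have finxL: "fin_over (gen E {x}) L"
    proof -
      have "L = gen (gen E {x}) (set_mset A)" unfolding LE gen_gen using x by (intro gen_eqI) (auto intro: subsetD[OF gen_gens])
      moreover have "alg_over (gen E {x}) z" for z by (rule alg_over_mono[OF algE gen_base])
      ultimately show ?thesis using fin_over_gen[OF gen_sfd, of "set_mset A" E "{x}"] by simp
    qed
    have "N = n * field_deg (gen E {x}) L"
      unfolding N_def using field_deg_tower(2)[OF E(1) gen_sfd degx(1)[OF x] finxL] degx(2)[OF x] by simp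
    moreover have "dg L x = field_deg (gen \<kappa> {x}) (gen E {x}) * field_deg (gen E {x}) L"
      using field_deg_tower(2)[OF gen_sfd gen_sfd _ finxL] conjG[OF x] xK[OF x] by (simp add: dg_def)
    ultimately show ?thesis using conjG[OF x] by simp
  qed
  \<comment> \<open>If all these norms were constant, \<open>F\<close> would have coefficients in
    \<open>\<kappa>\<close> and \<open>h\<close> would be a constant.\<close>
  have "\<exists>c\<in>\<kappa>. poly F c \<notin> \<kappa>"
  proof (rule ccontr)
    assume "\<not> ?thesis"
    hence "F \<in> Pol \<kappa>" by (intro Pol_of_values[of "{}"]) auto
    thus False using closed[OF _ F(2,3)] h by auto
  qed
  then obtain c where c: "c \<in> \<kappa>" "poly F c \<notin> \<kappa>" by auto
  define g where "g = poly F c"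
  have gE: "g \<in> E" unfolding g_def using F(1) c E by (intro Pol_poly) auto
  have g_prod: "g = (\<Prod>x\<in>#A. c - x)"
    unfolding g_def by (subst A(2)) (simp add: poly_prod_mset image_mset.compositionality o_def)
  define m where "m = G * N div n"
  have "c - x \<in> gen \<kappa> S' \<and> c - x \<noteq> 0 \<and> dg (gen \<kappa> S') (c - x) \<le> m" if x: "x \<in># A" for x
  proof -
    have "c - x \<in> gen \<kappa> S'" using c x by (intro sfd_diff gen_sfd in_gen1) (auto simp: S'_def)
    moreover have "c - x \<noteq> 0" using c xK[OF x] by auto
    moreover have "dg L (c - x) = dg L x"
      using dg_uminus[of L "x - c"] dg_diff_const[OF c(1), of L x] by simp
    moreover have "dg L x \<le> m" using dgx[OF x] n0 by (simp add: m_def less_eq_div_iff_mult_less_eq mult.commute)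
    ultimately show ?thesis by (simp add: L_def)
  qed
  from dg_prod_mset[where f = "\<lambda>x. c - x" and A = A, OF S' this] have "dg L g \<le> n * m" using A(1) by (simp add: g_prod L_def)
  also have "\<dots> \<le> G * N" by (simp add: m_def)
  finally have "dg L g \<le> G * N" .
  moreover have "dg L g = dg E g * N"
  proof -
    have "fin_over (gen \<kappa> {g}) E" unfolding E_def
      by (rule finite_over_simple[OF S]) (use c gE in \<open>auto simp: g_def E_def\<close>)
    thus ?thesis using field_deg_tower(2)[OF gen_sfd E(1) _ finEL] c by (simp add: dg_def N_def g_def)
  qed
  ultimately have "dg E g \<le> G" using Npos by simp
  thus ?thesis using that[of g] gE c by (simp add: g_def E_def)
qed

end

subsection \<open>Places\<close>

text \<open>The maximal ideal when \<open>V\<close> is a valuation ring; membership in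
  \<open>V\<close> is not demanded because it then follows.\<close>

definition maxid :: "'a::field set \<Rightarrow> 'a set" where
  "maxid V = {x. x = 0 \<or> inverse x \<notin> V}"

definition subrng :: "'a::field set \<Rightarrow> bool" where
  "subrng A \<longleftrightarrow> 1 \<in> A \<and> - 1 \<in> A \<and> (\<forall>x\<in>A. \<forall>y\<in>A. x + y \<in> A \<and> x * y \<in> A)"

lemma
  assumes "subrng A"
  shows subrng_1: "1 \<in> A" and subrng_0: "0 \<in> A"
    and subrng_add: "\<And>x y. x \<in> A \<Longrightarrow> y \<in> A \<Longrightarrow> x + y \<in> A"
    and subrng_mult: "\<And>x y. x \<in> A \<Longrightarrow> y \<in> A \<Longrightarrow> x * y \<in> A"
    and subrng_uminus: "\<And>x. x \<in> A \<Longrightarrow> - x \<in> A"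
    and subrng_diff: "\<And>x y. x \<in> A \<Longrightarrow> y \<in> A \<Longrightarrow> x - y \<in> A"
    and subrng_power: "\<And>x n. x \<in> A \<Longrightarrow> x ^ n \<in> A"
proof -
  show 1: "1 \<in> A" using assms by (simp add: subrng_def)
  show add: "x + y \<in> A" and mult: "x * y \<in> A" if "x \<in> A" "y \<in> A" for x y
    using assms that by (auto simp: subrng_def)
  show "0 \<in> A" using add[of 1 "- 1"] assms by (simp add: subrng_def)
  show um: "- x \<in> A" if "x \<in> A" for x using mult[of "- 1" x] that assms by (auto simp: subrng_def)
  show "x - y \<in> A" if "x \<in> A" "y \<in> A" for x y using add[of x "- y"] um[of y] that by simp
  show "x ^ n \<in> A" if "x \<in> A" for x n using that by (induction n) (auto intro: 1 mult)
qed

lemma subrng_sum: "subrng A \<Longrightarrow> (\<And>i. i \<in> I \<Longrightarrow> f i \<in> A) \<Longrightarrow> sum f I \<in> A"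
  by (induction I rule: infinite_finite_induct) (auto intro: subrng_0 subrng_add)

lemmas subrng_closed = subrng_0 subrng_1 subrng_add subrng_mult subrng_uminus subrng_diff subrng_power subrng_sum

lemma
  assumes A: "subrng A"
  shows Polr_add: "\<And>P Q. P \<in> Pol A \<Longrightarrow> Q \<in> Pol A \<Longrightarrow> P + Q \<in> Pol A"
    and Polr_diff: "\<And>P Q. P \<in> Pol A \<Longrightarrow> Q \<in> Pol A \<Longrightarrow> P - Q \<in> Pol A"
    and Polr_mult: "\<And>P Q. P \<in> Pol A \<Longrightarrow> Q \<in> Pol A \<Longrightarrow> P * Q \<in> Pol A"
    and Polr_monom: "\<And>c n. c \<in> A \<Longrightarrow> Polynomial.monom c n \<in> Pol A"
    and Polr_const: "\<And>c. c \<in> A \<Longrightarrow> [:c:] \<in> Pol A"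
    and Polr_poly: "\<And>P x. P \<in> Pol A \<Longrightarrow> x \<in> A \<Longrightarrow> poly P x \<in> A"
  using A by (auto simp: Pol_def coeff_pCons coeff_mult poly_altdef intro!: subrng_closed split: nat.splits)

lemma Polr_sum: "subrng A \<Longrightarrow> (\<And>i. i \<in> I \<Longrightarrow> f i \<in> Pol A) \<Longrightarrow> sum f I \<in> Pol A"
  by (auto simp: Pol_def coeff_sum intro!: subrng_sum)

lemma subrng_sfd: "sfd F \<Longrightarrow> subrng F"
  by (auto simp: subrng_def sfd_closed)

lemma subrng_adjoin: "subrng A \<Longrightarrow> subrng {poly P y | P. P \<in> Pol A}"
proof -
  assume A: "subrng A"
  show ?thesis unfolding subrng_def
  proof (intro conjI ballI)
    show "1 \<in> {poly P y | P. P \<in> Pol A}"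
      using Polr_const[OF A subrng_1[OF A]] by (auto intro!: exI[of _ "[:1:]"])
    show "- 1 \<in> {poly P y | P. P \<in> Pol A}"
      using Polr_const[OF A subrng_uminus[OF A subrng_1[OF A]]] by (auto intro!: exI[of _ "[:-1:]"])
  next
    fix a b assume "a \<in> {poly P y | P. P \<in> Pol A}" "b \<in> {poly P y | P. P \<in> Pol A}"
    then obtain P Q where PQ: "P \<in> Pol A" "Q \<in> Pol A" "a = poly P y" "b = poly Q y" by auto
    show "a + b \<in> {poly P y | P. P \<in> Pol A}" using PQ Polr_add[OF A PQ(1,2)] poly_add by (metis (mono_tags, lifting) mem_Collect_eq)
    show "a * b \<in> {poly P y | P. P \<in> Pol A}" using PQ Polr_mult[OF A PQ(1,2)] poly_mult by (metis (mono_tags, lifting) mem_Collect_eq)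
  qed
qed

context const_field
begin

text \<open>The valuation ring lives on the whole algebraically closed field, so that one place
  serves every intermediate field and measures the root \<open>u\<close> of \<open>s\<close> as
  well. The last clause makes \<open>\<kappa>\<close> the residue field. Values are divisible and
  there is no uniformiser; powers of \<open>1/u\<close> replace it later.\<close>

definition is_place :: "'a set \<Rightarrow> bool" where
  "is_place V \<longleftrightarrow> \<kappa> \<subseteq> V \<and> subrng V \<and> (\<forall>x. x \<in> V \<or> inverse x \<in> V) \<and> (\<forall>x\<in>V. \<exists>c\<in>\<kappa>. x - c \<in> maxid V)"

text \<open>Chevalley's extension theorem: a subring maximal among those that contain
  \<open>\<kappa>\<close> and \<open>1/w\<close> but not \<open>w\<close> is a valuation
  ring.\<close>

lemma exists_place:
  assumes w: "w \<notin> \<kappa>"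
  obtains V where "is_place V" "w \<notin> V"
proof -
  define z where "z = inverse w"
  have w0: "w \<noteq> 0" using w sfd_0[OF K] by auto
  have zw: "z * w = 1" "z \<noteq> 0" using w0 by (auto simp: z_def)
  define \<A> where "\<A> = {A. \<kappa> \<subseteq> A \<and> subrng A \<and> z \<in> A \<and> w \<notin> A}"
  have "{poly P z | P. P \<in> Pol \<kappa>} \<in> \<A>"
  proof -
    have "w \<noteq> poly P z" if P: "P \<in> Pol \<kappa>" for P
    proof
      assume "w = poly P z"
      hence "poly (pCons (-1) P) z = 0" using zw by simp
      moreover have "pCons (-1) P \<in> Pol \<kappa>" using P by (intro Pol_closed K sfd_closed)
      ultimately have "z \<in> \<kappa>" using closed by fastforce
      hence "inverse z \<in> \<kappa>" by (rule sfd_inverse[OF K])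
      thus False using w by (simp add: z_def)
    qed
    moreover have "c \<in> {poly P z | P. P \<in> Pol \<kappa>}" if "c \<in> \<kappa>" for c
      using that by (auto intro!: exI[of _ "[:c:]"] Pol_closed K)
    moreover have "z \<in> {poly P z | P. P \<in> Pol \<kappa>}"
      by (auto intro!: exI[of _ "[:0, 1:]"] Pol_closed K sfd_closed)
    ultimately show ?thesis unfolding \<A>_def using subrng_adjoin[OF subrng_sfd[OF K], of z] by blast
  qed
  hence "\<A> \<noteq> {}" by auto
  moreover have "\<Union>C \<in> \<A>" if C: "C \<noteq> {}" "subset.chain \<A> C" for C
  proof -
    have sub: "A \<in> \<A>" if "A \<in> C" for A using C(2) that by (auto simp: subset.chain_def)
    have "subrng (\<Union>C)" unfolding subrng_def
    proof (intro conjI ballI)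
      obtain A where "A \<in> C" using C(1) by auto
      with sub[OF this] show "1 \<in> \<Union>C" "-1 \<in> \<Union>C" by (auto simp: \<A>_def subrng_def)
    next
      fix x y assume "x \<in> \<Union>C" "y \<in> \<Union>C"
      then obtain A B where AB: "A \<in> C" "B \<in> C" "x \<in> A" "y \<in> B" by auto
      have "A \<subseteq> B \<or> B \<subseteq> A" using C(2) AB by (auto simp: subset.chain_def subset_chain_def)
      then obtain D where D: "D \<in> C" "x \<in> D" "y \<in> D" using AB by auto
      have "subrng D" using sub[OF D(1)] by (simp add: \<A>_def)
      from subrng_add[OF this D(2,3)] subrng_mult[OF this D(2,3)] D(1)
      show "x + y \<in> \<Union>C" "x * y \<in> \<Union>C" by auto
    qed
    moreover obtain A where "A \<in> C" using C(1) by auto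
    ultimately show ?thesis using sub by (auto simp: \<A>_def)
  qed
  ultimately obtain V where V: "V \<in> \<A>" and max: "\<And>Y. Y \<in> \<A> \<Longrightarrow> V \<subseteq> Y \<Longrightarrow> Y = V"
    using subset_Zorn_nonempty[of \<A>] by blast
  have KV: "\<kappa> \<subseteq> V" and R: "subrng V" and zV: "z \<in> V" and wV: "w \<notin> V" using V by (auto simp: \<A>_def)
  have noz: "z * b \<noteq> 1" if "b \<in> V" for b
  proof
    assume "z * b = 1"
    hence "b = w" using zw by (metis mult.commute mult.left_commute mult.right_neutral)
    thus False using that wV by simp
  qed
  \<comment> \<open>Inverting \<open>v = 1 - z b\<close> does not bring in \<open>w\<close>, because
    every power of \<open>v\<close> is 1 modulo \<open>z\<close>. Maximality of \<open>V\<close>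
    then gives the inverse.\<close>
  have unit: "inverse (1 - z * b) \<in> V" if b: "b \<in> V" for b
  proof -
    define v where "v = 1 - z * b"
    have vV: "v \<in> V" unfolding v_def using zV b by (intro subrng_closed[OF R])
    have v0: "v \<noteq> 0" using noz[OF b] by (auto simp: v_def)
    define A' where "A' = {a * inverse v ^ k | a k. a \<in> V}"
    have pw: "\<exists>b'\<in>V. v ^ k = 1 - z * b'" for k
    proof (induction k)
      case (Suc k)
      then obtain b' where b': "b' \<in> V" "v ^ k = 1 - z * b'" by auto
      have "b + b' - z * b * b' \<in> V" using b b' zV by (intro subrng_closed[OF R])
      moreover have "v ^ Suc k = 1 - z * (b + b' - z * b * b')"
        unfolding power_Suc b'(2) by (simp add: v_def algebra_simps)
      ultimately show ?case by blast
    qed (auto intro!: bexI[of _ 0] subrng_0[OF R])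
    have A'I: "a * inverse v ^ k \<in> A'" if "a \<in> V" for a k using that by (auto simp: A'_def)
    have VA: "V \<subseteq> A'" using A'I[of _ 0] by auto
    have "subrng A'" unfolding subrng_def
    proof (intro conjI ballI)
      show "1 \<in> A'" "- 1 \<in> A'" using VA subrng_1[OF R] subrng_uminus[OF R subrng_1[OF R]] by auto
      fix x y assume "x \<in> A'" "y \<in> A'"
      then obtain a k a' k' where *: "a \<in> V" "x = a * inverse v ^ k" "a' \<in> V" "y = a' * inverse v ^ k'"
        by (auto simp: A'_def)
      have "x + y = (a * v ^ k' + a' * v ^ k) * inverse v ^ (k + k')"
        using v0 by (simp add: * power_add field_simps)
      also have "\<dots> \<in> A'" by (intro A'I subrng_closed[OF R] * vV)
      finally show "x + y \<in> A'" .
      have "x * y = (a * a') * inverse v ^ (k + k')" by (simp add: * power_add mult_ac)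
      also have "\<dots> \<in> A'" by (intro A'I subrng_closed[OF R] *)
      finally show "x * y \<in> A'" .
    qed
    moreover have "w \<notin> A'"
    proof
      assume "w \<in> A'"
      then obtain a k where a: "a \<in> V" "w = a * inverse v ^ k" by (auto simp: A'_def)
      obtain b' where b': "b' \<in> V" "v ^ k = 1 - z * b'" using pw by blast
      have "v ^ k = z * w * v ^ k" using zw by simp
      also have "\<dots> = z * a" using v0 a(2) by (simp add: field_simps)
      finally have "z * (a + b') = 1" using b'(2) by (simp add: algebra_simps)
      moreover have "a + b' \<in> V" using a b' by (intro subrng_closed[OF R])
      ultimately show False using noz by blast
    qed
    ultimately have "A' = V" using VA KV zV by (intro max) (auto simp: \<A>_def)
    thus ?thesis using A'I[OF subrng_1[OF R], of 1] by (simp add: v_def)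
  qed
  \<comment> \<open>By maximality, adjoining \<open>y\<close> brings in \<open>w = 1/z\<close>,
    which is a polynomial value at \<open>y\<close>.\<close>
  have adj: "\<exists>P\<in>Pol V. z * poly P y = 1" if y: "y \<notin> V" for y
  proof (rule ccontr)
    assume neg: "\<not> ?thesis"
    let ?A = "{poly P y | P. P \<in> Pol V}"
    have VA: "V \<subseteq> ?A" using Polr_const[OF R] by (auto intro!: exI[of _ "[:x:]" for x])
    have "w \<notin> ?A" using neg zw by auto
    hence "?A \<in> \<A>" unfolding \<A>_def using subrng_adjoin[OF R, of y] VA KV zV by blast
    hence "?A = V" using max VA by blast
    moreover have "y = poly (Polynomial.monom 1 1) y" by (simp add: poly_monom)
    hence "y \<in> ?A" using Polr_monom[OF R subrng_1[OF R]] by blast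
    ultimately show False using y by simp
  qed
  \<comment> \<open>The relation for \<open>1/y\<close>, multiplied by a power of \<open>y\<close>
    and divided by the unit \<open>v\<close>, rewrites the top term of \<open>P\<close> through
    lower ones. Alternating this between \<open>y\<close> and its inverse is a descent on the total
    degree.\<close>
  have step: "\<exists>P'\<in>Pol V. z * poly P' y = 1 \<and> degree P' < degree P"
    if P: "P \<in> Pol V" "z * poly P y = 1" and Q: "Q \<in> Pol V" "z * poly Q (inverse y) = 1"
      and le: "degree Q \<le> degree P" and y: "y \<noteq> 0" for y P Q
  proof -
    define n where "n = degree P"
    define pn where "pn = coeff P n"
    define v where "v = 1 - z * coeff Q 0"
    have cV: "coeff P i \<in> V" "coeff Q i \<in> V" for i using P Q by (auto simp: Pol_def)
    have v: "inverse v \<in> V" "v \<noteq> 0" using unit[OF cV(2)] noz[OF cV(2)] by (auto simp: v_def)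
    have n: "n > 0"
    proof (rule ccontr)
      assume "\<not> n > 0"
      then obtain c where "Q = [:c:]" using le by (metis degree_eq_zeroE gr0I le_zero_eq n_def)
      thus False using Q noz[of c] cV(2)[of 0] by simp
    qed
    define T where "T = (\<Sum>j\<in>{1..degree Q}. Polynomial.monom (pn * z * coeff Q j * inverse v) (n - j))"
    define P' where "P' = P - Polynomial.monom pn n + T"
    have TV: "T \<in> Pol V" unfolding T_def pn_def by (intro Polr_sum[OF R] Polr_monom[OF R] subrng_closed[OF R] cV zV v)
    have "P' \<in> Pol V" unfolding P'_def
      by (intro Polr_add[OF R] Polr_diff[OF R] Polr_monom[OF R] P TV) (simp add: pn_def cV)
    moreover have "degree P' < degree P"
    proof -
      have "coeff P' i = 0" if "i \<ge> n" for i
      proof -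
        have "coeff T i = 0" unfolding T_def coeff_sum using that le n by (intro sum.neutral) (auto simp: n_def)
        moreover have "coeff (P - Polynomial.monom pn n) i = 0"
          using that by (cases "i = n") (auto simp: pn_def n_def coeff_eq_0)
        ultimately show ?thesis by (simp add: P'_def)
      qed
      thus ?thesis using n unfolding n_def[symmetric] by (intro degree_lessI) auto
    qed
    moreover have "z * poly P' y = 1"
    proof -
      have "poly Q (inverse y) = coeff Q 0 + (\<Sum>j\<in>{1..degree Q}. coeff Q j * inverse y ^ j)"
      proof -
        have "{..degree Q} = insert 0 {1..degree Q}" by auto
        thus ?thesis unfolding poly_altdef by simp
      qed
      hence "z * (\<Sum>j\<in>{1..degree Q}. coeff Q j * inverse y ^ j) = v"
        using Q(2) by (simp add: v_def algebra_simps)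
      moreover have "poly T y = pn * y ^ n * inverse v * (z * (\<Sum>j\<in>{1..degree Q}. coeff Q j * inverse y ^ j))"
        unfolding T_def poly_sum sum_distrib_left
      proof (intro sum.cong refl)
        fix j assume "j \<in> {1..degree Q}"
        hence "y ^ (n - j) = y ^ n * inverse y ^ j"
          using y le by (simp add: n_def power_diff power_inverse divide_inverse)
        thus "poly (Polynomial.monom (pn * z * coeff Q j * inverse v) (n - j)) y
            = pn * y ^ n * inverse v * (z * (coeff Q j * inverse y ^ j))"
          by (simp add: poly_monom mult_ac)
      qed
      ultimately have "poly T y = pn * y ^ n" using v by simp
      thus ?thesis using P(2) by (simp add: P'_def poly_monom)
    qed
    ultimately show ?thesis by blast
  qed
  have no_pair: False if "P \<in> Pol V" "z * poly P y = 1" "Q \<in> Pol V" "z * poly Q (inverse y) = 1" "y \<noteq> 0"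
    for y P Q
    using that
  proof (induction "degree P + degree Q" arbitrary: y P Q rule: less_induct)
    case less
    show ?case
    proof (cases "degree Q \<le> degree P")
      case True
      from step[OF less.prems(1-4) True less.prems(5)] obtain P' where
        "P' \<in> Pol V" "z * poly P' y = 1" "degree P' < degree P" by blast
      thus False using less.hyps[of P' Q y] less.prems by simp
    next
      case False
      have "\<exists>P'\<in>Pol V. z * poly P' (inverse y) = 1 \<and> degree P' < degree Q"
        by (rule step[of Q "inverse y" P]) (use less.prems False in auto)
      then obtain Q' where "Q' \<in> Pol V" "z * poly Q' (inverse y) = 1" "degree Q' < degree Q" by blast
      thus False using less.hyps[of P Q' y] less.prems by simp
    qed
  qed
  have val: "y \<in> V \<or> inverse y \<in> V" for y
  proof (rule ccontr)
    assume "\<not> ?thesis"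
    moreover from this have "y \<noteq> 0" using subrng_0[OF R] by auto
    ultimately show False using adj[of y] adj[of "inverse y"] no_pair by blast
  qed
  \<comment> \<open>If no \<open>x - c\<close> is in the ideal, all nonzero polynomials in
    \<open>x\<close> over \<open>\<kappa>\<close> are units. Now \<open>z\<close> satisfies an
    equation with such coefficients, and its lowest nonzero coefficient would be a multiple of
    \<open>z\<close>, so \<open>z\<close> would be a unit.\<close>
  have res: "\<exists>c\<in>\<kappa>. x - c \<in> maxid V" if x: "x \<in> V" for x
  proof (rule ccontr)
    assume "\<not> ?thesis"
    hence neg: "x - c \<noteq> 0 \<and> inverse (x - c) \<in> V" if "c \<in> \<kappa>" for c using that by (auto simp: maxid_def)
    hence xK: "x \<notin> \<kappa>" by auto
    have inv: "inverse (poly p x) \<in> V" if p: "p \<in> Pol \<kappa>" "p \<noteq> 0" for p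
    proof -
      obtain A where A: "p = smult (lead_coeff p) (\<Prod>a\<in>#A. [:-a, 1:])"
        using alg_closed_imp_factorization[OF p(2)] by blast
      have AK: "a \<in> \<kappa>" if "a \<in># A" for a
      proof (rule closed[OF \<open>p \<in> Pol \<kappa>\<close> \<open>p \<noteq> 0\<close>])
        show "poly p a = 0" using that by (subst A) (auto simp: poly_prod_mset prod_mset_zero_iff image_iff)
      qed
      have "inverse (\<Prod>a\<in>#A. x - a) \<in> V" using AK
        by (induction A) (auto intro!: subrng_closed[OF R] simp: neg)
      moreover have "inverse (lead_coeff p) \<in> V" using KV p sfd_inverse[OF K] by (auto simp: Pol_def)
      moreover have "poly p x = lead_coeff p * (\<Prod>a\<in>#A. x - a)"
        by (subst A) (simp add: poly_prod_mset image_mset.compositionality o_def)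
      ultimately show ?thesis by (simp add: subrng_mult[OF R])
    qed
    obtain P where P: "P \<in> Pol (gen \<kappa> {x})" "P \<noteq> 0" "poly P z = 0" using trdeg[OF xK, of z] by (auto simp: alg_over_def)
    obtain D Q where DQ: "D \<in> Pol \<kappa>" "poly D x \<noteq> 0" "Q \<in> BiPol \<kappa>" "smult (poly D x) P = spec Q x"
      by (rule clear_denominators[OF P(1)])
    have low: "w \<in> V" if "T \<noteq> 0" "poly T z = 0" "\<And>i. coeff T i \<in> V" "\<And>i. coeff T i \<noteq> 0 \<Longrightarrow> inverse (coeff T i) \<in> V" for T
      using that
    proof (induction T)
      case (pCons c T)
      have TV: "coeff T i \<in> V" "coeff T i \<noteq> 0 \<Longrightarrow> inverse (coeff T i) \<in> V" for i
        using pCons.prems(3,4)[of "Suc i"] by auto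
      show ?case
      proof (cases "c = 0")
        case True
        hence "T \<noteq> 0" "poly T z = 0" using pCons.prems zw by auto
        thus ?thesis using pCons.IH TV by blast
      next
        case False
        have "inverse c \<in> V" using pCons.prems(4)[of 0] False by simp
        moreover have "poly T z \<in> V" using TV(1) zV by (intro Polr_poly[OF R]) (auto simp: Pol_def)
        moreover have "z * (- (inverse c * poly T z)) = 1"
        proof -
          have "c + z * poly T z = 0" using pCons.prems(2) by simp
          hence "z * poly T z = - c" by (simp add: eq_neg_iff_add_eq_0 add.commute)
          hence "inverse c * (z * poly T z) = - 1" using False by simp
          thus ?thesis by (simp add: mult.left_commute)
        qed
        ultimately show ?thesis using noz subrng_closed[OF R] by metis
      qed
    qed simp
    have "w \<in> V"
    proof (rule low[of "spec Q x"])
      show "spec Q x \<noteq> 0" using P DQ by (simp add: DQ(4)[symmetric])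
      show "poly (spec Q x) z = 0" using P by (simp add: DQ(4)[symmetric])
      have cQ: "coeff Q i \<in> Pol \<kappa>" for i using DQ(3) by (simp add: BiPol_def)
      show "coeff (spec Q x) i \<in> V" for i
        using cQ[of i] KV x by (simp add: coeff_spec) (meson Pol_mono Polr_poly[OF R] subsetD)
      show "inverse (coeff (spec Q x) i) \<in> V" if "coeff (spec Q x) i \<noteq> 0" for i
        using inv[OF cQ[of i]] that by (metis coeff_spec poly_0)
    qed
    thus False using wV by simp
  qed
  show ?thesis by (rule that[of V]) (use KV R val res wV in \<open>auto simp: is_place_def\<close>)
qed

end

section \<open>Arithmetic in the valuation ring of a place\<close>

locale place = const_field \<kappa> for \<kappa> :: "'a::alg_closed_field set" +
  fixes V :: "'a set"
  assumes place_V: "is_place V"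
begin

lemma KV: "c \<in> \<kappa> \<Longrightarrow> c \<in> V" and R: "subrng V" and val: "x \<in> V \<or> inverse x \<in> V"
  using place_V by (auto simp: is_place_def)

lemma residue: "x \<in> V \<Longrightarrow> \<exists>c\<in>\<kappa>. x - c \<in> maxid V"
  using place_V by (simp add: is_place_def)

lemmas V_closed = subrng_closed[OF R]

lemma m_V: "x \<in> maxid V \<Longrightarrow> x \<in> V"
  using val[of x] subrng_0[OF R] by (auto simp: maxid_def)

lemma notm: "x \<notin> maxid V \<longleftrightarrow> x \<noteq> 0 \<and> inverse x \<in> V" by (auto simp: maxid_def)

lemma m_mult: "x \<in> maxid V \<Longrightarrow> y \<in> V \<Longrightarrow> x * y \<in> maxid V"
proof (rule ccontr)
  assume *: "x \<in> maxid V" "y \<in> V" "x * y \<notin> maxid V"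
  hence "x \<noteq> 0" "y \<noteq> 0" "inverse (x * y) * y \<in> V" by (auto simp: notm intro: V_closed)
  moreover from this have "inverse (x * y) * y = inverse x" by (simp add: field_simps)
  ultimately have "inverse x \<in> V" by metis
  thus False using *(1) \<open>x \<noteq> 0\<close> by (simp add: maxid_def)
qed

lemma m_mult': "x \<in> V \<Longrightarrow> y \<in> maxid V \<Longrightarrow> x * y \<in> maxid V"
  using m_mult[of y x] by (simp add: mult.commute)

lemma m_add: "x \<in> maxid V \<Longrightarrow> y \<in> maxid V \<Longrightarrow> x + y \<in> maxid V"
proof -
  have *: "x + y \<in> maxid V" if "x \<in> maxid V" "y \<in> maxid V" "x * inverse y \<in> V" "y \<noteq> 0" for x y
  proof -
    have "y * (x * inverse y + 1) \<in> maxid V" by (rule m_mult[OF that(2) V_closed(3)[OF that(3) V_closed(2)]])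
    moreover have "y * (x * inverse y + 1) = x + y" using that(4) by (simp add: distrib_left)
    ultimately show ?thesis by simp
  qed
  assume xy: "x \<in> maxid V" "y \<in> maxid V"
  consider "x = 0" | "y = 0" | "x \<noteq> 0" "y \<noteq> 0" by blast
  thus ?thesis
  proof cases
    case 3
    have "x * inverse y \<in> V \<or> y * inverse x \<in> V" using val[of "x * inverse y"] 3 by (simp add: mult.commute)
    thus ?thesis using *[OF xy] *[OF xy(2,1)] 3 by (auto simp: add.commute)
  qed (use xy in auto)
qed

lemma m_uminus: "x \<in> maxid V \<Longrightarrow> - x \<in> maxid V"
  using m_mult[of x "- 1"] V_closed(2,5) by auto

lemma m_diff: "x \<in> maxid V \<Longrightarrow> y \<in> maxid V \<Longrightarrow> x - y \<in> maxid V"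
  using m_add[of x "- y"] m_uminus[of y] by simp

lemma m_K: "c \<in> \<kappa> \<Longrightarrow> c \<in> maxid V \<Longrightarrow> c = 0"
  using KV[of "inverse c"] sfd_inverse[OF K] by (auto simp: maxid_def)

lemma m_zero: "0 \<in> maxid V" by (simp add: maxid_def)

lemma one_notm: "1 \<notin> maxid V" using V_closed(2) by (simp add: maxid_def)

lemma unit_1_diff: "x \<in> maxid V \<Longrightarrow> 1 - x \<notin> maxid V"
  using m_add[of "1 - x" x] one_notm by auto

lemma inverse_m: "x \<notin> V \<Longrightarrow> inverse x \<in> maxid V" by (simp add: maxid_def)

lemma V_power: "x ^ n \<in> V \<Longrightarrow> n > 0 \<Longrightarrow> x \<in> V"
proof (rule ccontr)
  assume *: "x ^ n \<in> V" "n > 0" "x \<notin> V"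
  have i: "inverse x \<in> maxid V" using inverse_m *(3) .
  have "inverse x ^ n \<in> maxid V" using *(2) i m_V[OF i]
    by (induction n rule: nat_induct_non_zero) (auto intro: m_mult')
  hence "x ^ n * inverse x ^ n \<in> maxid V" by (rule m_mult'[OF *(1)])
  moreover have "x \<noteq> 0" using *(3) V_closed(1) by auto
  ultimately show False using one_notm by (simp flip: power_mult_distrib)
qed

lemma cong_power: "x - y \<in> maxid V \<Longrightarrow> x \<in> V \<Longrightarrow> y \<in> V \<Longrightarrow> x ^ n - y ^ n \<in> maxid V"
proof (induction n)
  case (Suc n)
  have "x ^ Suc n - y ^ Suc n = x * (x ^ n - y ^ n) + (x - y) * y ^ n" by (simp add: algebra_simps)
  also have "\<dots> \<in> maxid V" using Suc by (intro m_add m_mult' m_mult V_closed) auto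
  finally show ?case .
qed (simp add: m_zero)

end

section \<open>The q-power Frobenius on constants and polynomials\<close>

locale frob_field = const_field \<kappa> for \<kappa> :: "'a::alg_closed_field set" +
  fixes q :: nat
  assumes frob_add: "\<And>x y :: 'a. (x + y) ^ q = x ^ q + y ^ q" and q: "q > 1"
begin

lemma frob_zero: "(0 :: 'a) ^ q = 0" using q by simp

lemma frob_uminus: "(- x :: 'a) ^ q = - (x ^ q)"
  using frob_add[of x "- x"] by (simp add: frob_zero eq_neg_iff_add_eq_0 add.commute)

lemma frob_diff: "(x - y :: 'a) ^ q = x ^ q - y ^ q"
  using frob_add[of x "- y"] by (simp add: frob_uminus)

lemma frob_sum: "(\<Sum>i\<in>I. f i :: 'a) ^ q = (\<Sum>i\<in>I. f i ^ q)"
  by (induction I rule: infinite_finite_induct) (simp_all add: frob_add frob_zero)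

lemma frob_surj:
  assumes c: "c \<in> \<kappa>" obtains b where "b \<in> \<kappa>" "b ^ q = c"
proof -
  obtain b where b: "b ^ q = c" using nth_root_exists[of q c] q by auto
  define P where "P = Polynomial.monom 1 q - [:c:]"
  have "coeff P q = 1" using q by (cases q) (auto simp: P_def)
  hence "P \<noteq> 0" by auto
  moreover have "P \<in> Pol \<kappa>" unfolding P_def by (intro Pol_closed K sfd_closed c)
  moreover have "poly P b = 0" using b by (simp add: P_def poly_monom)
  ultimately show ?thesis using closed b that by blast
qed

definition fr :: "'a poly \<Rightarrow> 'a poly" where "fr P = map_poly (\<lambda>c. c ^ q) P"

lemma coeff_fr: "coeff (fr P) i = coeff P i ^ q"
  by (simp add: fr_def coeff_map_poly frob_zero)

lemma fr_simps:
  "fr (P + Q) = fr P + fr Q" "fr (P - Q) = fr P - fr Q" "fr (P * Q) = fr P * fr Q"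
  "fr (pCons c P) = pCons (c ^ q) (fr P)" "fr 0 = 0" "fr 1 = 1" "fr (P ^ n) = fr P ^ n"
  "fr (sum f I) = (\<Sum>i\<in>I. fr (f i))" "fr (smult c P) = smult (c ^ q) (fr P)"
proof -
  show add: "fr (P + Q) = fr P + fr Q" for P Q by (rule poly_eqI) (simp add: coeff_fr frob_add)
  show "fr (P - Q) = fr P - fr Q" by (rule poly_eqI) (simp add: coeff_fr frob_diff)
  show mult: "fr (P * Q) = fr P * fr Q" for P Q
    by (rule poly_eqI) (simp add: coeff_fr coeff_mult frob_sum power_mult_distrib)
  show "fr (pCons c P) = pCons (c ^ q) (fr P)"
    by (rule poly_eqI) (simp add: coeff_fr coeff_pCons split: nat.splits)
  show zero: "fr 0 = 0" by (rule poly_eqI) (simp add: coeff_fr frob_zero)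
  show one: "fr 1 = 1" by (rule poly_eqI) (simp add: coeff_fr frob_zero)
  show "fr (P ^ n) = fr P ^ n" by (induction n) (simp_all add: one mult)
  show "fr (sum f I) = (\<Sum>i\<in>I. fr (f i))"
    by (induction I rule: infinite_finite_induct) (simp_all add: add zero)
  show "fr (smult c P) = smult (c ^ q) (fr P)" by (rule poly_eqI) (simp add: coeff_fr power_mult_distrib)
qed

lemma fr_Pol: "P \<in> Pol \<kappa> \<Longrightarrow> fr P \<in> Pol \<kappa>"
  by (auto simp: Pol_def coeff_fr intro: sfd_power[OF K])

definition Fq :: "'a set" where "Fq = {a \<in> \<kappa>. a ^ q = a}"

lemma Fq_sfd: "sfd Fq"
  by (rule sfdI) (auto simp: Fq_def sfd_closed[OF K] frob_diff power_mult_distrib power_inverse)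

lemma fr_Fq: "P \<in> Pol Fq \<Longrightarrow> fr P = P"
  by (rule poly_eqI) (simp add: coeff_fr Pol_def Fq_def)

lemma Fq_card: "finite Fq" "card Fq \<le> q"
proof -
  define P :: "'a poly" where "P = Polynomial.monom 1 q - Polynomial.monom 1 1"
  have "coeff P q = 1" using q by (simp add: P_def)
  hence P0: "P \<noteq> 0" by auto
  have "degree P \<le> q" using q unfolding P_def by (intro degree_diff_le) (auto simp: degree_monom_eq)
  moreover have sub: "Fq \<subseteq> {x. poly P x = 0}" by (auto simp: Fq_def P_def poly_monom)
  ultimately show "finite Fq" "card Fq \<le> q"
    using card_mono[OF poly_roots_finite[OF P0] sub] card_poly_roots_bound[OF P0] poly_roots_finite[OF P0]
    by (auto intro: finite_subset)
qed

end

section \<open>Congruences modulo powers of \<open>t = 1/u\<close> at a pole of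
  \<open>u\<close>\<close>

locale pole_place = place \<kappa> V + frob_field \<kappa> q
  for \<kappa> :: "'a::alg_closed_field set" and V q +
  fixes u :: 'a
  assumes u: "u \<notin> V"
begin

abbreviation t :: 'a where "t \<equiv> inverse u"

lemma u0: "u \<noteq> 0" using u V_closed(1) by auto

lemma tu [simp]: "t * u = 1" "u * t = 1" using u0 by auto

lemma tu_pow [simp]: "t ^ n * u ^ n = 1" "u ^ n * t ^ n = 1"
  by (simp_all flip: power_mult_distrib)

lemma t_m: "t \<in> maxid V" using u by (rule inverse_m)

lemma t_V: "t \<in> V" by (rule m_V[OF t_m])

lemma uK: "u \<notin> \<kappa>" using u KV by auto

text \<open>\<open>x \<equiv> y\<close> modulo \<open>t\<^sup>n V\<close>\<close>

definition cg :: "nat \<Rightarrow> 'a \<Rightarrow> 'a \<Rightarrow> bool" where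
  "cg n x y \<longleftrightarrow> (x - y) * u ^ n \<in> V"

lemma cg_refl [simp]: "cg n x x" by (simp add: cg_def V_closed)

lemma cg_sym: "cg n x y \<Longrightarrow> cg n y x"
  unfolding cg_def using V_closed(5)[of "(x - y) * u ^ n"] by (simp add: algebra_simps)

lemma cg_add: "cg n x y \<Longrightarrow> cg n x' y' \<Longrightarrow> cg n (x + x') (y + y')"
  unfolding cg_def using V_closed(3)[of "(x - y) * u ^ n" "(x' - y') * u ^ n"] by (simp add: algebra_simps)

lemma cg_uminus: "cg n x y \<Longrightarrow> cg n (- x) (- y)"
  unfolding cg_def using V_closed(5)[of "(x - y) * u ^ n"] by (simp add: algebra_simps)

lemma cg_diff: "cg n x y \<Longrightarrow> cg n x' y' \<Longrightarrow> cg n (x - x') (y - y')"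
  using cg_add[of n x y "- x'" "- y'"] cg_uminus[of n x' y'] by simp

lemma cg_trans: "cg n x y \<Longrightarrow> cg n y z \<Longrightarrow> cg n x z"
  unfolding cg_def using V_closed(3)[of "(x - y) * u ^ n" "(y - z) * u ^ n"] by (simp add: algebra_simps)

lemma cg_0_iff: "cg 0 x y \<longleftrightarrow> x - y \<in> V" by (simp add: cg_def)

lemma cg_mult: "cg n x y \<Longrightarrow> cg n x' y' \<Longrightarrow> x \<in> V \<Longrightarrow> y' \<in> V \<Longrightarrow> cg n (x * x') (y * y')"
  unfolding cg_def using V_closed(3)[of "x * ((x' - y') * u ^ n)" "((x - y) * u ^ n) * y'"]
    V_closed(4)[of x "(x' - y') * u ^ n"] V_closed(4)[of "(x - y) * u ^ n" y']
  by (simp add: algebra_simps)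

lemma cg_power: "cg n x y \<Longrightarrow> x \<in> V \<Longrightarrow> y \<in> V \<Longrightarrow> cg n (x ^ k) (y ^ k)"
  by (induction k) (auto intro!: cg_mult V_closed)

lemma cg_mono: "cg n x y \<Longrightarrow> m \<le> n \<Longrightarrow> cg m x y"
proof -
  assume "cg n x y" "m \<le> n"
  hence "(x - y) * u ^ n * t ^ (n - m) \<in> V" by (auto simp: cg_def intro!: V_closed t_V)
  moreover have "u ^ n * t ^ (n - m) = u ^ m"
    using \<open>m \<le> n\<close> tu_pow(2)[of "n - m"] by (metis le_add_diff_inverse2 mult.assoc mult.commute mult.right_neutral power_add)
  ultimately show ?thesis by (simp add: cg_def mult.assoc)
qed

lemma cg_shift: "cg (n + m) (t ^ m * x) (t ^ m * y) \<longleftrightarrow> cg n x y"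
proof -
  have "(t ^ m * x - t ^ m * y) * u ^ (n + m) = (t ^ m * u ^ m) * ((x - y) * u ^ n)"
    by (simp add: power_add algebra_simps del: tu_pow)
  thus ?thesis by (simp add: cg_def)
qed

text \<open>The converse fails: a square root of \<open>t\<close> lies in \<open>maxid V\<close> but
  is not a multiple of \<open>t\<close>.\<close>

lemma cg_m: "cg (Suc n) x 0 \<Longrightarrow> x \<in> maxid V"
proof -
  assume "cg (Suc n) x 0"
  hence "x * u ^ Suc n * t ^ Suc n \<in> maxid V"
    unfolding cg_def using m_mult'[OF _ m_mult[OF t_m V_closed(7)[OF t_V, of n]]] by simp
  thus ?thesis by (metis mult.assoc mult.right_neutral tu_pow(2))
qed

lemma cg_poly: "P \<in> Pol \<kappa> \<Longrightarrow> poly P t \<in> V"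
  by (rule Polr_poly[OF R _ t_V]) (auto simp: Pol_def KV)

text \<open>Nonzero constants are units at \<open>V\<close>, so \<open>t\<close> behaves like a free
  variable and the digits of an expansion are well defined.\<close>

lemma cg_poly_iff: "P \<in> Pol \<kappa> \<Longrightarrow> cg n (poly P t) 0 \<longleftrightarrow> (\<forall>i<n. coeff P i = 0)"
proof (induction n arbitrary: P)
  case 0 thus ?case using cg_poly[of P] by (simp add: cg_def)
next
  case (Suc n)
  obtain c P' where P: "P = pCons c P'" by (cases P)
  have c: "c \<in> \<kappa>" "P' \<in> Pol \<kappa>"
    using Pol_coeff[OF Suc.prems, of 0] Pol_coeff[OF Suc.prems, of "Suc i" for i] by (auto simp: P Pol_def)
  have "cg (Suc n) (poly P t) 0 \<longleftrightarrow> c = 0 \<and> cg n (poly P' t) 0"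
  proof (cases "c = 0")
    case True thus ?thesis using cg_shift[of n 1 "poly P' t" 0] by (simp add: P)
  next
    case False
    have "\<not> cg (Suc n) (poly P t) 0"
    proof
      assume "cg (Suc n) (poly P t) 0"
      hence "c + t * poly P' t \<in> maxid V" using cg_m P by simp
      moreover have "t * poly P' t \<in> maxid V" by (rule m_mult[OF t_m cg_poly[OF c(2)]])
      ultimately have "c \<in> maxid V" using m_diff by fastforce
      thus False using m_K c False by blast
    qed
    thus ?thesis using False by simp
  qed
  also have "\<dots> \<longleftrightarrow> (\<forall>i<Suc n. coeff P i = 0)"
    using Suc.IH[OF c(2)] by (auto simp: P less_Suc_eq_0_disj)
  finally show ?case .
qed

text \<open>The value group is archimedean with respect to \<open>t\<close>: \<open>y\<close> is
  algebraic over \<open>\<kappa>(u)\<close>, and solving such a relation for its top power bounds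
  the pole of \<open>y\<close> by the degrees of the coefficients in \<open>u\<close>.\<close>

lemma bounded: "\<exists>n. y * t ^ n \<in> V"
proof (cases "y \<in> V")
  case True thus ?thesis by (intro exI[of _ 0]) simp
next
  case False
  hence y: "inverse y \<in> V" "y \<noteq> 0" using val V_closed(1) by auto
  obtain P where P: "P \<in> Pol (gen \<kappa> {u})" "P \<noteq> 0" "poly P y = 0" using trdeg[OF uK, of y] by (auto simp: alg_over_def)
  obtain D Q where DQ: "D \<in> Pol \<kappa>" "poly D u \<noteq> 0" "Q \<in> BiPol \<kappa>" "smult (poly D u) P = spec Q u"
    by (rule clear_denominators[OF P(1)])
  have cQ: "coeff Q i \<in> Pol \<kappa>" for i using DQ(3) by (simp add: BiPol_def)
  have Q0: "poly (spec Q u) y = 0" "spec Q u \<noteq> 0" using P DQ by (auto simp: DQ(4)[symmetric])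
  define m where "m = degree Q"
  define k where "k = degree (coeff Q m)"
  define N where "N = Max ((\<lambda>i. degree (coeff Q i)) ` {..m})"
  have N: "degree (coeff Q i) \<le> N" if "i \<le> m" for i unfolding N_def using that by (intro Max_ge) auto
  have shrink: "poly p u * t ^ j \<in> V" if "p \<in> Pol \<kappa>" "degree p \<le> j" for p j
  proof -
    have "poly p u * t ^ j = (\<Sum>i\<le>degree p. coeff p i * t ^ (j - i))"
      unfolding poly_altdef sum_distrib_right
    proof (intro sum.cong refl)
      fix i assume "i \<in> {..degree p}"
      hence "t ^ j = t ^ i * t ^ (j - i)" using that by (simp flip: power_add)
      thus "coeff p i * u ^ i * t ^ j = coeff p i * t ^ (j - i)"
        by (metis mult.assoc mult.right_neutral tu_pow(2))
    qed
    also have "\<dots> \<in> V" using that(1) by (intro V_closed t_V KV) (auto simp: Pol_def)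
    finally show ?thesis .
  qed
  define lc where "lc = poly (coeff Q m) u * t ^ k"
  have "coeff Q m \<noteq> 0" using Q0(2) by (auto simp: m_def)
  \<comment> \<open>\<open>lc\<close> is the leading coefficient \<open>a\<close> plus multiples of
    \<open>t\<close>, hence a unit.\<close>
  have lcm: "lc \<notin> maxid V"
  proof
    assume lc: "lc \<in> maxid V"
    define a where "a = lead_coeff (coeff Q m)"
    have a: "a \<in> \<kappa>" "a \<noteq> 0" using cQ \<open>coeff Q m \<noteq> 0\<close> by (auto simp: a_def Pol_def)
    define p where "p = coeff Q m - Polynomial.monom a k"
    have p: "p \<in> Pol \<kappa>" unfolding p_def by (intro Pol_closed K cQ a)
    have pk: "coeff p i = 0" if "i \<ge> k" for i
      using that by (cases "i = k") (auto simp: p_def k_def a_def coeff_eq_0)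
    have "poly p u * t ^ k \<in> maxid V"
    proof (cases "k = 0")
      case True
      hence "p = 0" using pk by (intro poly_eqI) auto
      thus ?thesis by (simp add: m_zero)
    next
      case False
      have "degree p \<le> k - 1" using pk False by (intro degree_le) auto
      hence "poly p u * t ^ (k - 1) * t \<in> maxid V" by (intro m_mult' shrink p t_m)
      thus ?thesis using False by (metis (no_types, lifting) One_nat_def Suc_pred gr0I mult.assoc power_Suc2)
    qed
    moreover have "lc = poly p u * t ^ k + a" by (simp add: lc_def p_def poly_monom algebra_simps)
    ultimately have "a \<in> maxid V" using m_diff[OF lc] by fastforce
    thus False using m_K a by blast
  qed
  have lc: "inverse lc \<in> V" "lc \<noteq> 0" using lcm by (auto simp: notm)
  have m: "m > 0"
  proof (rule ccontr)
    assume "\<not> m > 0"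
    then obtain c where "Q = [:c:]" by (metis degree_eq_zeroE gr0I m_def)
    thus False using Q0 by simp
  qed
  have "(\<Sum>i\<le>m. poly (coeff Q i) u * y ^ i) = 0" using Q0 by (simp add: poly_spec m_def)
  hence top: "poly (coeff Q m) u * y ^ m = - (\<Sum>i<m. poly (coeff Q i) u * y ^ i)"
    by (simp add: eq_neg_iff_add_eq_0 add.commute flip: lessThan_Suc_atMost)
  have "y * t ^ N = inverse lc * t ^ k * (- (\<Sum>i<m. (poly (coeff Q i) u * t ^ N) * inverse y ^ (m - 1 - i)))"
  proof -
    have "(\<Sum>i<m. (poly (coeff Q i) u * t ^ N) * inverse y ^ (m - 1 - i)) * y ^ (m - 1)
        = (\<Sum>i<m. poly (coeff Q i) u * y ^ i) * t ^ N"
      unfolding sum_distrib_right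
    proof (intro sum.cong refl)
      fix i assume "i \<in> {..<m}"
      hence "y ^ (m - 1) = y ^ i * y ^ (m - 1 - i)" by (simp flip: power_add)
      hence "inverse y ^ (m - 1 - i) * y ^ (m - 1) = y ^ i" using y(2) by (simp add: field_simps)
      thus "poly (coeff Q i) u * t ^ N * inverse y ^ (m - 1 - i) * y ^ (m - 1) = poly (coeff Q i) u * y ^ i * t ^ N"
        by (metis (no_types, lifting) mult.assoc mult.commute)
    qed
    also have "\<dots> = - (poly (coeff Q m) u * y ^ m * t ^ N)" using top by simp
    finally have e: "(- (\<Sum>i<m. (poly (coeff Q i) u * t ^ N) * inverse y ^ (m - 1 - i))) * y ^ (m - 1)
        = (poly (coeff Q m) u * y * t ^ N) * y ^ (m - 1)"
      using m by (simp add: power_eq_if[of y m] mult_ac)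
    hence "- (\<Sum>i<m. (poly (coeff Q i) u * t ^ N) * inverse y ^ (m - 1 - i)) = poly (coeff Q m) u * y * t ^ N"
      using y(2) by (subst (asm) mult_right_cancel) auto
    hence "inverse lc * t ^ k * (- (\<Sum>i<m. (poly (coeff Q i) u * t ^ N) * inverse y ^ (m - 1 - i)))
        = (inverse lc * lc) * (y * t ^ N)" by (simp add: lc_def mult_ac del: tu tu_pow)
    thus ?thesis using lc(2) by simp
  qed
  also have "\<dots> \<in> V" using N by (intro V_closed lc(1) t_V y(1) shrink cQ) auto
  finally show ?thesis by blast
qed

text \<open>Comes from \<open>bounded\<close> for the inverse of \<open>y\<close>. It makes
  expansions separating: an element divisible by all powers of \<open>t\<close> is 0.\<close>

lemma not_divisible: "y \<noteq> 0 \<Longrightarrow> \<exists>n. \<not> cg n y 0"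
proof -
  assume y: "y \<noteq> 0"
  obtain n where n: "inverse y * t ^ n \<in> V" using bounded by blast
  have "\<not> cg (Suc n) y 0"
  proof
    assume "cg (Suc n) y 0"
    hence "y * u ^ Suc n * (inverse y * t ^ n) \<in> V" using n by (auto simp: cg_def intro: V_closed)
    also have "y * u ^ Suc n * (inverse y * t ^ n) = (y * inverse y) * u * (u ^ n * t ^ n)"
      by (simp add: mult_ac del: tu_pow)
    also have "\<dots> = u" using y by simp
    finally show False using u by simp
  qed
  thus ?thesis by blast
qed


subsection \<open>The Frobenius of the constants acting on Laurent expansions\<close>

text \<open>\<open>R0 a b\<close> says that \<open>a\<close> has an expansion \<open>\<Sum>c\<^sub>i t\<^sup>i\<close> with \<open>c\<^sub>i \<in> \<kappa>\<close> and that \<open>b\<close> is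
  \<open>\<Sum>c\<^sub>i\<^sup>q t\<^sup>i\<close>; \<open>Rhat\<close> allows finitely many negative exponents.\<close>

definition R0 :: "'a \<Rightarrow> 'a \<Rightarrow> bool" where
  "R0 a b \<longleftrightarrow> (\<forall>n. \<exists>P\<in>Pol \<kappa>. cg n a (poly P t) \<and> cg n b (poly (fr P) t))"

definition Rhat :: "'a \<Rightarrow> 'a \<Rightarrow> bool" where
  "Rhat a b \<longleftrightarrow> (\<exists>k. R0 (a * t ^ k) (b * t ^ k))"

lemma R0_V: assumes "R0 a b" shows "a \<in> V" "b \<in> V"
proof -
  obtain P where P: "P \<in> Pol \<kappa>" "cg 0 a (poly P t)" "cg 0 b (poly (fr P) t)" using assms by (auto simp: R0_def)
  show "a \<in> V" using V_closed(3)[of "a - poly P t" "poly P t"] P(1,2) cg_poly by (simp add: cg_0_iff)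
  show "b \<in> V" using V_closed(3)[of "b - poly (fr P) t" "poly (fr P) t"] P(1,3) cg_poly[OF fr_Pol]
    by (simp add: cg_0_iff)
qed

lemma R0_const: "c \<in> \<kappa> \<Longrightarrow> R0 c (c ^ q)"
  unfolding R0_def by (intro allI bexI[of _ "[:c:]"]) (auto simp: fr_simps Pol_closed[OF K])

lemma R0_t: "R0 t t"
  unfolding R0_def
  by (intro allI bexI[of _ "[:0, 1:]"]) (auto simp: fr_simps frob_zero Pol_closed[OF K] sfd_closed[OF K])

lemma R0_add: "R0 a b \<Longrightarrow> R0 a' b' \<Longrightarrow> R0 (a + a') (b + b')"
  unfolding R0_def
proof (intro allI)
  fix n assume "\<forall>n. \<exists>P\<in>Pol \<kappa>. cg n a (poly P t) \<and> cg n b (poly (fr P) t)"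
    "\<forall>n. \<exists>P\<in>Pol \<kappa>. cg n a' (poly P t) \<and> cg n b' (poly (fr P) t)"
  then obtain P P' where "P \<in> Pol \<kappa>" "cg n a (poly P t)" "cg n b (poly (fr P) t)"
    "P' \<in> Pol \<kappa>" "cg n a' (poly P' t)" "cg n b' (poly (fr P') t)" by metis
  thus "\<exists>P\<in>Pol \<kappa>. cg n (a + a') (poly P t) \<and> cg n (b + b') (poly (fr P) t)"
    by (intro bexI[of _ "P + P'"]) (auto simp: fr_simps Pol_closed[OF K] intro: cg_add)
qed

lemma R0_mult: assumes "R0 a b" "R0 a' b'" shows "R0 (a * a') (b * b')"
  unfolding R0_def
proof (intro allI)
  fix n
  obtain P where P: "P \<in> Pol \<kappa>" "cg n a (poly P t)" "cg n b (poly (fr P) t)" using assms(1) unfolding R0_def by metis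
  obtain P' where P': "P' \<in> Pol \<kappa>" "cg n a' (poly P' t)" "cg n b' (poly (fr P') t)"
    using assms(2) unfolding R0_def by metis
  show "\<exists>P\<in>Pol \<kappa>. cg n (a * a') (poly P t) \<and> cg n (b * b') (poly (fr P) t)"
    using P P' R0_V[OF assms(1)] cg_poly fr_Pol
    by (intro bexI[of _ "P * P'"]) (auto simp: fr_simps Pol_closed[OF K] intro!: cg_mult)
qed

lemma R0_tpow: "R0 a b \<Longrightarrow> R0 (a * t ^ n) (b * t ^ n)"
  by (induction n) (auto simp: mult.assoc[symmetric] power_Suc2 simp del: power_Suc intro: R0_mult R0_t)

text \<open>Digits \<open>c\<close> and \<open>c^q\<close> vanish together, so \<open>a\<close> and
  \<open>b\<close> have the same order of vanishing.\<close>

lemma R0_cg_iff: assumes "R0 a b" shows "cg n a 0 \<longleftrightarrow> cg n b 0"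
proof -
  obtain P where P: "P \<in> Pol \<kappa>" "cg n a (poly P t)" "cg n b (poly (fr P) t)" using assms unfolding R0_def by metis
  have "cg n a 0 \<longleftrightarrow> cg n (poly P t) 0" using P(2) cg_trans cg_sym by blast
  also have "\<dots> \<longleftrightarrow> cg n (poly (fr P) t) 0"
    using q by (simp add: cg_poly_iff P(1) fr_Pol coeff_fr)
  also have "\<dots> \<longleftrightarrow> cg n b 0" using P(3) cg_trans cg_sym by blast
  finally show ?thesis .
qed

lemma R0_shift: assumes "R0 a b" "cg n a 0" shows "R0 (a * u ^ n) (b * u ^ n)"
  using assms(2)
proof (induction n)
  case (Suc n)
  have "cg n a 0" using cg_mono[OF Suc.prems] by simp
  define a' where "a' = a * u ^ n"
  define b' where "b' = b * u ^ n"
  have r: "R0 a' b'" unfolding a'_def b'_def by (rule Suc.IH) fact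
  have a1: "cg 1 a' 0" using Suc.prems by (simp add: cg_def a'_def mult_ac)
  have "R0 (a' * u) (b' * u)" unfolding R0_def
  proof
    fix m
    \<comment> \<open>One extra digit is taken because division by \<open>t\<close> loses
      one.\<close>
    obtain P where P: "P \<in> Pol \<kappa>" "cg (Suc m) a' (poly P t)" "cg (Suc m) b' (poly (fr P) t)"
      using r unfolding R0_def by metis
    have "cg 1 (poly P t) 0" using cg_mono[OF P(2), of 1] a1 cg_trans cg_sym by (metis One_nat_def Suc_le_mono le0)
    hence "coeff P 0 = 0" using cg_poly_iff[OF P(1), of 1] by simp
    then obtain P' where P': "P = pCons 0 P'" by (cases P) auto
    have P'K: "P' \<in> Pol \<kappa>" using Pol_coeff[OF P(1), of "Suc i" for i] by (simp add: P' Pol_def)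
    have "cg m (a' * u) (poly P' t)"
      using P(2) cg_shift[of m 1 "a' * u" "poly P' t"] by (simp add: P' mult.left_commute)
    moreover have "cg m (b' * u) (poly (fr P') t)"
      using P(3) cg_shift[of m 1 "b' * u" "poly (fr P') t"] by (simp add: P' fr_simps frob_zero mult.left_commute)
    ultimately show "\<exists>P\<in>Pol \<kappa>. cg m (a' * u) (poly P t) \<and> cg m (b' * u) (poly (fr P) t)" using P'K by blast
  qed
  thus ?case by (simp add: a'_def b'_def mult_ac)
qed (use assms in simp)

lemma R0_residue:
  assumes "R0 a b"
  obtains c where "c \<in> \<kappa>" "cg 1 a c" "cg 1 b (c ^ q)"
proof -
  obtain P where P: "P \<in> Pol \<kappa>" "cg 1 a (poly P t)" "cg 1 b (poly (fr P) t)" using assms unfolding R0_def by metis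
  have *: "cg 1 (poly P t) (coeff P 0)" if "P \<in> Pol \<kappa>" for P
  proof -
    have c: "coeff P 0 \<in> \<kappa>" using that by (simp add: Pol_def)
    have "P - [:coeff P 0:] \<in> Pol \<kappa>" by (intro Pol_closed K that c)
    from cg_poly_iff[OF this, of 1] have "cg 1 (poly P t - coeff P 0) 0" by simp
    thus ?thesis by (simp add: cg_def)
  qed
  have "cg 1 a (coeff P 0)" using cg_trans[OF P(2) *[OF P(1)]] .
  moreover have "cg 1 b (coeff P 0 ^ q)" using cg_trans[OF P(3) *[OF fr_Pol[OF P(1)]]] by (simp add: coeff_fr)
  ultimately show ?thesis using that[of "coeff P 0"] P(1) by (simp add: Pol_def)
qed

text \<open>\<open>Q\<close> is the truncated geometric series for \<open>1/P\<close>; the remainder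
  is an n-th power of a multiple of \<open>t\<close>. The explicit form of \<open>Q\<close> matters
  because it commutes with \<open>fr\<close>.\<close>

lemma cg_geometric:
  assumes P: "P \<in> Pol \<kappa>" "coeff P 0 = c" "c \<noteq> 0" and a: "cg n a (poly P t)" "a \<notin> maxid V"
    and Q: "Q = smult (inverse c) (\<Sum>i<n. (1 - smult (inverse c) P) ^ i)"
  shows "cg n (inverse a) (poly Q t)"
proof -
  have c: "c \<in> \<kappa>" using P by (auto simp: Pol_def)
  have QK: "Q \<in> Pol \<kappa>" unfolding Q by (intro Pol_closed K sfd_closed P c)
  define T where "T = (1 - smult (inverse c) P) ^ n"
  have "1 - T = smult (inverse c) P * (\<Sum>i<n. (1 - smult (inverse c) P) ^ i)"
    unfolding T_def using one_diff_power_eq[of "1 - smult (inverse c) P" n] by simp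
  hence PQ: "P * Q = 1 - T" by (simp add: Q)
  have TK: "T \<in> Pol \<kappa>" unfolding T_def by (intro Pol_closed K sfd_closed P c)
  have b: "inverse a \<in> V" "a \<noteq> 0" using a(2) by (auto simp: notm)
  obtain w0 W where W0: "1 - smult (inverse c) P = pCons w0 W" by (cases "1 - smult (inverse c) P")
  have "coeff (1 - smult (inverse c) P) 0 = 0" using P(2,3) by simp
  hence W: "1 - smult (inverse c) P = pCons 0 W" by (simp add: W0)
  have "T = Polynomial.monom 1 n * W ^ n"
  proof -
    have "pCons 0 W = Polynomial.monom 1 1 * W" by (simp add: monom_altdef)
    thus ?thesis by (simp add: T_def W power_mult_distrib monom_power)
  qed
  hence "\<forall>i<n. coeff T i = 0" by (simp add: coeff_monom_mult)
  hence T0: "cg n (poly T t) 0" using cg_poly_iff[OF TK] by simp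
  have aV: "a \<in> V" using V_closed(3)[of "a - poly P t" "poly P t"] cg_mono[OF a(1), of 0] cg_poly[OF P(1)]
    by (simp add: cg_0_iff)
  have "cg n (a * poly Q t) (poly P t * poly Q t)" by (intro cg_mult a aV cg_refl cg_poly QK)
  hence "cg n (a * poly Q t) (1 - poly T t)" by (metis PQ poly_mult poly_diff poly_1)
  moreover have "cg n (1 - poly T t) (1 - 0)" by (intro cg_diff T0 cg_refl)
  ultimately have "cg n (a * poly Q t) 1" using cg_trans by fastforce
  hence "cg n (inverse a * (a * poly Q t)) (inverse a * 1)"
    using V_closed b by (intro cg_mult) auto
  hence "cg n (poly Q t) (inverse a)" using b(2) by (simp add: mult.assoc[symmetric])
  thus ?thesis by (rule cg_sym)
qed

lemma R0_inverse:
  assumes r: "R0 a b" and a: "a \<notin> maxid V" and b: "b \<notin> maxid V"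
  shows "R0 (inverse a) (inverse b)"
  unfolding R0_def
proof
  fix n
  \<comment> \<open>Precision at least 1 is needed even for \<open>n = 0\<close>: only then does
    \<open>P\<close> show that its constant coefficient is nonzero.\<close>
  obtain P where P: "P \<in> Pol \<kappa>" "cg (Suc n) a (poly P t)" "cg (Suc n) b (poly (fr P) t)"
    using r unfolding R0_def by metis
  define c where "c = coeff P 0"
  have c: "c \<in> \<kappa>" using P(1) by (simp add: c_def Pol_def)
  have "c \<noteq> 0"
  proof
    assume "c = 0"
    hence "cg 1 (poly P t) 0" using cg_poly_iff[OF P(1), of 1] by (simp add: c_def)
    moreover have "cg 1 a (poly P t)" using cg_mono[OF P(2), of 1] by simp
    ultimately have "cg 1 a 0" using cg_trans by blast
    thus False using cg_m[of 0 a] a by simp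
  qed
  define Q where "Q = smult (inverse c) (\<Sum>i<Suc n. (1 - smult (inverse c) P) ^ i)"
  have QK: "Q \<in> Pol \<kappa>" unfolding Q_def by (intro Pol_closed K sfd_closed P c)
  have frQ: "fr Q = smult (inverse (c ^ q)) (\<Sum>i<Suc n. (1 - smult (inverse (c ^ q)) (fr P)) ^ i)"
    unfolding Q_def by (simp only: fr_simps power_inverse)
  have "cg (Suc n) (inverse a) (poly Q t)"
    by (rule cg_geometric[OF P(1) c_def[symmetric] \<open>c \<noteq> 0\<close> P(2) a Q_def])
  moreover have "cg (Suc n) (inverse b) (poly (fr Q) t)"
    by (rule cg_geometric[OF fr_Pol[OF P(1)] _ _ P(3) b frQ]) (use \<open>c \<noteq> 0\<close> in \<open>auto simp: coeff_fr c_def\<close>)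
  ultimately have "cg n (inverse a) (poly Q t) \<and> cg n (inverse b) (poly (fr Q) t)"
    using cg_mono by (meson le_SucI order.refl)
  thus "\<exists>P\<in>Pol \<kappa>. cg n (inverse a) (poly P t) \<and> cg n (inverse b) (poly (fr P) t)" using QK by blast
qed

lemma Rhat_raise: "R0 (a * t ^ k) (b * t ^ k) \<Longrightarrow> k \<le> k' \<Longrightarrow> R0 (a * t ^ k') (b * t ^ k')"
  using R0_tpow[of "a * t ^ k" "b * t ^ k" "k' - k"] by (simp add: mult.assoc flip: power_add)

lemma Rhat_add: "Rhat a b \<Longrightarrow> Rhat a' b' \<Longrightarrow> Rhat (a + a') (b + b')"
proof -
  assume "Rhat a b" "Rhat a' b'"
  then obtain k k' where "R0 (a * t ^ k) (b * t ^ k)" "R0 (a' * t ^ k') (b' * t ^ k')" by (auto simp: Rhat_def)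
  hence "R0 (a * t ^ max k k') (b * t ^ max k k')" "R0 (a' * t ^ max k k') (b' * t ^ max k k')"
    by (auto intro: Rhat_raise)
  from R0_add[OF this] show ?thesis unfolding Rhat_def by (auto simp: distrib_right)
qed

lemma Rhat_mult: "Rhat a b \<Longrightarrow> Rhat a' b' \<Longrightarrow> Rhat (a * a') (b * b')"
proof -
  assume "Rhat a b" "Rhat a' b'"
  then obtain k k' where "R0 (a * t ^ k) (b * t ^ k)" "R0 (a' * t ^ k') (b' * t ^ k')" by (auto simp: Rhat_def)
  from R0_mult[OF this] show ?thesis
    unfolding Rhat_def by (intro exI[of _ "k + k'"]) (simp add: power_add mult_ac)
qed

lemma Rhat_const: "c \<in> \<kappa> \<Longrightarrow> Rhat c (c ^ q)"
  unfolding Rhat_def by (rule exI[of _ 0]) (simp add: R0_const)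

lemma Rhat_u: "Rhat u u"
proof -
  have "R0 1 1" using R0_const[OF sfd_1[OF K]] by simp
  thus ?thesis unfolding Rhat_def by (intro exI[of _ 1]) simp
qed

lemma Rhat_diff: "Rhat a b \<Longrightarrow> Rhat a' b' \<Longrightarrow> Rhat (a - a') (b - b')"
proof -
  assume *: "Rhat a b" "Rhat a' b'"
  have "Rhat (-1) (-1)" using Rhat_const[of "-1"] sfd_closed[OF K] by (simp add: frob_uminus)
  from Rhat_add[OF *(1) Rhat_mult[OF this *(2)]] show ?thesis by simp
qed

lemma Rhat_zero_iff: assumes "Rhat a b" shows "a = 0 \<longleftrightarrow> b = 0"
proof -
  obtain k where k: "R0 (a * t ^ k) (b * t ^ k)" using assms by (auto simp: Rhat_def)
  have z: "x = 0 \<longleftrightarrow> (\<forall>n. cg n (x * t ^ k) 0)" for x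
    using not_divisible[of "x * t ^ k"] u0 by auto
  show ?thesis using R0_cg_iff[OF k] by (simp add: z[of a] z[of b])
qed

text \<open>The exact number \<open>N\<close> of factors \<open>t\<close> is removed first, which by
  \<open>R0_cg_iff\<close> is the same on both sides and finite by \<open>not_divisible\<close>.
  What remains has a nonzero constant digit and is inverted by \<open>R0_inverse\<close>.\<close>

lemma Rhat_inverse: assumes r: "Rhat a b" shows "Rhat (inverse a) (inverse b)"
proof (cases "a = 0")
  case True
  thus ?thesis using r Rhat_zero_iff[OF r] by simp
next
  case False
  obtain k where k: "R0 (a * t ^ k) (b * t ^ k)" using r by (auto simp: Rhat_def)
  define a' where "a' = a * t ^ k"
  define b' where "b' = b * t ^ k"
  have r': "R0 a' b'" using k by (simp add: a'_def b'_def)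
  have ex: "\<exists>n. \<not> cg n a' 0" using not_divisible[of a'] False u0 by (simp add: a'_def)
  define N0 where "N0 = (LEAST n. \<not> cg n a' 0)"
  have N0: "\<not> cg N0 a' 0" unfolding N0_def by (rule LeastI_ex[OF ex])
  have N0': "cg n a' 0" if "n < N0" for n
    using not_less_Least[of n "\<lambda>n. \<not> cg n a' 0"] that unfolding N0_def by blast
  have "N0 \<noteq> 0"
  proof
    assume "N0 = 0"
    thus False using N0 R0_V(1)[OF r'] by (simp add: cg_0_iff)
  qed
  then obtain N where "N0 = Suc N" by (cases N0) auto
  with N0 N0' have N: "\<not> cg (Suc N) a' 0" "cg N a' 0" by auto
  define a'' where "a'' = a' * u ^ N"
  define b'' where "b'' = b' * u ^ N"
  have r'': "R0 a'' b''" unfolding a''_def b''_def by (rule R0_shift[OF r' N(2)])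
  have a1: "\<not> cg 1 a'' 0" using N(1) by (simp add: cg_def a''_def mult_ac)
  hence b1: "\<not> cg 1 b'' 0" using R0_cg_iff[OF r''] by simp
  obtain c where c: "c \<in> \<kappa>" "cg 1 a'' c" "cg 1 b'' (c ^ q)" by (rule R0_residue[OF r''])
  have c0: "c \<noteq> 0" using a1 c(2) by auto
  have nm: "x \<notin> maxid V" if "cg 1 x y" "y \<in> \<kappa>" "y \<noteq> 0" for x y
  proof
    assume x: "x \<in> maxid V"
    have "cg 1 (x - y) 0" using that(1) by (simp add: cg_def)
    hence "x - y \<in> maxid V" using cg_m[of 0 "x - y"] by simp
    from m_diff[OF x this] have "y \<in> maxid V" by simp
    thus False using m_K that by blast
  qed
  have "R0 (inverse a'') (inverse b'')"
    by (rule R0_inverse[OF r'']) (use nm[OF c(2)] nm[OF c(3)] c c0 sfd_power[OF K] in auto)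
  hence "R0 (inverse a'' * t ^ k) (inverse b'' * t ^ k)" by (rule R0_tpow)
  moreover have "inverse (x * t ^ k * u ^ N) * t ^ k = inverse x * t ^ N" for x
    using u0 by (simp add: power_inverse)
  ultimately have "R0 (inverse a * t ^ N) (inverse b * t ^ N)" unfolding a''_def b''_def a'_def b'_def by metis
  thus ?thesis unfolding Rhat_def by blast
qed

text \<open>The local source of \<open>\<sigma>(g) \<equiv> g^q\<close>: if \<open>g\<close> has
  residue \<open>c\<close>, both sides have residue \<open>c^q\<close>.\<close>

lemma Rhat_residue:
  assumes "Rhat a b" "a \<in> V"
  obtains c where "c \<in> \<kappa>" "a - c \<in> maxid V" "b - c ^ q \<in> maxid V"
proof -
  obtain k where k: "R0 (a * t ^ k) (b * t ^ k)" using assms by (auto simp: Rhat_def)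
  have "cg k (a * t ^ k) 0" using assms(2) by (simp add: cg_def mult.assoc)
  from R0_shift[OF k this] have r: "R0 a b" by (simp add: mult.assoc)
  obtain c where c: "c \<in> \<kappa>" "cg 1 a c" "cg 1 b (c ^ q)" by (rule R0_residue[OF r])
  have "x - y \<in> maxid V" if "cg 1 x y" for x y
    using that cg_m[of 0 "x - y"] by (simp add: cg_def)
  thus ?thesis using that c by blast
qed

end

lemma sfd_of_nat: "sfd F \<Longrightarrow> of_nat n \<in> F"
  by (induction n) (auto simp: sfd_closed)

lemma pow_split:
  assumes "e + 2 \<le> d" shows "(x :: 'a::comm_monoid_mult) ^ d = x ^ (d - 1 - e) * (x ^ e * x)"
proof -
  obtain j where "d = e + 2 + j" using assms le_Suc_ex by blast
  thus ?thesis by (simp add: power_add mult_ac power2_eq_square)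
qed

subsection \<open>The dynamics of \<open>(z\<^sup>d - s) / z\<^sup>e\<close> at a place\<close>

definition fmap :: "'a::field \<Rightarrow> nat \<Rightarrow> nat \<Rightarrow> 'a \<Rightarrow> 'a" where
  "fmap s d e x = (x ^ d - s) / x ^ e"

text \<open>The test \<open>x ^ e = 0\<close> handles both cases: for \<open>e = 0\<close> it never
  holds and 0 is an ordinary point.\<close>

fun fstep :: "'a::field \<Rightarrow> nat \<Rightarrow> nat \<Rightarrow> 'a proj_line \<Rightarrow> 'a proj_line" where
  "fstep s d e Infty = Infty"
| "fstep s d e (Aff x) = (if x ^ e = 0 then Infty else Aff (fmap s d e x))"

definition preper :: "'a::field \<Rightarrow> nat \<Rightarrow> nat \<Rightarrow> 'a proj_line \<Rightarrow> bool" where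
  "preper s d e P \<longleftrightarrow> finite (range (\<lambda>n. (fstep s d e ^^ n) P))"

lemma preper_step: "preper s d e P \<Longrightarrow> preper s d e (fstep s d e P)"
  unfolding preper_def
  by (rule finite_subset) (auto simp: funpow_swap1 simp flip: funpow.simps(2)[unfolded o_apply] intro!: image_eqI[of _ _ "Suc _"])

context place
begin

lemma notV_mult: "a \<notin> V \<Longrightarrow> b \<notin> maxid V \<Longrightarrow> a * b \<notin> V"
proof
  assume "a \<notin> V" "b \<notin> maxid V" "a * b \<in> V"
  hence "a * b * inverse b \<in> V" "b \<noteq> 0" by (auto simp: notm intro: V_closed)
  thus False using \<open>a \<notin> V\<close> by (simp add: mult.assoc)
qed

lemma notV_notm: "a \<notin> V \<Longrightarrow> a \<notin> maxid V" using m_V by auto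

lemma notV_0: "a \<notin> V \<Longrightarrow> a \<noteq> 0" using V_closed(1) by auto

lemma notV_power: "a \<notin> V \<Longrightarrow> n > 0 \<Longrightarrow> a ^ n \<notin> V" using V_power by blast

lemma m_power: "a \<in> maxid V \<Longrightarrow> n > 0 \<Longrightarrow> a ^ n \<in> maxid V"
  using m_mult[of a "a ^ (n - 1)"] m_V[of a] V_closed(7) by (cases n) auto

text \<open>Each step multiplies the point by an element outside \<open>V\<close>, so absolute
  values grow strictly along the orbit and no point recurs.\<close>

lemma escape:
  assumes A: "\<And>x. x \<in> A \<Longrightarrow> x \<noteq> 0 \<and> fmap s d e x \<in> A \<and> fmap s d e x / x \<notin> V" and x: "x \<in> A"
  shows "\<not> preper s d e (Aff x)"
proof -
  define xn where "xn = (\<lambda>n. (fmap s d e ^^ n) x)"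
  have xA: "xn n \<in> A" for n unfolding xn_def by (induction n) (use x A in auto)
  have st: "xn (Suc n) / xn n \<notin> V" for n using A[OF xA[of n]] by (simp add: xn_def)
  have orbit: "(fstep s d e ^^ n) (Aff x) = Aff (xn n)" for n
    by (induction n) (use A xA in \<open>auto simp: xn_def\<close>)
  have grow: "xn (n + Suc k) / xn n \<notin> V" for n k
  proof (induction k)
    case 0 thus ?case using st[of n] by simp
  next
    case (Suc k)
    have "xn (n + Suc k) / xn n * (xn (Suc (n + Suc k)) / xn (n + Suc k)) \<notin> V"
      by (rule notV_mult[OF Suc notV_notm[OF st]])
    thus ?case using A[OF xA[of "n + Suc k"]] by simp
  qed
  have ne: "xn n \<noteq> xn m" if nm: "n < m" for n m
  proof
    assume "xn n = xn m"
    moreover obtain k where "m = n + Suc k" using less_imp_Suc_add[OF nm] by auto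
    ultimately have "xn n / xn n \<notin> V" using grow[of n k] by simp
    thus False using A[OF xA[of n]] V_closed(2) by simp
  qed
  have "inj (\<lambda>n. (fstep s d e ^^ n) (Aff x))"
    unfolding orbit
  proof (rule injI)
    fix n m assume "Aff (xn n) = Aff (xn m)"
    thus "n = m" using ne[of n m] ne[of m n] by (cases n m rule: linorder_cases) auto
  qed
  thus ?thesis unfolding preper_def using finite_imageD infinite_UNIV_nat by blast
qed

text \<open>Infinity is attracting: the quotient equals \<open>x^(d-1-e) (1 - s/x^d)\<close>, with
  exponent at least 1 and a second factor that is a unit.\<close>

lemma fmap_large:
  assumes ed: "e + 2 \<le> d" and x: "x \<notin> V" and sx: "s / x ^ d \<in> maxid V"
  shows "fmap s d e x / x \<notin> V"
proof -
  have x0: "x \<noteq> 0" using notV_0 x .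
  have "x ^ (d - 1 - e) * (1 - s / x ^ d) \<notin> V"
    by (intro notV_mult notV_power unit_1_diff sx x) (use ed in auto)
  moreover have "fmap s d e x / x = x ^ (d - 1 - e) * (1 - s / x ^ d)"
  proof -
    have "x ^ d = x ^ (d - 1 - e) * (x ^ e * x)" by (rule pow_split[OF ed])
    hence "x ^ (d - 1 - e) = x ^ d / (x ^ e * x)" using x0 by (simp add: field_simps)
    thus ?thesis using x0 by (simp add: fmap_def field_simps)
  qed
  ultimately show ?thesis by simp
qed

lemma preper_integral:
  assumes ed: "e + 2 \<le> d" and s: "s \<in> V" and x: "preper s d e (Aff x)"
  shows "x \<in> V"
proof (rule ccontr)
  assume xV: "x \<notin> V"
  have "y \<noteq> 0 \<and> fmap s d e y \<in> - V \<and> fmap s d e y / y \<notin> V" if "y \<in> - V" for y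
  proof -
    have y: "y \<notin> V" using that by simp
    have "s / y ^ d = s * inverse y ^ d" by (simp add: divide_inverse power_inverse)
    also have "\<dots> \<in> maxid V" by (intro m_mult' s m_power inverse_m y) (use ed in auto)
    finally have big: "fmap s d e y / y \<notin> V" by (rule fmap_large[OF ed y])
    have "fmap s d e y / y * y \<notin> V" by (rule notV_mult[OF big notV_notm[OF y]])
    thus ?thesis using big notV_0[OF y] by simp
  qed
  from escape[OF this, of x] show False using x xV by auto
qed

text \<open>A point larger than \<open>u\<close> escapes to infinity. A nonzero point smaller than
  \<open>u\<close> is sent by the dominant term \<open>- s / x^e\<close> to a point larger than
  \<open>u\<close>, which then escapes.\<close>

lemma preper_pole:
  assumes ed: "e + 2 \<le> d" and u: "u \<notin> V" and s: "s = u ^ d" and x: "preper s d e (Aff x)" "x \<noteq> 0"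
  shows "x / u \<in> V" "x / u \<notin> maxid V"
proof -
  have u0: "u \<noteq> 0" using notV_0 u .
  define A where "A = {x. x / u \<notin> V}"
  have esc: "\<not> preper s d e (Aff y)" if "y \<in> A" for y
  proof (rule escape[OF _ that])
    fix y assume "y \<in> A"
    hence yu: "y / u \<notin> V" by (simp add: A_def)
    have "y / u * u \<notin> V" by (rule notV_mult[OF yu notV_notm[OF u]])
    hence y: "y \<notin> V" using u0 by simp
    have y0: "y \<noteq> 0" using notV_0 y .
    have "s / y ^ d = inverse (y / u) ^ d" by (simp add: s field_simps)
    also have "\<dots> \<in> maxid V" by (intro m_power inverse_m yu) (use ed in auto)
    finally have big: "fmap s d e y / y \<notin> V" by (rule fmap_large[OF ed y])
    have "fmap s d e y / y * (y / u) \<notin> V" by (rule notV_mult[OF big notV_notm[OF yu]])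
    thus "y \<noteq> 0 \<and> fmap s d e y \<in> A \<and> fmap s d e y / y \<notin> V" using big y0 by (simp add: A_def)
  qed
  show "x / u \<in> V" using esc[of x] x(1) by (auto simp: A_def)
  show "x / u \<notin> maxid V"
  proof
    assume xm: "x / u \<in> maxid V"
    hence ux: "inverse (x / u) \<notin> V" using x(2) u0 by (simp add: maxid_def)
    have "inverse (x / u) ^ e \<notin> maxid V"
      using one_notm notV_notm[OF notV_power[OF ux]] by (cases "e = 0") auto
    moreover have "u ^ (d - 1 - e) \<notin> V" by (rule notV_power[OF u]) (use ed in simp)
    moreover have "1 - (x / u) ^ d \<notin> maxid V" by (intro unit_1_diff m_power xm) (use ed in simp)
    ultimately have "u ^ (d - 1 - e) * inverse (x / u) ^ e * (1 - (x / u) ^ d) \<notin> V" by (intro notV_mult)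
    moreover have "u ^ (d - 1 - e) * inverse (x / u) ^ e * (1 - (x / u) ^ d) = - (fmap s d e x / u)"
    proof -
      have "u ^ d = u ^ (d - 1 - e) * (u ^ e * u)" by (rule pow_split[OF ed])
      hence U: "u ^ (d - 1 - e) * u ^ e = u ^ d / u" using u0 by (simp add: field_simps)
      have "u ^ (d - 1 - e) * inverse (x / u) ^ e * (1 - (x / u) ^ d)
          = (u ^ (d - 1 - e) * u ^ e) / x ^ e * (1 - x ^ d / u ^ d)" by (simp add: power_divide)
      also have "\<dots> = u ^ d / u / x ^ e * (1 - x ^ d / u ^ d)" by (simp only: U)
      also have "\<dots> = - (fmap s d e x / u)" using x(2) u0 by (simp add: fmap_def s field_simps)
      finally show ?thesis .
    qed
    ultimately have "fmap s d e x \<in> A" using V_closed(5) unfolding A_def by fastforce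
    hence "\<not> preper s d e (Aff (fmap s d e x))" by (rule esc)
    thus False using preper_step[OF x(1)] x(2) by simp
  qed
qed

end

section \<open>Expansions of preperiodic points at a pole of \<open>s\<close>\<close>

context pole_place
begin

text \<open>Newton approximation: the solutions \<open>\<xi>\<close> of \<open>\<xi>\<^sup>d = 1 + \<xi>\<^sup>e \<eta> t\<^sup>k\<close> are known modulo \<open>t\<^sup>n\<^sup>+\<^sup>1\<close>
  once \<open>\<xi>\<close> and \<open>\<eta>\<close> are known modulo \<open>t\<^sup>n\<close>.\<close>

lemma Fq_expansion:
  assumes d: "d > 0" "of_nat d \<noteq> (0 :: 'a)" and roots: "\<And>c :: 'a. c ^ d = 1 \<Longrightarrow> c ^ q = c" and k: "k > 0"
    and V0: "\<And>x. x \<in> A \<Longrightarrow> x \<in> V"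
    and eq: "\<And>x. x \<in> A \<Longrightarrow> x \<noteq> 0 \<Longrightarrow> \<exists>y\<in>A. x ^ d = 1 + x ^ e * y * t ^ k"
    and x: "x \<in> A"
  shows "\<exists>P\<in>Pol Fq. cg n x (poly P t)"
  using x
proof (induction n arbitrary: x)
  case 0
  thus ?case using V0 by (intro bexI[of _ 0]) (auto simp: cg_0_iff Pol_0[OF Fq_sfd])
next
  case (Suc n)
  show ?case
  proof (cases "x = 0")
    case True
    thus ?thesis by (intro bexI[of _ 0]) (auto simp: Pol_0[OF Fq_sfd])
  next
    case False
    obtain y where y: "y \<in> A" "x ^ d = 1 + x ^ e * y * t ^ k" using eq[OF Suc.prems False] by blast
    have xV: "x \<in> V" and yV: "y \<in> V" using V0 Suc.prems y by auto
    have small: "cg 1 (x ^ d) 1"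
    proof -
      have "x ^ e * y * t ^ k * u = x ^ e * y * t ^ (k - 1) * (t * u)" using k by (cases k) (simp_all add: mult_ac)
      also have "\<dots> \<in> V" using xV yV t_V by (simp add: V_closed)
      finally show ?thesis by (simp add: cg_def y(2))
    qed
    obtain c where c: "c \<in> \<kappa>" "x - c \<in> maxid V" using residue[OF xV] by blast
    have cd: "c ^ d = 1"
    proof -
      have "x ^ d - c ^ d \<in> maxid V" by (rule cong_power[OF c(2) xV KV[OF c(1)]])
      moreover have "x ^ d - 1 \<in> maxid V" using small cg_m[of 0 "x ^ d - 1"] by (simp add: cg_def)
      ultimately have "(x ^ d - 1) - (x ^ d - c ^ d) \<in> maxid V" using m_diff by blast
      hence "c ^ d - 1 \<in> maxid V" by simp
      thus ?thesis using m_K[of "c ^ d - 1"] c(1) by (simp add: sfd_closed[OF K])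
    qed
    have cF: "c \<in> Fq" using roots[OF cd] c(1) by (simp add: Fq_def)
    have c0: "c \<noteq> 0" using cd d by (auto simp: power_0_left)
    \<comment> \<open>The derivative of \<open>z^d\<close> at the leading digit \<open>c\<close>; it
      is an element of \<open>Fq\<close> and nonzero because \<open>d\<close> is invertible.\<close>
    define D where "D = of_nat d * c ^ (d - 1)"
    have D: "D \<in> Fq" "D \<noteq> 0" unfolding D_def using c0 d(2)
      by (auto intro!: sfd_closed[OF Fq_sfd] sfd_of_nat[OF Fq_sfd] cF)
    have DK: "D \<in> \<kappa>" using D(1) by (simp add: Fq_def)
    have factor: "x ^ d - l ^ d = (x - l) * (\<Sum>i<d. l ^ (d - Suc i) * x ^ i)" for l by (rule power_diff_sumr2)
    show ?thesis
    proof (cases "n = 0")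
      case True
      \<comment> \<open>So far \<open>x - c\<close> is only known to lie in the maximal ideal.
        Dividing \<open>x^d - 1\<close>, a multiple of \<open>t\<close>, by the unit
        \<open>U\<close> shows that it is a multiple of \<open>t\<close>.\<close>
      define U where "U = (\<Sum>i<d. c ^ (d - Suc i) * x ^ i)"
      have "U - D \<in> maxid V"
      proof -
        have "D = (\<Sum>i<d. c ^ (d - Suc i) * c ^ i)"
          by (simp add: D_def flip: power_add)
        hence "U - D = (\<Sum>i<d. c ^ (d - Suc i) * (x ^ i - c ^ i))"
          by (simp add: U_def sum_subtractf algebra_simps)
        also have "\<dots> \<in> maxid V"
        proof -
          have "(\<Sum>i\<in>I. c ^ (d - Suc i) * (x ^ i - c ^ i)) \<in> maxid V" for I
            by (induction I rule: infinite_finite_induct)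
              (auto simp: m_zero intro!: m_add m_mult' cong_power c xV KV V_closed)
          thus ?thesis .
        qed
        finally show ?thesis .
      qed
      hence "U \<notin> maxid V" using m_diff[of U "U - D"] m_K[OF DK] D(2) by auto
      hence Ui: "inverse U \<in> V" "U \<noteq> 0" by (auto simp: notm)
      have "x - c = (x ^ d - 1) * inverse U" using factor[of c] Ui by (simp add: cd U_def)
      hence "(x - c) * u = (x ^ d - 1) * u * inverse U" by simp
      also have "\<dots> \<in> V" by (rule V_closed(4)[OF _ Ui(1)]) (use small in \<open>simp add: cg_def\<close>)
      finally have "cg (Suc n) x (poly [:c:] t)" using True by (simp add: cg_def)
      thus ?thesis by (intro bexI[of _ "[:c:]"]) (auto intro!: Pol_closed Fq_sfd cF)
    next
      case False
      hence n: "1 \<le> n" by simp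
      \<comment> \<open>The hypothesis is used for \<open>x\<close> and for the \<open>y\<close> of
        its equation, which is why all of \<open>A\<close> is expanded simultaneously.\<close>
      obtain L where L: "L \<in> Pol Fq" "cg n x (poly L t)" using Suc.IH[OF Suc.prems] by blast
      obtain M where M: "M \<in> Pol Fq" "cg n y (poly M t)" using Suc.IH[OF y(1)] by blast
      have FK: "Pol Fq \<subseteq> Pol \<kappa>" by (rule Pol_mono) (auto simp: Fq_def)
      note LK = subsetD[OF FK L(1)] and MK = subsetD[OF FK M(1)]
      define l where "l = poly L t"
      have lV: "l \<in> V" and mV: "poly M t \<in> V" by (simp_all add: l_def cg_poly LK MK)
      \<comment> \<open>\<open>W\<close> predicts \<open>x^d - l^d\<close> one digit further than
        \<open>x\<close> is known: the factor \<open>t^k\<close> with \<open>k > 0\<close> pushes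
        the errors of \<open>L\<close> and \<open>M\<close> up by at least one power.\<close>
      define W where "W = 1 + L ^ e * M * Polynomial.monom 1 k - L ^ d"
      have WF: "W \<in> Pol Fq" unfolding W_def by (intro Pol_closed Fq_sfd L M sfd_closed)
      note WK = subsetD[OF FK WF]
      have "cg n (x ^ e * y) (l ^ e * poly M t)"
        unfolding l_def using L(2) M(2) xV lV mV by (intro cg_mult cg_power V_closed) (auto simp: l_def V_closed)
      hence "cg (n + k) (t ^ k * (x ^ e * y)) (t ^ k * (l ^ e * poly M t))" by (simp add: cg_shift)
      hence "cg (Suc n) (t ^ k * (x ^ e * y)) (t ^ k * (l ^ e * poly M t))" by (rule cg_mono) (use k in simp)
      hence "cg (Suc n) (1 + t ^ k * (x ^ e * y) - l ^ d) (1 + t ^ k * (l ^ e * poly M t) - l ^ d)"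
        by (intro cg_diff cg_add cg_refl)
      hence xW: "cg (Suc n) (x ^ d - l ^ d) (poly W t)"
        by (simp add: y(2) W_def l_def poly_monom mult_ac)
      have xl: "cg n (x - l) 0" using L(2) by (simp add: cg_def l_def)
      have "cg n (x ^ d - l ^ d) (l ^ d - l ^ d)"
        using L(2) by (intro cg_diff cg_power xV lV) (simp_all add: l_def)
      hence "cg n (poly W t) 0" using cg_mono[OF xW, of n] cg_sym cg_trans by (metis diff_self le_SucI order.refl)
      hence Wlow: "\<forall>i<n. coeff W i = 0" using cg_poly_iff[OF WK] by simp
      \<comment> \<open>As \<open>x^d - l^d\<close> is \<open>D (x - l)\<close> modulo
        \<open>t^(n+1)\<close>, the next digit of \<open>x\<close> is \<open>w / D\<close>.\<close>
      define w where "w = coeff W n"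
      have wF: "w \<in> Fq" using WF by (simp add: w_def Pol_def)
      have wK: "w \<in> \<kappa>" using wF by (simp add: Fq_def)
      have "W - Polynomial.monom w n \<in> Pol \<kappa>" by (intro Pol_closed K WK wK)
      moreover have "\<forall>i<Suc n. coeff (W - Polynomial.monom w n) i = 0" using Wlow by (auto simp: less_Suc_eq w_def)
      ultimately have "cg (Suc n) (poly (W - Polynomial.monom w n) t) 0" using cg_poly_iff by blast
      hence "cg (Suc n) (poly W t) (w * t ^ n)" by (simp add: cg_def poly_monom)
      with xW have main: "cg (Suc n) (x ^ d - l ^ d) (w * t ^ n)" by (rule cg_trans)
      define U where "U = (\<Sum>i<d. l ^ (d - Suc i) * x ^ i)"
      have xlU: "x ^ d - l ^ d = (x - l) * U" unfolding U_def by (rule factor)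
      have c1: "cg 1 l c"
      proof -
        define c' where "c' = coeff L 0"
        have c'K: "c' \<in> \<kappa>" using LK by (simp add: c'_def Pol_def)
        have "L - [:c':] \<in> Pol \<kappa>" by (intro Pol_closed K LK c'K)
        from cg_poly_iff[OF this, of 1] have lc': "cg 1 l c'" by (simp add: cg_def l_def c'_def)
        have "cg 1 x c'" using cg_trans[OF cg_mono[OF L(2) n, folded l_def] lc'] .
        hence "x - c' \<in> maxid V" using cg_m[of 0 "x - c'"] by (simp add: cg_def)
        from m_diff[OF c(2) this] have "c' - c \<in> maxid V" by simp
        hence "c' = c" using m_K[of "c' - c"] c(1) c'K by (simp add: sfd_closed[OF K])
        thus ?thesis using lc' by simp
      qed
      have x1: "cg 1 x c" using cg_trans[OF cg_mono[OF L(2) n, folded l_def] c1] .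
      have UD: "cg 1 U D"
      proof -
        have "cg 1 (\<Sum>i\<in>I. l ^ (d - Suc i) * x ^ i) (\<Sum>i\<in>I. c ^ (d - Suc i) * c ^ i)" for I
          by (induction I rule: infinite_finite_induct)
            (auto intro!: cg_add cg_mult cg_power c1[simplified] x1[simplified] lV xV KV c(1) V_closed)
        moreover have "D = (\<Sum>i<d. c ^ (d - Suc i) * c ^ i)" by (simp add: D_def flip: power_add)
        ultimately show ?thesis by (simp add: U_def)
      qed
      have "cg (Suc n) ((x - l) * D) ((x - l) * U)"
      proof -
        have "((x - l) * D - (x - l) * U) * u ^ Suc n = (((x - l) - 0) * u ^ n) * (- ((U - D) * u ^ 1))"
          by (simp add: algebra_simps)
        also have "\<dots> \<in> V" using xl UD unfolding cg_def by (rule V_closed(4)[OF _ V_closed(5)])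
        finally show ?thesis by (simp add: cg_def)
      qed
      with main have "cg (Suc n) ((x - l) * D) (w * t ^ n)" unfolding xlU by (rule cg_trans[rotated])
      hence "cg (Suc n) (inverse D * ((x - l) * D)) (inverse D * (w * t ^ n))"
        by (rule cg_mult[OF cg_refl]) (use KV[OF wK] KV[OF sfd_inverse[OF K DK]] t_V in \<open>auto intro!: V_closed\<close>)
      moreover have "inverse D * ((x - l) * D) = x - l" using D(2) by simp
      ultimately have "cg (Suc n) (x - l) (inverse D * w * t ^ n)" by (metis mult.assoc)
      hence "cg (Suc n) (x - l + l) (inverse D * w * t ^ n + l)" by (intro cg_add cg_refl)
      hence "cg (Suc n) x (poly (L + Polynomial.monom (inverse D * w) n) t)"
        by (simp add: l_def poly_monom add.commute)
      moreover have "L + Polynomial.monom (inverse D * w) n \<in> Pol Fq"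
        by (intro Pol_closed Fq_sfd L sfd_closed D wF)
      ultimately show ?thesis by blast
    qed
  qed
qed

text \<open>With \<open>z = x/u\<close> the map becomes \<open>z^d = 1 + z^e y t^(d-1-e)\<close>,
  where \<open>y\<close> is the image divided by \<open>u\<close>. The digits of \<open>z\<close>
  lie in \<open>Fq\<close> and are fixed by the Frobenius, whence \<open>Rhat x x\<close>.\<close>

lemma preper_expansion:
  assumes ed: "e + 2 \<le> d" and d: "of_nat d \<noteq> (0 :: 'a)" and roots: "\<And>c :: 'a. c ^ d = 1 \<Longrightarrow> c ^ q = c"
    and s: "s = u ^ d" and x: "preper s d e (Aff x)" "x \<noteq> 0"
  shows "Rhat x x" "\<exists>c\<in>\<kappa>. c ^ d = 1 \<and> cg 1 (x * t) c"
proof -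
  \<comment> \<open>0 is included because a preperiodic point may be mapped to 0, and
    \<open>A\<close> must contain the images of its nonzero elements.\<close>
  define A where "A = insert 0 {x * t | x. preper s d e (Aff x) \<and> x \<noteq> 0}"
  have AV: "z \<in> V" if "z \<in> A" for z
    using that preper_pole(1)[OF ed u s] V_closed(1) by (auto simp: A_def divide_inverse)
  have eq: "\<exists>y\<in>A. z ^ d = 1 + z ^ e * y * t ^ (d - 1 - e)" if zA: "z \<in> A" "z \<noteq> 0" for z
  proof -
    obtain x where x: "z = x * t" "preper s d e (Aff x)" "x \<noteq> 0" using zA by (auto simp: A_def)
    have "preper s d e (Aff (fmap s d e x))" using preper_step[OF x(2)] x(3) by simp
    hence "fmap s d e x * t \<in> A" by (auto simp: A_def)
    moreover have "z ^ d = 1 + z ^ e * (fmap s d e x * t) * t ^ (d - 1 - e)"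
    proof -
      have td: "t ^ e * t * t ^ (d - 1 - e) = t ^ d" using pow_split[OF ed, of t] by (simp add: mult_ac)
      have "x ^ d = s + x ^ e * fmap s d e x" using x(3) by (simp add: fmap_def)
      hence "z ^ d = (s + x ^ e * fmap s d e x) * t ^ d" by (simp add: x(1) power_mult_distrib)
      also have "\<dots> = 1 + x ^ e * fmap s d e x * t ^ d" by (simp add: s distrib_right)
      also have "\<dots> = 1 + z ^ e * (fmap s d e x * t) * t ^ (d - 1 - e)"
        unfolding td[symmetric] x(1) power_mult_distrib by (simp only: mult_ac)
      finally show ?thesis .
    qed
    ultimately show ?thesis by blast
  qed
  have xA: "x * t \<in> A" using x by (auto simp: A_def)
  have ex: "\<exists>P\<in>Pol Fq. cg n (x * t) (poly P t)" for n
    by (rule Fq_expansion[OF _ d roots _ AV eq xA]) (use ed in auto)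
  have FK: "Pol Fq \<subseteq> Pol \<kappa>" by (rule Pol_mono) (auto simp: Fq_def)
  have "R0 (x * t) (x * t)" unfolding R0_def
  proof
    fix n
    obtain P where "P \<in> Pol Fq" "cg n (x * t) (poly P t)" using ex by blast
    thus "\<exists>P\<in>Pol \<kappa>. cg n (x * t) (poly P t) \<and> cg n (x * t) (poly (fr P) t)"
      using FK fr_Fq by (intro bexI[of _ P]) auto
  qed
  thus "Rhat x x" unfolding Rhat_def by (intro exI[of _ 1]) simp
  from R0_residue[OF \<open>R0 (x * t) (x * t)\<close>] obtain c where c: "c \<in> \<kappa>" "cg 1 (x * t) c" by metis
  have "cg 1 ((x * t) ^ d) (c ^ d)" by (rule cg_power[OF c(2) AV[OF xA] KV[OF c(1)]])
  moreover have "cg 1 ((x * t) ^ d) 1"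
  proof -
    obtain y where y: "y \<in> A" "(x * t) ^ d = 1 + (x * t) ^ e * y * t ^ (d - 1 - e)"
      using eq[OF xA] x(2) u0 by auto
    have "(x * t) ^ e * y * t ^ (d - 1 - e) * u = (x * t) ^ e * y * t ^ (d - 2 - e) * (t * u)"
    proof -
      have "d - 1 - e = Suc (d - 2 - e)" using ed by simp
      thus ?thesis by (simp only: power_Suc2 mult.assoc)
    qed
    also have "\<dots> \<in> V" using AV[OF xA] AV[OF y(1)] t_V by (simp add: V_closed)
    finally show ?thesis by (simp add: cg_def y(2))
  qed
  ultimately have "cg 1 (c ^ d) 1" using cg_sym cg_trans by blast
  hence "c ^ d - 1 \<in> maxid V" using cg_m[of 0 "c ^ d - 1"] by (simp add: cg_def)
  hence "c ^ d = 1" using m_K[of "c ^ d - 1"] c(1) by (simp add: sfd_closed[OF K])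
  thus "\<exists>c\<in>\<kappa>. c ^ d = 1 \<and> cg 1 (x * t) c" using c by blast
qed

text \<open>After the residue is subtracted, \<open>b\<close> vanishes at the place and has the same
  order of vanishing as its partner \<open>b^q\<close>. As \<open>q > 1\<close>, that order is
  infinite and \<open>b = 0\<close>.\<close>

lemma Rhat_power_const:
  assumes r: "Rhat a (a ^ q)" and a: "a \<in> V"
  shows "a \<in> \<kappa>"
proof -
  obtain c where c: "c \<in> \<kappa>" "a - c \<in> maxid V" using residue[OF a] by blast
  define b where "b = a - c"
  have rb: "Rhat b (b ^ q)" unfolding b_def frob_diff by (rule Rhat_diff[OF r Rhat_const[OF c(1)]])
  have bV: "b \<in> V" using c(2) m_V by (simp add: b_def)
  obtain k where k: "R0 (b * t ^ k) (b ^ q * t ^ k)" using rb by (auto simp: Rhat_def)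
  have "cg k (b * t ^ k) 0" using bV by (simp add: cg_def mult.assoc)
  from R0_shift[OF k this] have R: "R0 b (b ^ q)" by (simp add: mult.assoc)
  have all: "cg (Suc n) b 0" for n
  proof (induction n)
    case 0
    obtain c' where c': "c' \<in> \<kappa>" "cg 1 b c'" by (rule R0_residue[OF R]) blast
    hence "b - c' \<in> maxid V" using cg_m[of 0 "b - c'"] by (simp add: cg_def)
    from m_diff[OF c(2)[folded b_def] this] have "c' = 0" using m_K[OF c'(1)] by simp
    thus ?case using c'(2) by simp
  next
    case (Suc n)
    \<comment> \<open>One factor \<open>b\<close> contributes \<open>n + 1\<close> powers of
      \<open>t\<close>, the other at least one, so \<open>b^q\<close> gains a digit over
      \<open>b\<close>.\<close>
    have "(b * u ^ Suc n) * (b * u) \<in> V"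
      by (rule V_closed(4)) (use Suc cg_mono[OF Suc, of 1] in \<open>simp_all add: cg_def\<close>)
    hence "b ^ (q - 2) * ((b * u ^ Suc n) * (b * u)) \<in> V" by (intro V_closed(4)[OF V_closed(7)[OF bV]])
    moreover have "b ^ q = b ^ (q - 2) * (b * b)"     proof -
      have "q = q - 2 + 2" using q by simp
      thus ?thesis by (metis power_add power2_eq_square)
    qed
    ultimately have "cg (Suc (Suc n)) (b ^ q) 0" by (simp add: cg_def mult_ac)
    thus ?case using R0_cg_iff[OF R] by simp
  qed
  have "b = 0"
  proof (rule ccontr)
    assume "b \<noteq> 0"
    then obtain n where "\<not> cg n b 0" using not_divisible by blast
    thus False using cg_mono[OF all[of n], of n] by simp
  qed
  thus ?thesis using c by (simp add: b_def)
qed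

end

subsection \<open>The number of poles seen by the preperiodic points\<close>

context const_field
begin

text \<open>Functions with the values of the identity matrix at \<open>r\<close> zeros of \<open>w - 1\<close> are linearly
  independent over \<open>\<kappa>(w)\<close>.\<close>

lemma zeros_le_degree:
  assumes S: "finite S" and w: "w \<in> gen \<kappa> S" "w \<notin> \<kappa>"
    and v: "\<And>i. i < r \<Longrightarrow> v i \<in> gen \<kappa> S" and pl: "\<And>i. i < r \<Longrightarrow> is_place (V i)"
    and w1: "\<And>i. i < r \<Longrightarrow> w - 1 \<in> maxid (V i)"
    and vi: "\<And>i. i < r \<Longrightarrow> v i - 1 \<in> maxid (V i)"
    and vj: "\<And>i j. i < r \<Longrightarrow> j < r \<Longrightarrow> i \<noteq> j \<Longrightarrow> v j \<in> maxid (V i)"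
  shows "r \<le> dg (gen \<kappa> S) w"
proof (rule ccontr)
  assume neg: "\<not> ?thesis"
  have van: "\<forall>i<r. p i = 0" if "\<And>i. i < r \<Longrightarrow> p i \<in> Pol \<kappa>" "(\<Sum>i<r. poly (p i) w * v i) = 0" for p
    using that
  proof (induction "\<Sum>i<r. degree (p i)" arbitrary: p rule: less_induct)
    case less
    \<comment> \<open>Modulo \<open>V i\<close> the relation reduces to its \<open>i\<close>-th
      term, since \<open>w\<close> and \<open>v i\<close> become 1 and the other \<open>v j\<close>
      vanish. Hence all \<open>p i\<close> are divisible by \<open>X - 1\<close>, which starts a
      descent on the sum of degrees.\<close>
    have root: "poly (p i) 1 = 0" if i: "i < r" for i
    proof -
      interpret place \<kappa> "V i" by unfold_locales (rule pl[OF i])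
      have wV: "w \<in> V i" using V_closed(3)[OF m_V[OF w1[OF i]] V_closed(2)] by simp
      have vV: "v j \<in> V i" if "j < r" for j
        using m_V[OF vj[OF i that]] V_closed(3)[OF m_V[OF vi[OF i]] V_closed(2)] by (cases "i = j") auto
      have pw: "poly p w - poly p 1 \<in> maxid (V i)" if "p \<in> Pol \<kappa>" for p
      proof -
        have "(\<Sum>j\<in>J. coeff p j * (w ^ j - 1 ^ j)) \<in> maxid (V i)" for J
          by (induction J rule: infinite_finite_induct)
            (auto simp: m_zero intro!: m_add m_mult' KV Pol_coeff[OF that]
              cong_power[OF w1[OF i] wV V_closed(2), simplified])
        thus ?thesis by (simp add: poly_altdef sum_subtractf algebra_simps)
      qed
      have pK: "poly (p j) 1 \<in> \<kappa>" if "j < r" for j using less.prems(1)[OF that] by (rule Pol_poly[OF K _ sfd_1[OF K]])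
      have "(\<Sum>j\<in>{..<r} - {i}. poly (p j) w * v j) \<in> maxid (V i)"
      proof -
        have "(\<Sum>j\<in>J. poly (p j) w * v j) \<in> maxid (V i)" if "J \<subseteq> {..<r} - {i}" for J
          using that
        proof (induction J rule: infinite_finite_induct)
          case (insert j J)
          have "poly (p j) w \<in> V i"
            using less.prems(1)[of j] insert.prems KV wV by (intro Polr_poly[OF R]) (auto simp: Pol_def)
          hence "poly (p j) w * v j \<in> maxid (V i)" using insert.prems vj[OF i, of j] by (intro m_mult') auto
          thus ?case using insert by (auto intro!: m_add)
        qed (auto simp: m_zero)
        thus ?thesis by simp
      qed
      moreover have "(\<Sum>j<r. poly (p j) w * v j) = poly (p i) w * v i + (\<Sum>j\<in>{..<r} - {i}. poly (p j) w * v j)"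
        using i by (subst sum.remove[of _ i]) auto
      ultimately have "poly (p i) w * v i \<in> maxid (V i)"
        using less.prems(2) m_uminus by (simp add: eq_neg_iff_add_eq_0[symmetric])
      moreover have "poly (p i) w * (v i - 1) \<in> maxid (V i)"
        using less.prems(1)[OF i] KV wV by (intro m_mult' vi[OF i] Polr_poly[OF R]) (auto simp: Pol_def)
      ultimately have "poly (p i) w * v i - poly (p i) w * (v i - 1) \<in> maxid (V i)" by (rule m_diff)
      hence "poly (p i) w \<in> maxid (V i)" by (simp add: algebra_simps)
      from m_diff[OF this pw[OF less.prems(1)[OF i]]] have "poly (p i) 1 \<in> maxid (V i)" by simp
      thus ?thesis using m_K[OF pK[OF i]] by simp
    qed
    show ?case
    proof (cases "\<exists>i<r. p i \<noteq> 0")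
      case True
      have "\<exists>p'. p i = [:- 1, 1:] * p'" if "i < r" for i         using root[OF that] unfolding poly_eq_0_iff_dvd dvd_def .
      then obtain p' where p': "\<And>i. i < r \<Longrightarrow> p i = [:- 1, 1:] * p' i" by metis
      have p'K: "p' i \<in> Pol \<kappa>" if "i < r" for i
        by (rule Pol_factor[of 1]) (use less.prems(1)[OF that] p'[OF that] sfd_1[OF K] in auto)
      have "(\<Sum>i<r. poly (p i) w * v i) = (w - 1) * (\<Sum>i<r. poly (p' i) w * v i)"
        unfolding sum_distrib_left by (intro sum.cong refl) (simp add: p' algebra_simps)
      moreover have "w \<noteq> 1" using w(2) sfd_1[OF K] by auto
      ultimately have z: "(\<Sum>i<r. poly (p' i) w * v i) = 0" using less.prems(2) by simp
      have dl: "degree (p i) = Suc (degree (p' i))" if "i < r" "p i \<noteq> 0" for i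
      proof -
        have "p' i \<noteq> 0" using that p' by auto
        thus ?thesis unfolding p'[OF that(1)] by (subst degree_mult_eq) auto
      qed
      have d0: "p' i = 0" if "i < r" "p i = 0" for i
      proof -
        have "[:- 1, 1:] * p' i = 0" using that p'[OF that(1)] by metis
        thus ?thesis by (simp only: mult_eq_0_iff) auto
      qed
      have "(\<Sum>i<r. degree (p' i)) < (\<Sum>i<r. degree (p i))"
      proof (rule sum_strict_mono_ex1)
        show "\<forall>i\<in>{..<r}. degree (p' i) \<le> degree (p i)" using dl d0 by (metis degree_0 le0 lessThan_iff le_SucI order.refl)
        show "\<exists>i\<in>{..<r}. degree (p' i) < degree (p i)" using True dl by (metis lessI lessThan_iff)
      qed simp
      from less.hyps[OF this p'K z] show ?thesis using p' by simp
    qed auto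
  qed
  obtain p where p: "\<And>i. p i \<in> Pol \<kappa>" "\<exists>i<r. p i \<noteq> 0" "(\<Sum>i<r. poly (p i) w * v i) = 0"
    by (rule dependent_polys[OF S w(2,1) _ v, of r]) (use neg w in \<open>auto simp: dg_def\<close>)
  thus False using van[of p] by blast
qed

definition resid :: "'a set \<Rightarrow> 'a \<Rightarrow> 'a" where
  "resid V x = (SOME c. c \<in> \<kappa> \<and> x - c \<in> maxid V)"

lemma resid: "is_place V \<Longrightarrow> x \<in> V \<Longrightarrow> resid V x \<in> \<kappa> \<and> x - resid V x \<in> maxid V"
  unfolding resid_def by (rule someI_ex) (auto simp: is_place_def)

lemma resid_eqI:
  assumes "is_place V" "c \<in> \<kappa>" "x - c \<in> maxid V" shows "resid V x = c"
proof -
  interpret place \<kappa> V by unfold_locales fact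
  have "x \<in> V" using V_closed(3)[OF m_V[OF assms(3)] KV[OF assms(2)]] by simp
  hence *: "resid V x \<in> \<kappa>" "x - resid V x \<in> maxid V" using resid[OF assms(1)] by auto
  from m_diff[OF assms(3) *(2)] have "resid V x - c \<in> maxid V" by simp
  thus ?thesis using m_K[of "resid V x - c"] *(1) assms(2) by (simp add: sfd_closed[OF K])
qed

end

section \<open>The automorphism \<open>\<sigma>\<close> as a relation\<close>

context frob_field
begin

text \<open>The graph of the automorphism of \<open>\<kappa>(s, X)\<close> which is the Frobenius on \<open>\<kappa>\<close> and fixes \<open>s\<close> and
  all preperiodic points, as seen from all poles of \<open>u\<close>.\<close>

definition twist :: "'a \<Rightarrow> 'a \<Rightarrow> 'a \<Rightarrow> bool" where
  "twist u a b \<longleftrightarrow> (\<forall>V. is_place V \<longrightarrow> u \<notin> V \<longrightarrow> pole_place.Rhat \<kappa> V q u a b)"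

lemma pole_placeI: "is_place V \<Longrightarrow> u \<notin> V \<Longrightarrow> pole_place \<kappa> V q u"
  by unfold_locales

lemma twist_const: "c \<in> \<kappa> \<Longrightarrow> twist u c (c ^ q)"
  unfolding twist_def using pole_place.Rhat_const[OF pole_placeI] by blast

lemma twist_self: "twist u u u"
  unfolding twist_def using pole_place.Rhat_u[OF pole_placeI] by blast

lemma twist_diff: "twist u a b \<Longrightarrow> twist u a' b' \<Longrightarrow> twist u (a - a') (b - b')"
  unfolding twist_def using pole_place.Rhat_diff[OF pole_placeI] by blast

lemma twist_add: "twist u a b \<Longrightarrow> twist u a' b' \<Longrightarrow> twist u (a + a') (b + b')"
  unfolding twist_def using pole_place.Rhat_add[OF pole_placeI] by blast

lemma twist_mult: "twist u a b \<Longrightarrow> twist u a' b' \<Longrightarrow> twist u (a * a') (b * b')"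
  unfolding twist_def using pole_place.Rhat_mult[OF pole_placeI] by blast

lemma twist_inverse: "twist u a b \<Longrightarrow> twist u (inverse a) (inverse b)"
  unfolding twist_def using pole_place.Rhat_inverse[OF pole_placeI] by blast

text \<open>A nonconstant \<open>u\<close> has at least one pole, and one pole decides. With
  additivity this makes the relation single-valued and injective.\<close>

lemma twist_zero: "u \<notin> \<kappa> \<Longrightarrow> twist u a b \<Longrightarrow> a = 0 \<longleftrightarrow> b = 0"
  unfolding twist_def by (metis exists_place pole_place.Rhat_zero_iff[OF pole_placeI])

lemma twist_poly: "twist u a b \<Longrightarrow> P \<in> Pol \<kappa> \<Longrightarrow> twist u (poly P a) (poly (fr P) b)"
proof (induction P)
  case 0
  thus ?case using twist_const[OF sfd_0[OF K]] by (simp add: fr_simps frob_zero)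
next
  case (pCons c P)
  have "c \<in> \<kappa>" "P \<in> Pol \<kappa>"
    using Pol_coeff[OF pCons.prems(2), of 0] Pol_coeff[OF pCons.prems(2), of "Suc i" for i] by (auto simp: Pol_def)
  with pCons show ?case by (auto simp: fr_simps intro!: twist_add twist_mult twist_const)
qed

text \<open>The elements that have a partner in \<open>gen \<kappa> S\<close> form a field
  containing the generators. The second claim is surjectivity of \<open>\<sigma>\<close> and rests
  on \<open>\<kappa>\<close> being perfect.\<close>

lemma twist_gen:
  assumes "\<And>x. x \<in> S \<Longrightarrow> twist u x x" and a: "a \<in> gen \<kappa> S"
  shows "\<exists>b\<in>gen \<kappa> S. twist u a b" "\<exists>b\<in>gen \<kappa> S. twist u b a"
proof -
  define A where "A = {a. \<exists>b\<in>gen \<kappa> S. twist u a b}"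
  define B where "B = {a. \<exists>b\<in>gen \<kappa> S. twist u b a}"
  have one: "twist u 1 1" using twist_const[OF sfd_1[OF K]] by simp
  note cl = twist_diff twist_mult twist_inverse sfd_diff[OF gen_sfd] sfd_mult[OF gen_sfd] sfd_inverse[OF gen_sfd]
  have "sfd A" unfolding A_def
    by (rule sfdI) (use one sfd_1[OF gen_sfd, of \<kappa> S] in \<open>auto, (meson cl)+\<close>)
  moreover have "\<kappa> \<subseteq> A" unfolding A_def using twist_const in_gen1(2) sfd_power[OF K] by blast
  moreover have "S \<subseteq> A" unfolding A_def using assms(1) in_gen1(3) by blast
  ultimately have "gen \<kappa> S \<subseteq> A" by (rule gen_min)
  thus "\<exists>b\<in>gen \<kappa> S. twist u a b" using a by (auto simp: A_def)
  have "sfd B" unfolding B_def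
    by (rule sfdI) (use one sfd_1[OF gen_sfd, of \<kappa> S] in \<open>auto, (meson cl)+\<close>)
  moreover have "\<kappa> \<subseteq> B"
  proof
    fix c assume "c \<in> \<kappa>"
    then obtain b where "b \<in> \<kappa>" "b ^ q = c" by (rule frob_surj)
    thus "c \<in> B" unfolding B_def using twist_const[of b u] in_gen1(2) by blast
  qed
  moreover have "S \<subseteq> B" unfolding B_def using assms(1) in_gen1(3) by blast
  ultimately have "gen \<kappa> S \<subseteq> B" by (rule gen_min)
  thus "\<exists>b\<in>gen \<kappa> S. twist u b a" using a by (auto simp: B_def)
qed

lemma twist_not_const:
  assumes u: "u \<notin> \<kappa>" and tw: "twist u a b" and a: "a \<notin> \<kappa>"
  shows "b \<notin> \<kappa>"
proof
  assume "b \<in> \<kappa>"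
  then obtain c where cK: "c \<in> \<kappa>" and "c ^ q = b" by (rule frob_surj)
  hence "twist u (a - c) 0" using twist_diff[OF tw twist_const[OF cK]] by simp
  from twist_zero[OF u this] have "a = c" by simp
  thus False using a cK by simp
qed

text \<open>\<open>\<sigma>\<close> carries \<open>\<kappa>(a)\<close> to \<open>\<kappa>(b)\<close>
  and \<open>gen \<kappa> S\<close> onto itself, so linear relations over the first become linear
  relations over the second.\<close>

lemma twist_degree:
  assumes u: "u \<notin> \<kappa>" and S: "finite S" "\<And>x. x \<in> S \<Longrightarrow> twist u x x"
    and tw: "twist u a b" and a: "a \<in> gen \<kappa> S" "a \<notin> \<kappa>"
  shows "dg (gen \<kappa> S) b \<le> dg (gen \<kappa> S) a"
proof -
  have bK: "b \<notin> \<kappa>" by (rule twist_not_const[OF u tw a(2)])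
  obtain b' where b': "b' \<in> gen \<kappa> S" "twist u a b'" using twist_gen(1)[OF S(2) a(1)] by blast
  have "twist u 0 (b - b')" using twist_diff[OF tw b'(2)] by simp
  from twist_zero[OF u this] have "b = b'" by simp
  hence bE: "b \<in> gen \<kappa> S" using b' by simp
  define m where "m = field_deg (gen \<kappa> {a}) (gen \<kappa> S)"
  have "fin_over (gen \<kappa> {b}) (gen \<kappa> S) \<and> field_deg (gen \<kappa> {b}) (gen \<kappa> S) \<le> m"
  proof (rule field_deg_leI[OF gen_sfd subspc_sfd[OF gen_sfd gen_incl]])
    show "{b} \<subseteq> gen \<kappa> S" using bE by simp
    fix z assume z: "\<And>i. i \<le> m \<Longrightarrow> z i \<in> gen \<kappa> S"
    have "\<forall>i. \<exists>y. i \<le> m \<longrightarrow> y \<in> gen \<kappa> S \<and> twist u y (z i)" using twist_gen(2)[OF S(2) z] by blast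
    then obtain y where y: "\<And>i. i \<le> m \<Longrightarrow> y i \<in> gen \<kappa> S \<and> twist u (y i) (z i)" by metis
    obtain p where p: "\<And>i. p i \<in> Pol \<kappa>" "\<exists>i<Suc m. p i \<noteq> 0" "(\<Sum>i<Suc m. poly (p i) a * y i) = 0"
      by (rule dependent_polys[OF S(1) a(2,1), of "Suc m" y]) (use y in \<open>auto simp: m_def\<close>)
    have "twist u (\<Sum>i\<in>I. poly (p i) a * y i) (\<Sum>i\<in>I. poly (fr (p i)) b * z i)" if "I \<subseteq> {..m}" for I
      using that
    proof (induction I rule: infinite_finite_induct)
      case (insert i I)
      thus ?case using y[of i] by (auto intro!: twist_add twist_mult twist_poly tw p(1))
    qed (use twist_const[OF sfd_0[OF K], of u] in \<open>auto simp: frob_zero\<close>)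
    from this[of "{..m}"] have "(\<Sum>i\<le>m. poly (fr (p i)) b * z i) = 0" using twist_zero[OF u] p(3) by (auto simp: lessThan_Suc_atMost)
    moreover have "poly (fr (p i)) b \<in> gen \<kappa> {b}" for i
      using fr_Pol[OF p(1)] Pol_mono[OF gen_base] by (intro Pol_poly[OF gen_sfd]) (auto intro: in_gen1)
    moreover obtain i where i: "i \<le> m" "p i \<noteq> 0" using p(2) by (auto simp: less_Suc_eq_le)
    moreover have "poly (fr (p i)) b \<noteq> 0"
    proof -
      have "fr (p i) \<noteq> 0" using i(2) q by (auto simp: poly_eq_iff coeff_fr)
      thus ?thesis using nonzero_at[OF fr_Pol[OF p(1)] bK] by simp
    qed
    ultimately show "\<exists>a. (\<forall>i\<le>m. a i \<in> gen \<kappa> {b}) \<and> (\<exists>i\<le>m. a i \<noteq> 0) \<and> (\<Sum>i\<le>m. a i * z i) = 0"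
      by (intro exI[of _ "\<lambda>i. poly (fr (p i)) b"]) auto
  qed
  thus ?thesis using a bK by (simp add: dg_def m_def)
qed

end

lemma roots_of_unity_card:
  assumes "n > 0" shows "finite {c :: 'a::field. c ^ n = 1}" "card {c :: 'a. c ^ n = 1} \<le> n"
proof -
  define P :: "'a poly" where "P = Polynomial.monom 1 n - [:1:]"
  have "coeff P n = 1" using assms by (cases n) (auto simp: P_def)
  hence P0: "P \<noteq> 0" by auto
  have deg: "degree P \<le> n" unfolding P_def by (intro degree_diff_le) (auto simp: degree_monom_le)
  have eq: "{x. poly P x = 0} = {c. c ^ n = 1}" by (auto simp: P_def poly_monom)
  show "finite {c :: 'a. c ^ n = 1}" "card {c :: 'a. c ^ n = 1} \<le> n"
    using poly_roots_finite[OF P0] card_poly_roots_bound[OF P0] deg unfolding eq by auto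
qed

section \<open>Counting the vectors of leading coefficients\<close>

context pole_place
begin

text \<open>The ratio lies in the field generated by the points, whereas \<open>x t\<close> involves
  the root \<open>u\<close> of \<open>s\<close>. The proof needs \<open>y t\<close> to be a
  unit.\<close>

lemma preper_ratio:
  assumes ed: "e + 2 \<le> d" and d: "of_nat d \<noteq> (0 :: 'a)" and roots: "\<And>c :: 'a. c ^ d = 1 \<Longrightarrow> c ^ q = c"
    and s: "s = u ^ d" and x: "preper s d e (Aff x)" "x \<noteq> 0" and y: "preper s d e (Aff y)" "y \<noteq> 0"
    and c: "a \<in> \<kappa>" "cg 1 (x * t) a" "b \<in> \<kappa>" "b ^ d = 1" "cg 1 (y * t) b"
  shows "x / y - a / b \<in> maxid V"
proof -
  have b0: "b \<noteq> 0" using c(4) ed by (auto simp: power_0_left)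
  have m: "z \<in> maxid V" if "cg 1 z 0" for z using cg_m[of 0 z] that by simp
  have xm: "x * t - a \<in> maxid V" "y * t - b \<in> maxid V" using c by (auto intro!: m simp: cg_def)
  have y1: "y * t \<notin> maxid V" using preper_pole(2)[OF ed u s y] by (simp add: divide_inverse)
  have "x / y - a / b = ((x * t - a) * b - a * (y * t - b)) * inverse (y * t) * inverse b"
    using y(2) b0 u0 by (simp add: field_simps)
  also have "\<dots> \<in> maxid V"
    by (rule m_mult[OF m_mult[OF m_diff[OF m_mult[OF xm(1)] m_mult'[OF _ xm(2)]]]])
      (use y1 KV c(1,3) KV[OF sfd_inverse[OF K c(3)]] in \<open>auto simp: notm\<close>)
  finally show ?thesis .
qed

end

context frob_field
begin

lemma preper_twist:
  assumes "e + 2 \<le> d" "of_nat d \<noteq> (0 :: 'a)" "\<And>c :: 'a. c ^ d = 1 \<Longrightarrow> c ^ q = c" "s = u ^ d"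
    "preper s d e (Aff x)" "x \<noteq> 0"
  shows "twist u x x"
  unfolding twist_def using pole_place.preper_expansion(1)[OF pole_placeI assms] by blast

text \<open>The functions \<open>v i\<close> certify that the places are distinct on
  \<open>gen \<kappa> S\<close>, so that \<open>w - 1\<close> really has \<open>r\<close> different
  zeros. The bound \<open>(q + 1) G\<close> adds \<open>G\<close> for \<open>\<sigma>(g)\<close> and
  \<open>q G\<close> for \<open>g^q\<close>.\<close>

lemma many_zeros_degree:
  assumes u: "u \<notin> \<kappa>" and S: "finite S" "\<And>x. x \<in> S \<Longrightarrow> twist u x x"
    and g: "g0 \<in> gen \<kappa> S" "g0 \<notin> \<kappa>" "dg (gen \<kappa> S) g0 \<le> G"
    and V: "\<And>i. i < r \<Longrightarrow> is_place (V i) \<and> u \<notin> V i"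
    and v: "\<And>i. i < r \<Longrightarrow> v i \<in> gen \<kappa> S"
    and vi: "\<And>i. i < r \<Longrightarrow> v i - 1 \<in> maxid (V i)"
    and vj: "\<And>i j. i < r \<Longrightarrow> j < r \<Longrightarrow> i \<noteq> j \<Longrightarrow> v j \<in> maxid (V i)"
  shows "r \<le> (q + 1) * G"
proof (cases "r = 0")
  case False
  define E where "E = gen \<kappa> S"
  have pl: "place \<kappa> (V i)" if "i < r" for i using V[OF that] by unfold_locales auto
  \<comment> \<open>\<open>a\<close> avoids the values of \<open>g0\<close>, so
    \<open>1 / (g0 - a)\<close> is finite at every chosen place. Where \<open>g0\<close> has a pole,
    \<open>resid\<close> is an arbitrary value, and avoiding it does no harm.\<close>
  obtain a where a: "a \<in> \<kappa>" "a \<notin> (\<lambda>i. resid (V i) g0) ` {..<r}" using avoid_finite[of "(\<lambda>i. resid (V i) g0) ` {..<r}"] by auto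
  define g1 where "g1 = inverse (g0 - a)"
  have g0a: "g0 - a \<noteq> 0" using g(2) a(1) by auto
  have g1V: "g1 \<in> V i" if i: "i < r" for i
  proof (cases "g0 \<in> V i")
    case True
    interpret place \<kappa> "V i" by (rule pl[OF i])
    have "g0 - a \<notin> maxid (V i)"
    proof
      assume "g0 - a \<in> maxid (V i)"
      hence "resid (V i) g0 = a" using V[OF i] a(1) by (intro resid_eqI) auto
      thus False using a(2) i by auto
    qed
    thus ?thesis by (simp add: notm g1_def)
  next
    case False
    interpret place \<kappa> "V i" by (rule pl[OF i])
    have "g0 - a \<notin> V i" using False V_closed(3)[of "g0 - a" a] KV[OF a(1)] by auto
    thus ?thesis unfolding g1_def using inverse_m m_V by blast
  qed
  \<comment> \<open>\<open>b\<close> avoids the values of \<open>g1\<close>, which makes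
    \<open>g\<close> a unit at every chosen place.\<close>
  obtain b where b: "b \<in> \<kappa>" "b \<notin> (\<lambda>i. resid (V i) g1) ` {..<r}" using avoid_finite[of "(\<lambda>i. resid (V i) g1) ` {..<r}"] by auto
  define g where "g = g1 - b"
  have gu: "g \<in> V i" "g \<notin> maxid (V i)" if i: "i < r" for i
  proof -
    interpret place \<kappa> "V i" by (rule pl[OF i])
    show "g \<in> V i" unfolding g_def by (intro V_closed g1V i KV b)
    show "g \<notin> maxid (V i)"
    proof
      assume "g \<in> maxid (V i)"
      hence "resid (V i) g1 = b" using V[OF i] b(1) by (intro resid_eqI) (auto simp: g_def)
      thus False using b(2) i by auto
    qed
  qed
  have gE: "g \<in> E" unfolding g_def g1_def E_def by (intro sfd_closed gen_sfd g(1) in_gen1 a b)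
  have gK: "g \<notin> \<kappa>"
  proof
    assume "g \<in> \<kappa>"
    hence "inverse (g + b) + a \<in> \<kappa>" using a b by (intro sfd_closed K)
    thus False using \<open>g0 \<notin> \<kappa>\<close> by (simp add: g_def g1_def)
  qed
  have g0': "g \<noteq> 0" using gK sfd_0[OF K] by auto
  have dgg: "dg E g \<le> G"
    using g(3) dg_diff_const[OF b(1), of E g1] dg_inverse[of E "g0 - a"] dg_diff_const[OF a(1), of E g0]
    by (simp add: g_def g1_def E_def)
  obtain y where y: "y \<in> E" "twist u g y" using twist_gen(1)[OF S(2) gE[unfolded E_def]] unfolding E_def by blast
  have dgy: "dg E y \<le> G" using twist_degree[OF u S y(2)] gE gK dgg unfolding E_def by force
  have y0: "y \<noteq> 0" using twist_zero[OF u y(2)] g0' by simp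
  define w where "w = y * inverse g ^ q"
  have wE: "w \<in> E" using y(1) gE unfolding w_def E_def by (intro sfd_closed gen_sfd)
  have dgw: "dg E w \<le> (q + 1) * G"
  proof -
    have i: "inverse g \<in> E" "inverse g \<noteq> 0" using gE g0' by (auto simp: E_def intro: sfd_inverse[OF gen_sfd])
    have 1: "dg E w \<le> dg E y + dg E (inverse g ^ q)"
      unfolding w_def E_def using y i y0 by (intro dg_mult S) (auto simp: E_def sfd_power[OF gen_sfd])
    have "dg E (inverse g ^ q) \<le> q * dg E (inverse g)" unfolding E_def using i by (intro dg_power S) (auto simp: E_def)
    also have "\<dots> = q * dg E g" by (simp only: dg_inverse)
    also have "\<dots> \<le> q * G" using dgg by simp
    finally show ?thesis using 1 dgy by simp
  qed
  have res: "\<exists>c\<in>\<kappa>. g - c \<in> maxid (V i) \<and> y - c ^ q \<in> maxid (V i)" if i: "i < r" for i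
  proof -
    interpret pole_place \<kappa> "V i" q u by (rule pole_placeI) (use V[OF i] in auto)
    have "Rhat g y" using y(2) V[OF i] by (simp add: twist_def)
    from Rhat_residue[OF this gu(1)[OF i]] show ?thesis by metis
  qed
  have yg: "y - g ^ q \<in> maxid (V i)" if i: "i < r" for i
  proof -
    interpret place \<kappa> "V i" by (rule pl[OF i])
    obtain c where c: "c \<in> \<kappa>" "g - c \<in> maxid (V i)" "y - c ^ q \<in> maxid (V i)" using res[OF i] by blast
    from m_diff[OF c(3) cong_power[OF c(2) gu(1)[OF i] KV[OF c(1)], of q]] show ?thesis by simp
  qed
  have w1: "w - 1 \<in> maxid (V i)" if i: "i < r" for i
  proof -
    interpret place \<kappa> "V i" by (rule pl[OF i])
    have "w - 1 = (y - g ^ q) * inverse g ^ q" using g0' by (simp add: w_def field_simps)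
    also have "\<dots> \<in> maxid (V i)" using gu(2)[OF i] by (intro m_mult yg i V_closed) (simp add: notm)
    finally show ?thesis .
  qed
  have wK: "w \<notin> \<kappa>"
  proof
    assume wK: "w \<in> \<kappa>"
    have i: "0 < r" using False by simp
    interpret pole_place \<kappa> "V 0" q u by (rule pole_placeI) (use V[OF i] in auto)
    have "w = 1" using m_K[of "w - 1"] w1[OF i] wK by (simp add: sfd_closed[OF K])
    hence "y = g ^ q" using g0' by (simp add: w_def field_simps)
    hence "Rhat g (g ^ q)" using y(2) V[OF i] by (simp add: twist_def)
    thus False using Rhat_power_const[OF _ gu(1)[OF i]] gK by blast
  qed
  have "r \<le> dg (gen \<kappa> S) w"
    by (rule zeros_le_degree[OF S(1) _ wK v _ w1 vi vj]) (use wE V in \<open>auto simp: E_def\<close>)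
  thus ?thesis using dgw by (simp add: E_def)
qed simp

theorem preper_bound:
  assumes s: "s \<notin> \<kappa>" and ed: "e + 2 \<le> d" and d: "of_nat d \<noteq> (0 :: 'a)"
    and roots: "\<And>c :: 'a. c ^ d = 1 \<Longrightarrow> c ^ q = c"
    and A: "finite A" "\<And>x. x \<in> A \<Longrightarrow> x \<noteq> 0 \<and> preper s d e (Aff x)"
    and h: "h \<notin> \<kappa>" and G: "field_deg (gen \<kappa> {h}) (gen \<kappa> (insert h (insert s A))) \<le> G"
  shows "card A \<le> q * d ^ ((q + 1) * G)"
proof (cases "A = {}")
  case False
  then obtain x0 where x0: "x0 \<in> A" by auto
  obtain u where su: "u ^ d = s" using nth_root_exists[of d s] ed by auto
  have u: "u \<notin> \<kappa>" using s su sfd_power[OF K] by auto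
  have pole: "pole_place \<kappa> V q u" if "is_place V" "s \<notin> V" for V
  proof -
    interpret place \<kappa> V by unfold_locales fact
    show ?thesis by (rule pole_placeI[OF that(1)]) (use that(2) su V_closed(7)[of u d] in auto)
  qed
  define S where "S = insert s A"
  have S: "finite S" using A by (simp add: S_def)
  have tw_s: "twist u s s"
  proof -
    have "twist u (u ^ n) (u ^ n)" for n
      by (induction n) (use twist_const[OF sfd_1[OF K], of u] in \<open>auto intro: twist_mult twist_self\<close>)
    thus ?thesis using su by blast
  qed
  have tw: "twist u x x" if "x \<in> S" for x
    using that tw_s preper_twist[OF ed d roots su[symmetric]] A(2) by (auto simp: S_def)
  obtain g0 where g0: "g0 \<in> gen \<kappa> S" "g0 \<notin> \<kappa>" "dg (gen \<kappa> S) g0 \<le> G"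
    by (rule norm_degree[OF S _ s h G[folded S_def]]) (simp add: S_def)
  define Pl where "Pl = {V. is_place V \<and> s \<notin> V}"
  define vec where "vec = (\<lambda>V. restrict (\<lambda>x. resid V (x / x0)) A)"
  \<comment> \<open>Vectors rather than places are counted: different places of the ambient field
    may give the same vector, and only different vectors can be separated by functions in the
    points.\<close>
  define \<R> where "\<R> = vec ` Pl"
  define \<mu> where "\<mu> = {c :: 'a. c ^ d = 1}"
  have \<mu>: "finite \<mu>" "card \<mu> \<le> d" unfolding \<mu>_def using roots_of_unity_card[of d] ed by auto
  have ratio: "\<exists>c c0. c \<in> \<kappa> \<and> c0 \<in> \<kappa> \<and> c ^ d = 1 \<and> c0 ^ d = 1 \<and> pole_place.cg V u 1 (x * inverse u) c \<and>
      pole_place.cg V u 1 (x0 * inverse u) c0 \<and> x / x0 - c / c0 \<in> maxid V \<and> resid V (x / x0) = c / c0"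
    if V: "V \<in> Pl" and x: "x \<in> A" for V x
  proof -
    interpret pole_place \<kappa> V q u using pole V by (simp add: Pl_def)
    note px = A(2)[OF x] A(2)[OF x0]
    obtain c where c: "c \<in> \<kappa>" "c ^ d = 1" "cg 1 (x * t) c"
      using preper_expansion(2)[OF ed d roots su[symmetric], of x] px by blast
    obtain c0 where c0: "c0 \<in> \<kappa>" "c0 ^ d = 1" "cg 1 (x0 * t) c0"
      using preper_expansion(2)[OF ed d roots su[symmetric], of x0] px by blast
    have m: "x / x0 - c / c0 \<in> maxid V"
      by (rule preper_ratio[OF ed d roots su[symmetric] _ _ _ _ c(1,3) c0]) (use px in auto)
    have "resid V (x / x0) = c / c0"
      by (rule resid_eqI[OF _ sfd_divide[OF K c(1) c0(1)] m]) (use V in \<open>simp add: Pl_def\<close>)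
    thus ?thesis using c c0 m by blast
  qed
  have vec\<mu>: "vec V x \<in> \<mu>" if "V \<in> Pl" "x \<in> A" for V x
    using ratio[OF that] that(2) by (auto simp: vec_def \<mu>_def power_divide)
  have "\<R> \<subseteq> A \<rightarrow>\<^sub>E \<mu>" using vec\<mu> by (auto simp: \<R>_def vec_def PiE_iff)
  hence finR: "finite \<R>" using finite_PiE[OF A(1), of "\<lambda>_. \<mu>"] \<mu>(1) by (auto intro: finite_subset)
  define r where "r = card \<R>"
  have rG: "r \<le> (q + 1) * G"
  proof -
    obtain f where f: "bij_betw f {..<r} \<R>" using ex_bij_betw_nat_finite[OF finR] by (auto simp: r_def atLeast0LessThan)
    have fR: "f i \<in> \<R>" if "i < r" for i using f that by (auto simp: bij_betw_def)
    have finj: "f i \<noteq> f j" if "i < r" "j < r" "i \<noteq> j" for i j using f that by (auto simp: bij_betw_def inj_on_def)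
    have "\<forall>i. \<exists>V. i < r \<longrightarrow> V \<in> Pl \<and> vec V = f i" using fR by (fastforce simp: \<R>_def)
    then obtain V where V: "\<And>i. i < r \<Longrightarrow> V i \<in> Pl \<and> vec (V i) = f i" by metis
    have "\<exists>x. x \<in> A \<and> f i x \<noteq> f j x" if "i < r" "j < r" "i \<noteq> j" for i j
    proof (rule ccontr)
      assume *: "\<not> ?thesis"
      have "vec (V i) = vec (V j)"
      proof
        fix x show "vec (V i) x = vec (V j) x"
        proof (cases "x \<in> A")
          case True
          thus ?thesis using * V[OF that(1)] V[OF that(2)] by auto
        qed (simp add: vec_def)
      qed
      thus False using finj[OF that] V that by simp
    qed
    then obtain z where z: "\<And>i j. i < r \<Longrightarrow> j < r \<Longrightarrow> i \<noteq> j \<Longrightarrow> z i j \<in> A \<and> f i (z i j) \<noteq> f j (z i j)" by metis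
    have fK: "f i x \<in> \<kappa>" if "i < r" "x \<in> A" for i x
    proof -
      have "resid (V i) (x / x0) \<in> \<kappa>" using ratio[of "V i" x] V[OF that(1)] that(2) sfd_divide[OF K] by metis
      moreover have "f i x = vec (V i) x" using V[OF that(1)] by simp
      ultimately show ?thesis using that(2) by (simp add: vec_def)
    qed
    have fm: "x / x0 - f i x \<in> maxid (V i)" if "i < r" "x \<in> A" for i x
    proof -
      have "x / x0 - resid (V i) (x / x0) \<in> maxid (V i)" using ratio[of "V i" x] V[OF that(1)] that(2) by metis
      moreover have "f i x = vec (V i) x" using V[OF that(1)] by simp
      ultimately show ?thesis using that(2) by (simp add: vec_def)
    qed
    \<comment> \<open>Interpolation: at \<open>z i j\<close> the vectors \<open>i\<close> and
      \<open>j\<close> differ. The factor for \<open>j\<close> is 1 at \<open>V i\<close> and 0 at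
      \<open>V j\<close>.\<close>
    define v where "v = (\<lambda>i. \<Prod>j\<in>{..<r} - {i}. (z i j / x0 - f j (z i j)) * inverse (f i (z i j) - f j (z i j)))"
    show ?thesis
    proof (rule many_zeros_degree[OF u S tw g0, where V = V and v = v])
      fix i assume i: "i < r"
      show "is_place (V i) \<and> u \<notin> V i"
        using V[OF i] pole[of "V i"] by (auto simp: Pl_def pole_place_def pole_place_axioms_def)
      have "(z i j / x0 - f j (z i j)) * inverse (f i (z i j) - f j (z i j)) \<in> gen \<kappa> S"
        if j: "j \<in> {..<r} - {i}" for j
      proof -
        have zj: "z i j \<in> A" using z[OF i, of j] j by auto
        hence "z i j / x0 \<in> gen \<kappa> S" using x0 by (intro sfd_divide gen_sfd in_gen1) (auto simp: S_def)
        moreover have "f j (z i j) \<in> \<kappa>" "f i (z i j) \<in> \<kappa>" using fK zj i j by auto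
        ultimately show ?thesis
          by (intro sfd_mult[OF gen_sfd] sfd_inverse[OF gen_sfd] sfd_diff[OF gen_sfd]) (auto intro: in_gen1)
      qed
      thus "v i \<in> gen \<kappa> S" unfolding v_def by (rule sfd_prod[OF gen_sfd])
      interpret place \<kappa> "V i" by unfold_locales (use V[OF i] in \<open>simp add: Pl_def\<close>)
      show "v i - 1 \<in> maxid (V i)"
      proof -
        have "(\<Prod>j\<in>J. (z i j / x0 - f j (z i j)) * inverse (f i (z i j) - f j (z i j))) - 1 \<in> maxid (V i)"
          if "J \<subseteq> {..<r} - {i}" for J
          using that
        proof (induction J rule: infinite_finite_induct)
          case (insert j J)
          define c where "c = f i (z i j) - f j (z i j)"
          define y where "y = (z i j / x0 - f j (z i j)) * inverse c"
          define P where "P = (\<Prod>j\<in>J. (z i j / x0 - f j (z i j)) * inverse (f i (z i j) - f j (z i j)))"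
          have j: "j < r" "j \<noteq> i" using insert.prems by auto
          note zj = z[OF i j(1) j(2)[symmetric]]
          have c: "c \<noteq> 0" "c \<in> \<kappa>" using zj fK[OF i] fK[OF j(1)] by (auto simp: c_def intro: sfd_diff[OF K])
          have "y - 1 = (z i j / x0 - f i (z i j)) * inverse c" using c(1) by (simp add: y_def c_def field_simps)
          also have "\<dots> \<in> maxid (V i)" using zj fm[OF i] KV[OF sfd_inverse[OF K c(2)]] by (intro m_mult) auto
          finally have y1: "y - 1 \<in> maxid (V i)" .
          have "P - 1 \<in> maxid (V i)" unfolding P_def using insert by auto
          moreover from this have "P \<in> V i" using V_closed(3)[OF m_V V_closed(2)] by fastforce
          ultimately have "(y - 1) * P + (P - 1) \<in> maxid (V i)" using y1 by (intro m_add m_mult)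
          moreover have "(y - 1) * P + (P - 1) = y * P - 1" by (simp add: algebra_simps)
          ultimately have "y * P - 1 \<in> maxid (V i)" by (simp only:)
          moreover have "(\<Prod>j\<in>insert j J. (z i j / x0 - f j (z i j)) * inverse (f i (z i j) - f j (z i j))) = y * P"
            unfolding y_def P_def c_def by (rule prod.insert[OF insert.hyps(1,2)])
          ultimately show ?case by (simp only:)
        qed (auto simp: m_zero)
        thus ?thesis by (simp add: v_def)
      qed
      fix j assume j: "j < r" "i \<noteq> j"
      have xV: "x / x0 \<in> V i" if "x \<in> A" for x
        using V_closed(3)[OF m_V[OF fm[OF i that]] KV[OF fK[OF i that]]] by simp
      have "v j = (z j i / x0 - f i (z j i)) * inverse (f j (z j i) - f i (z j i)) *
          (\<Prod>l\<in>{..<r} - {j} - {i}. (z j l / x0 - f l (z j l)) * inverse (f j (z j l) - f l (z j l)))"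
        unfolding v_def using i j by (subst prod.remove[of _ i]) auto
      also have "\<dots> \<in> maxid (V i)"
      proof (intro m_mult)
        show "z j i / x0 - f i (z j i) \<in> maxid (V i)" using z[OF j(1) i] j(2) by (intro fm i) auto
        show "inverse (f j (z j i) - f i (z j i)) \<in> V i"
          using z[OF j(1) i] j(2) by (intro KV sfd_inverse sfd_diff K fK j i) auto
        have rest: "(\<Prod>l\<in>J. (z j l / x0 - f l (z j l)) * inverse (f j (z j l) - f l (z j l))) \<in> V i"
          if "J \<subseteq> {..<r} - {j}" for J using that
        proof (induction J rule: infinite_finite_induct)
          case (insert l J)
          hence l: "l < r" "l \<noteq> j" by auto
          note zl = z[OF j(1) l(1) l(2)[symmetric]]
          have "(z j l / x0 - f l (z j l)) * inverse (f j (z j l) - f l (z j l)) \<in> V i"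
            using zl by (intro V_closed(4,6) xV KV sfd_inverse sfd_diff K fK j l) auto
          thus ?case using insert by (auto intro: V_closed)
        qed (auto simp: V_closed)
        show "(\<Prod>l\<in>{..<r} - {j} - {i}. (z j l / x0 - f l (z j l)) * inverse (f j (z j l) - f l (z j l))) \<in> V i"
          by (rule rest) auto
      qed
      finally show "v j \<in> maxid (V i)" .
    qed
  qed
  define \<Phi> where "\<Phi> = (\<lambda>x. restrict (\<lambda>\<rho>. \<rho> x) \<R>)"
  have fibre: "x - y \<in> Fq" if xy: "x \<in> A" "y \<in> A" "\<Phi> x = \<Phi> y" for x y
  proof -
    \<comment> \<open>Where \<open>s\<close> is finite, both points are finite. At a pole of
      \<open>s\<close> they have the same leading coefficient, so the terms in \<open>u\<close>
      cancel.\<close>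
    have all: "x - y \<in> V" if V: "is_place V" for V
    proof (cases "s \<in> V")
      case True
      interpret place \<kappa> V by unfold_locales fact
      show ?thesis using preper_integral[OF ed True] A(2) xy by (intro V_closed) auto
    next
      case False
      hence VP: "V \<in> Pl" using V by (simp add: Pl_def)
      interpret pole_place \<kappa> V q u using pole V False by simp
      have "vec V \<in> \<R>" using VP by (auto simp: \<R>_def)
      hence "vec V x = vec V y" using xy(3) by (metis \<Phi>_def restrict_apply)
      hence eq: "resid V (x / x0) = resid V (y / x0)" using xy by (simp add: vec_def)
      obtain c c0 where c: "c \<in> \<kappa>" "c0 ^ d = 1" "c0 \<in> \<kappa>" "cg 1 (x * t) c" "cg 1 (x0 * t) c0" "resid V (x / x0) = c / c0"
        using ratio[OF VP xy(1)] by blast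
      obtain b b0 where b: "b \<in> \<kappa>" "b0 ^ d = 1" "b0 \<in> \<kappa>" "cg 1 (y * t) b" "cg 1 (x0 * t) b0" "resid V (y / x0) = b / b0"
        using ratio[OF VP xy(2)] by blast
      \<comment> \<open>Both are the leading digit of \<open>x0\<close>, so equality of the ratios
        gives equality of the digits of \<open>x\<close> and \<open>y\<close>.\<close>
      have "cg 1 c0 b0" using c b cg_sym cg_trans by blast
      hence "c0 - b0 \<in> maxid V" using cg_m[of 0 "c0 - b0"] by (simp add: cg_def)
      hence "c0 - b0 = 0" using c b by (intro m_K) (auto intro: sfd_diff[OF K])
      moreover have "c0 \<noteq> 0" using c(2) ed by (auto simp: power_0_left)
      ultimately have "c = b" using eq c b by simp
      hence "cg 1 (x * t) (y * t)" using c b cg_sym cg_trans by blast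
      moreover have "(x * t - y * t) * u ^ 1 = (x - y) * (t * u)"
        by (simp only: power_one_right left_diff_distrib mult.assoc)
      ultimately show ?thesis unfolding cg_def by (simp only: tu mult_1_right)
    qed
    \<comment> \<open>A nonconstant element has a pole somewhere.\<close>
    have xyK: "x - y \<in> \<kappa>" using exists_place[of "x - y"] all by blast
    have "twist u x x" "twist u y y" using tw xy by (auto simp: S_def)
    hence "twist u (x - y) (x - y)" by (rule twist_diff)
    from twist_diff[OF this twist_const[OF xyK]] have "twist u 0 ((x - y) - (x - y) ^ q)" by simp
    from twist_zero[OF u this] have "(x - y) ^ q = x - y" by simp
    thus ?thesis using xyK by (simp add: Fq_def)
  qed
  have "card A \<le> card (\<Phi> ` A) * q"
  proof -
    have "A = (\<Union>\<phi>\<in>\<Phi> ` A. {x \<in> A. \<Phi> x = \<phi>})" by auto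
    hence "card A \<le> (\<Sum>\<phi>\<in>\<Phi> ` A. card {x \<in> A. \<Phi> x = \<phi>})"
      using card_UN_le[of "\<Phi> ` A" "\<lambda>\<phi>. {x \<in> A. \<Phi> x = \<phi>}"] A(1) by simp
    also have "\<dots> \<le> (\<Sum>\<phi>\<in>\<Phi> ` A. q)"
    proof (rule sum_mono)
      fix \<phi> assume "\<phi> \<in> \<Phi> ` A"
      then obtain y where y: "y \<in> A" "\<phi> = \<Phi> y" by auto
      have "{x \<in> A. \<Phi> x = \<phi>} \<subseteq> (\<lambda>c. c + y) ` Fq"
      proof
        fix x assume "x \<in> {x \<in> A. \<Phi> x = \<phi>}"
        hence "x - y \<in> Fq" using fibre[of x y] y by auto
        thus "x \<in> (\<lambda>c. c + y) ` Fq" by (intro image_eqI[of _ _ "x - y"]) auto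
      qed
      hence "card {x \<in> A. \<Phi> x = \<phi>} \<le> card Fq" using Fq_card(1) by (meson card_image_le card_mono finite_imageI le_trans)
      thus "card {x \<in> A. \<Phi> x = \<phi>} \<le> q" using Fq_card(2) by simp
    qed
    finally show ?thesis by simp
  qed
  also have "\<dots> \<le> d ^ r * q"
  proof (rule mult_le_mono1)
    have sub: "\<Phi> ` A \<subseteq> \<R> \<rightarrow>\<^sub>E \<mu>" using vec\<mu> by (auto simp: \<Phi>_def \<R>_def)
    have "card (\<Phi> ` A) \<le> card (\<R> \<rightarrow>\<^sub>E \<mu>)"
      by (rule card_mono[OF _ sub]) (use finite_PiE[OF finR, of "\<lambda>_. \<mu>"] \<mu>(1) in auto)
    also have "\<dots> = card \<mu> ^ r" using finR by (simp add: card_PiE r_def)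
    also have "\<dots> \<le> d ^ r" using \<mu>(2) by (rule power_mono) simp
    finally show "card (\<Phi> ` A) \<le> d ^ r" .
  qed
  also have "\<dots> \<le> d ^ ((q + 1) * G) * q" using rG ed by (intro mult_le_mono1 power_increasing) auto
  finally show ?thesis by (simp add: mult.commute)
qed simp

end

subsection \<open>Algebraic elements\<close>

lemma TA_algebraic_iff:
  assumes F: "sfd F" shows "ring.algebraic ring_of_type_algebra F x \<longleftrightarrow> alg_over F x"
proof
  interpret D: domain "ring_of_type_algebra :: 'a ring" by (rule field.axioms(1)[OF field_from_type_algebra])
  assume alg: "TA.algebraic F x"
  let ?E = "TA.simple_extension F x"
  have fin: "fin_over F ?E"
    unfolding fin_over_def using D.finite_dimension_simple_extension[OF F, of x] alg by (simp add: over_def)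
  have sr: "subring ?E ring_of_type_algebra"
    by (rule D.simple_extension_is_subring[OF subfieldE(1)[OF F]]) simp
  have xE: "x \<in> ?E" by (rule TA.simple_extension_mem[OF subfieldE(1)[OF F]]) simp
  have "x ^ i \<in> ?E" for i
    by (induction i) (use subringE(3)[OF sr] subringE(6)[OF sr xE] in auto)
  thus "alg_over F x" by (rule fin_over_alg[OF F fin])
next
  assume "alg_over F x"
  then obtain P where P: "P \<in> Pol F" "P \<noteq> 0" "poly P x = 0" by (auto simp: alg_over_def)
  have "TA.finite_dimension F (gen F {x})" using simple_deg(1)[OF F P] by (simp add: fin_over_def)
  from TA.finite_dimension_imp_algebraic[OF F subfieldE(1)[OF gen_sfd] this, of x] gen_gens[of "{x}" F]
  show "TA.algebraic F x" by (simp add: over_def)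
qed

lemma alg_over_trans:
  assumes F: "sfd F" and C: "\<And>c. c \<in> C \<Longrightarrow> alg_over F c" and P: "P \<in> Pol C" "P \<noteq> 0" "poly P x = 0"
  shows "alg_over F x"
proof -
  define M where "M = gen F (coeff P ` {..degree P})"
  have finM: "fin_over F M" unfolding M_def by (rule fin_over_gen[OF F]) (use C P(1) in \<open>auto simp: Pol_def\<close>)
  have "coeff P i \<in> M" for i
  proof (cases "i \<le> degree P")
    case True
    thus ?thesis unfolding M_def using gen_gens[of "coeff P ` {..degree P}" F] by auto
  next
    case False
    thus ?thesis unfolding M_def by (simp add: coeff_eq_0 sfd_0[OF gen_sfd])
  qed
  hence "P \<in> Pol M" by (simp add: Pol_def)
  from simple_deg(1)[OF _ this P(2,3)] have "fin_over M (gen M {x})" by (simp add: M_def gen_sfd)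
  with field_deg_tower(1)[OF F _ finM] have fin: "fin_over F (gen M {x})" by (simp add: M_def gen_sfd)
  show ?thesis
    by (rule fin_over_alg[OF F fin]) (use gen_gens[of "{x}" M] in \<open>auto intro!: sfd_power[OF gen_sfd]\<close>)
qed

text \<open>Steinitz exchange: a bivariate relation for \<open>x\<close> over \<open>F(h)\<close> is
  read as a polynomial in \<open>h\<close>. It does not vanish identically, since one of its
  coefficients is a nonzero polynomial over \<open>F\<close> evaluated at the transcendental
  \<open>x\<close>.\<close>

lemma alg_over_exchange:
  assumes F: "sfd F" and x: "alg_over (gen F {h}) x" "\<not> alg_over F x"
  shows "alg_over (gen F {x}) h"
proof -
  obtain P where P: "P \<in> Pol (gen F {h})" "P \<noteq> 0" "poly P x = 0" using x(1) by (auto simp: alg_over_def)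
  obtain D Q where DQ: "D \<in> Pol F" "poly D h \<noteq> 0" "Q \<in> BiPol F" "smult (poly D h) P = spec Q h"
    by (rule sfd_clear_denominators[OF F P(1)])
  have Q: "spec Q h \<noteq> 0" "poly (spec Q h) x = 0" using P DQ by (auto simp: DQ(4)[symmetric])
  define T where "T = poly Q [:x:]"
  have ev: "poly (poly A [:x:]) h = poly (spec A h) x" for A by (induction A) auto
  have cT: "coeff (poly A [:x:]) i = poly (map_poly (\<lambda>p. coeff p i) A) x" for A i
    by (induction A) (simp_all add: map_poly_pCons)
  have row: "map_poly (\<lambda>p. coeff p i) Q \<in> Pol F" for i
    using DQ(3) by (simp add: Pol_def BiPol_def coeff_map_poly)
  have xg: "x \<in> gen F {x}" using gen_gens[of "{x}" F] by simp
  have "T \<in> Pol (gen F {x})"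
    using subsetD[OF Pol_mono[OF gen_base] row] by (auto simp: Pol_def[of "gen F {x}"] T_def cT intro!: Pol_poly[OF gen_sfd] xg)
  moreover have "poly T h = 0" using ev[of Q] Q(2) by (simp add: T_def)
  moreover have "T \<noteq> 0"
  proof
    assume "T = 0"
    hence "poly (map_poly (\<lambda>p. coeff p i) Q) x = 0" for i using cT[of Q i] by (simp add: T_def)
    hence "map_poly (\<lambda>p. coeff p i) Q = 0" for i using x(2) row by (auto simp: alg_over_def)
    hence "coeff (coeff Q j) i = 0" for i j by (metis coeff_0 coeff_map_poly)
    hence "Q = 0" by (intro poly_eqI) simp
    thus False using Q(1) by simp
  qed
  ultimately show ?thesis by (auto simp: alg_over_def)
qed

section \<open>From a function field to the setting over its algebraic closure of constants\<close>

lemma poly_map_to_ac: "poly (map_poly to_ac P) (to_ac x) = to_ac (poly P x)"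
  by (induction P) (simp_all add: map_poly_pCons)

lemma to_ac_image_sfd:
  assumes k: "sfd k" shows "sfd (to_ac ` k)"
proof (rule sfdI)
  show "1 \<in> to_ac ` k" using sfd_1[OF k] by (metis image_eqI to_ac_1)
next
  fix x y assume "x \<in> to_ac ` k" "y \<in> to_ac ` k"
  then obtain a b where ab: "a \<in> k" "b \<in> k" "x = to_ac a" "y = to_ac b" by blast
  show "x - y \<in> to_ac ` k" using sfd_diff[OF k ab(1,2)] ab(3,4) by (metis image_eqI to_ac_diff)
  show "x * y \<in> to_ac ` k" using sfd_mult[OF k ab(1,2)] ab(3,4) by (metis image_eqI to_ac_mult)
next
  fix x assume "x \<in> to_ac ` k"
  then obtain a where a: "a \<in> k" "x = to_ac a" by blast
  show "inverse x \<in> to_ac ` k" using sfd_inverse[OF k a(1)] a(2) by (metis image_eqI to_ac_inverse)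
qed

lemma alg_over_to_ac:
  assumes "alg_over (to_ac ` k) (to_ac x)" and k: "sfd k" shows "alg_over k x"
proof -
  obtain P where P: "P \<in> Pol (to_ac ` k)" "P \<noteq> 0" "poly P (to_ac x) = 0" using assms by (auto simp: alg_over_def)
  define P0 where "P0 = map_poly of_ac P"
  have c: "coeff P0 i \<in> k \<and> to_ac (coeff P0 i) = coeff P i" for i
  proof -
    obtain y where y: "y \<in> k" "coeff P i = to_ac y" using Pol_coeff[OF P(1), of i] by blast
    thus ?thesis by (simp add: P0_def coeff_map_poly)
  qed
  have eq: "map_poly to_ac P0 = P" by (rule poly_eqI) (simp add: coeff_map_poly c)
  have "to_ac (poly P0 x) = 0" using P(3) poly_map_to_ac[of P0 x] by (simp add: eq)
  moreover have "P0 \<noteq> 0" using eq P(2) by auto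
  ultimately show ?thesis using c by (auto simp: alg_over_def Pol_def)
qed

text \<open>\<open>m\<close> is \<open>[K : k(t)]\<close>, so \<open>L\<close> has degree at most
  \<open>m D\<close> over \<open>k(t)\<close>, and passing to the compositum with
  \<open>\<kappa>\<close> does not increase this. The bound sees \<open>L\<close> only through
  \<open>D\<close>, which is the source of uniformity.\<close>

lemma function_field_const_field:
  fixes k :: "'K::field set"
  assumes ff: "function_field_over k"
  obtains h m where "const_field (algebraic_closure_in k)" "h \<notin> algebraic_closure_in k"
    "\<And>L D A. extension_of_degree L D \<Longrightarrow> A \<subseteq> L \<Longrightarrow>
      field_deg (gen (algebraic_closure_in k) {h}) (gen (algebraic_closure_in k) (insert h A)) \<le> m * D"
proof -
  obtain t where k: "sfd k" and t: "TA.transcendental k t"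
    and fin: "TA.finite_dimension (generate_field ring_of_type_algebra (insert t k)) UNIV"
    using ff by (auto simp: function_field_over_def)
  define F :: "'K alg_closure set" where "F = to_ac ` k"
  define \<kappa> where "\<kappa> = algebraic_closure_in k"
  define h where "h = to_ac t"
  define B where "B = gen F {h}"
  define K0 :: "'K alg_closure set" where "K0 = range to_ac"
  have F: "sfd F" unfolding F_def by (rule to_ac_image_sfd[OF k])
  have K0: "sfd K0" unfolding K0_def by (rule to_ac_image_sfd) (rule sfdI, auto)
  have \<kappa>: "x \<in> \<kappa> \<longleftrightarrow> alg_over F x" for x
    by (simp add: \<kappa>_def algebraic_closure_in_def TA_algebraic_iff[OF F] flip: F_def)
  have fin': "fin_over (gen k {t}) UNIV" using fin by (simp add: fin_over_def gen_def)
  define m where "m = field_deg (gen k {t}) UNIV"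
  obtain b where b: "UNIV = vspan (gen k {t}) b m" using fin_over_spanning[OF gen_sfd fin'] unfolding m_def by blast
  have B: "sfd B" unfolding B_def by (rule gen_sfd)
  have BK0: "B \<subseteq> K0" unfolding B_def by (rule gen_min[OF K0]) (auto simp: F_def K0_def h_def)
  have toB: "to_ac z \<in> B" if "z \<in> gen k {t}" for z
  proof -
    have "sfd {z. to_ac z \<in> B}" by (rule sfdI) (auto simp: sfd_closed[OF B])
    moreover have "k \<subseteq> {z. to_ac z \<in> B}" using gen_base[of F "{h}"] by (auto simp: B_def F_def)
    moreover have "{t} \<subseteq> {z. to_ac z \<in> B}" using gen_gens[of "{h}" F] by (auto simp: B_def h_def)
    ultimately show ?thesis using gen_min[of "{z. to_ac z \<in> B}" k "{t}"] that by blast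
  qed
  have sub: "K0 \<subseteq> vspan B (\<lambda>i. to_ac (b i)) m"
  proof
    fix y assume "y \<in> K0"
    then obtain z where z: "y = to_ac z" by (auto simp: K0_def)
    have "z \<in> vspan (gen k {t}) b m" using b by blast
    then obtain a where a: "\<forall>i. a i \<in> gen k {t}" "z = (\<Sum>i<m. a i * b i)" by (auto simp: vspan_def)
    thus "y \<in> vspan B (\<lambda>i. to_ac (b i)) m"
      unfolding vspan_def z by (auto simp: to_ac_sum toB intro!: exI[of _ "\<lambda>i. to_ac (a i)"])
  qed
  note dK0 = field_deg_mono[OF B subspc_sfd[OF K0 BK0] sub vspan_deg(1)[OF B]]
  have dK: "field_deg B K0 \<le> m" using dK0(2) vspan_deg(2)[OF B] le_trans by blast
  have algB: "alg_over B y" for y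
  proof -
    obtain p where p: "p \<noteq> 0" "poly (map_poly to_ac p) y = 0" by (rule alg_closure_algebraic[of y])
    have a: "alg_over B c" if "c \<in> K0" for c
      by (rule fin_over_alg[OF B dK0(1)]) (use that in \<open>auto intro: sfd_power[OF K0]\<close>)
    have pK: "map_poly to_ac p \<in> Pol K0" by (simp add: Pol_def K0_def coeff_map_poly)
    have p0: "map_poly to_ac p \<noteq> 0" using p(1) by (auto simp: poly_eq_iff coeff_map_poly)
    show ?thesis by (rule alg_over_trans[OF B a pK p0 p(2)])
  qed
  have sK: "sfd \<kappa>"
  proof -
    have "{x \<in> carrier ring_of_type_algebra. (TA.algebraic over F) x} = \<kappa>"
      by (auto simp: \<kappa>_def algebraic_closure_in_def over_def F_def)
    thus ?thesis using field.subfield_of_algebraics[OF field_from_type_algebra F] by simp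
  qed
  have F\<kappa>: "F \<subseteq> \<kappa>"
  proof
    fix c assume "c \<in> F"
    thus "c \<in> \<kappa>" unfolding \<kappa> alg_over_def by (intro bexI[of _ "[:- c, 1:]"]) (auto intro!: Pol_closed F sfd_closed)
  qed
  have cf: "const_field \<kappa>"
  proof (rule const_field.intro)
    show "sfd \<kappa>" by (rule sK)
    show "x \<in> \<kappa>" if "P \<in> Pol \<kappa>" "P \<noteq> 0" "poly P x = 0" for P x
      unfolding \<kappa> by (rule alg_over_trans[OF F _ that]) (simp add: \<kappa>)
    \<comment> \<open>By exchange \<open>h\<close> is algebraic over \<open>\<kappa>(x)\<close>, and
      everything is algebraic over \<open>B = F(h)\<close>.\<close>
    show "alg_over (gen \<kappa> {x}) y" if x: "x \<notin> \<kappa>" for x y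
    proof -
      let ?N = "gen \<kappa> {x}"
      have "alg_over (gen F {x}) h"
        by (rule alg_over_exchange[OF F]) (use algB[of x] x in \<open>auto simp: B_def \<kappa>\<close>)
      moreover have "gen F {x} \<subseteq> ?N" using F\<kappa> gen_base[of \<kappa> "{x}"] gen_gens[of "{x}" \<kappa>] by (intro gen_mono) auto
      ultimately have hN: "alg_over ?N h" by (rule alg_over_mono)
      have fN: "fin_over ?N (gen ?N {h})" by (rule fin_over_gen[OF gen_sfd]) (use hN in auto)
      have "B \<subseteq> gen ?N {h}" unfolding B_def gen_gen
        using F\<kappa> gen_base[of \<kappa> "{x} \<union> {h}"] gen_gens[of "{x} \<union> {h}" \<kappa>] by (intro gen_mono) auto
      hence "C \<in> Pol (gen ?N {h})" if "C \<in> Pol B" for C using that Pol_mono by blast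
      then obtain C where C: "C \<in> Pol (gen ?N {h})" "C \<noteq> 0" "poly C y = 0" using algB[of y] by (auto simp: alg_over_def)
      show ?thesis
      proof (rule alg_over_trans[OF gen_sfd _ C])
        fix c assume "c \<in> gen ?N {h}"
        thus "alg_over ?N c" by (intro fin_over_alg[OF gen_sfd fN] sfd_power[OF gen_sfd])
      qed
    qed
  qed
  have h\<kappa>: "h \<notin> \<kappa>"
  proof
    assume "h \<in> \<kappa>"
    hence "alg_over k t" unfolding \<kappa> F_def h_def by (rule alg_over_to_ac[OF _ k])
    thus False using t TA_algebraic_iff[OF k, of t] by simp
  qed
  have "field_deg (gen \<kappa> {h}) (gen \<kappa> (insert h A)) \<le> m * D" if L: "extension_of_degree L D" and A: "A \<subseteq> L" for L D A
  proof -
    have sL: "sfd L" "K0 \<subseteq> L" "TA.dimension D K0 L" using L by (auto simp: extension_of_degree_def K0_def)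
    have dL: "fin_over K0 L" "field_deg K0 L = D" using field_degI[OF K0 sL(3)] by auto
    note tower = field_deg_tower[OF B K0 dK0(1) dL(1)]
    have BN: "B \<subseteq> gen \<kappa> {h}" unfolding B_def
      using F\<kappa> gen_base[of \<kappa> "{h}"] gen_gens[of "{h}" \<kappa>] by (intro gen_mono) auto
    have hL: "h \<in> L" using sL(2) by (auto simp: h_def K0_def)
    have "gen (gen \<kappa> {h}) A = gen \<kappa> (insert h A)" by (simp add: gen_gen)
    moreover have "field_deg (gen \<kappa> {h}) (gen (gen \<kappa> {h}) A) \<le> field_deg B L"
      by (rule compositum_deg(2)[OF B sL(1) _ tower(1) gen_sfd BN A]) (use BK0 sL(2) in auto)
    moreover have "field_deg B L \<le> m * D" using tower(2) dL(2) dK by simp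
    ultimately show ?thesis by simp
  qed
  thus ?thesis using that[of h m] cf h\<kappa> by (simp add: \<kappa>_def)
qed


subsection \<open>The rational functions \<open>(z\<^sup>d - s) / z\<^sup>e\<close>\<close>

abbreviation ffam :: "nat \<Rightarrow> nat \<Rightarrow> 'K::field alg_closure \<Rightarrow> 'K alg_closure ratfun" where
  "ffam d e s \<equiv> Fract (Polynomial.monom 1 d - [:s:]) (Polynomial.monom 1 e)"

text \<open>The fraction is in lowest terms because \<open>z\<close> does not divide the numerator
  when \<open>s \<noteq> 0\<close>.\<close>

lemma quot_of_ffam:
  fixes s :: "'K::field alg_closure"
  assumes "s \<noteq> 0" "d > 0"
  shows "quot_of_fract (ffam d e s) = (Polynomial.monom 1 d - [:s:], Polynomial.monom 1 e)"
proof -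
  let ?x = "[:0, 1:] :: 'K alg_closure poly"
  have mono: "Polynomial.monom 1 n = ?x ^ n" for n by (simp add: monom_altdef)
  have "coprime (?x ^ d - [:s:]) ?x"
  proof (rule coprimeI)
    fix c assume c: "c dvd ?x ^ d - [:s:]" "c dvd ?x"
    have "c dvd ?x ^ d" using c(2) assms(2) by (meson dvd_power dvd_trans)
    hence "c dvd ?x ^ d - (?x ^ d - [:s:])" using c(1) by (rule dvd_diff)
    hence "c dvd [:s:]" by simp
    moreover have "is_unit [:s:]" using assms(1) by (simp add: is_unit_const_poly_iff dvd_field_iff)
    ultimately show "is_unit c" by (rule dvd_unit_imp_unit)
  qed
  hence "coprime (?x ^ d - [:s:]) (?x ^ e)" by simp
  moreover have "unit_factor (?x ^ e) = 1" by (simp add: unit_factor_poly_def lead_coeff_power)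
  ultimately have "(Polynomial.monom 1 d - [:s:], Polynomial.monom 1 e) \<in> normalized_fracts"
    by (simp add: normalized_fracts_def mono)
  from quot_of_fract_quot_to_fract'[OF this] show ?thesis by (simp add: quot_to_fract_def)
qed

lemma rat_eval_ffam:
  assumes "s \<noteq> 0" "e + 2 \<le> d"
  shows "rat_degree (ffam d e s) = d" "rat_eval (ffam d e s) = fstep s d e"
proof -
  have q: "rat_num (ffam d e s) = Polynomial.monom 1 d - [:s:]" "rat_den (ffam d e s) = Polynomial.monom 1 e"
    using quot_of_ffam[of s d e] assms by (simp_all add: rat_num_def rat_den_def)
  have "degree (Polynomial.monom 1 d - [:s:]) = d"
  proof (rule antisym)
    show "degree (Polynomial.monom 1 d - [:s:]) \<le> d" by (intro degree_diff_le) (auto simp: degree_monom_le)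
    show "d \<le> degree (Polynomial.monom 1 d - [:s:])" by (rule le_degree) (use assms in \<open>cases d; auto\<close>)
  qed
  thus deg: "rat_degree (ffam d e s) = d" using assms by (simp add: rat_degree_def q degree_monom_eq)
  show "rat_eval (ffam d e s) = fstep s d e"
  proof
    fix P show "rat_eval (ffam d e s) P = fstep s d e P"
      using assms by (cases P) (auto simp: q deg poly_monom fmap_def)
  qed
qed

text \<open>The representation over \<open>L\<close> need not be the standard one. Cross-multiplying
  and comparing coefficients at the lowest nonzero index \<open>j\<close> of \<open>q\<close> puts
  \<open>s\<close> times that coefficient into \<open>L\<close>.\<close>

lemma ffam_coeff_field:
  assumes f: "ffam d e s \<in> ratfuns_over L" and L: "sfd L" and d: "d > 0"
  shows "s \<in> L"
proof -
  obtain p q where pq: "ffam d e s = Fract p q" "q \<noteq> 0" "\<And>i. coeff p i \<in> L" "\<And>i. coeff q i \<in> L"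
    using f by (auto simp: ratfuns_over_def)
  have eq: "(Polynomial.monom 1 d - [:s:]) * q = p * Polynomial.monom 1 e"
    using pq(1,2) by (simp add: eq_fract monom_eq_0_iff)
  define j where "j = (LEAST j. coeff q j \<noteq> 0)"
  have "\<exists>j. coeff q j \<noteq> 0" using pq(2) by (auto simp: poly_eq_iff)
  hence j: "coeff q j \<noteq> 0" unfolding j_def by (rule LeastI_ex)
  have lt: "coeff q i = 0" if "i < j" for i using not_less_Least[of i "\<lambda>j. coeff q j \<noteq> 0"] that unfolding j_def by blast
  have "coeff (Polynomial.monom 1 d * q) j = 0" using lt d by (auto simp: coeff_monom_mult)
  hence "coeff ((Polynomial.monom 1 d - [:s:]) * q) j = - (s * coeff q j)" by (simp add: algebra_simps)
  moreover have "coeff (p * Polynomial.monom 1 e) j \<in> L"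
    using pq(3) sfd_0[OF L] by (simp add: mult.commute[of p] coeff_monom_mult)
  ultimately have "s * coeff q j \<in> L" using eq sfd_uminus[OF L, of "- (s * coeff q j)"] by simp
  hence "s * coeff q j / coeff q j \<in> L" using pq(4) by (intro sfd_divide[OF L])
  thus ?thesis using j by simp
qed

lemma rat_comp_id:
  fixes f :: "'K::field alg_closure ratfun"
  shows "rat_comp f (mobius 1 0 0 1) = f" "rat_comp (mobius 1 0 0 1) f = f"
proof -
  have z: "mobius 1 0 0 1 = to_fract [:0, 1 :: 'K alg_closure:]" by (simp add: mobius_def to_fract_def pCons_one)
  have ev: "poly (map_poly (\<lambda>c. to_fract [:c:]) p) (to_fract [:0, 1:]) = to_fract p" for p :: "'K alg_closure poly"
  proof (induction p)
    case (pCons c p)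
    have "pCons c p = [:c:] + [:0, 1:] * p" by simp
    thus ?case using pCons by (simp add: map_poly_pCons flip: to_fract_add to_fract_mult)
  qed simp
  show "rat_comp f (mobius 1 0 0 1) = f"
    unfolding rat_comp_def z ev rat_num_def rat_den_def by (simp flip: Fract_conv_to_fract)
  have "rat_num (mobius 1 0 0 1) = [:0, 1 :: 'K alg_closure:]" "rat_den (mobius 1 0 0 1) = (1 :: 'K alg_closure poly)"
    unfolding z by (simp_all add: rat_num_def rat_den_def)
  thus "rat_comp (mobius 1 0 0 1) f = f" by (simp add: rat_comp_def map_poly_pCons flip: one_pCons)
qed

text \<open>Conjugation by the identity suffices. Contraposed, it gives
  \<open>s \<notin> \<kappa>\<close> for the members of the family.\<close>

lemma ffam_const_isotrivial:
  assumes "sfd C" "s \<in> C" shows "\<exists>g\<in>ratfuns_over C. pgl2_conjugate (ffam d e s) g"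
proof
  show "ffam d e s \<in> ratfuns_over C"
    unfolding ratfuns_over_def
    by (intro CollectI exI[of _ "Polynomial.monom 1 d - [:s:]"] exI[of _ "Polynomial.monom 1 e"] conjI allI
        Pol_coeff Pol_closed assms sfd_closed) (simp_all add: monom_eq_0_iff)
  show "pgl2_conjugate (ffam d e s) (ffam d e s)"
    unfolding pgl2_conjugate_def
    by (rule exI[of _ 1], rule exI[of _ 0], rule exI[of _ 0], rule exI[of _ 1]) (simp add: rat_comp_id)
qed

theorem theorem1p3:
  fixes k :: "'K::field set" and p d e :: nat
  assumes "function_field_over k"
    and "CHAR('K) = p" and "p > 0"
    and "d \<ge> 2" and "e \<le> d - 2" and "\<not> p dvd d"
  shows "SUBP_family k
           (\<lambda>t :: 'K alg_closure. Fract (Polynomial.monom 1 d - [:t:]) (Polynomial.monom 1 e))"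
proof -
  define \<kappa> where "\<kappa> = algebraic_closure_in k"
  obtain h m where cf: "const_field \<kappa>" and h: "h \<notin> \<kappa>"
    and m: "\<And>L D A. extension_of_degree L D \<Longrightarrow> A \<subseteq> L \<Longrightarrow> field_deg (gen \<kappa> {h}) (gen \<kappa> (insert h A)) \<le> m * D"
    unfolding \<kappa>_def by (rule function_field_const_field[OF assms(1)]) blast
  interpret const_field \<kappa> by (rule cf)
  have ed: "e + 2 \<le> d" using assms by simp
  have p: "CHAR('K alg_closure) = p" using assms(2) by simp
  have prime: "Factorial_Ring.prime p" using prime_CHAR_semidom[where ?'a = 'K] assms(2,3) by simp
  \<comment> \<open>By Euler's theorem this power of \<open>p\<close> is 1 modulo \<open>d\<close>,
    so every d-th root of unity is fixed by the q-th power.\<close>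
  define q where "q = p ^ totient d"
  have "totient d > 0" using assms by simp
  hence q1: "q > 1" unfolding q_def using prime_gt_1_nat[OF prime] by (intro one_less_power) auto
  interpret frob_field \<kappa> q
  proof
    show "(x + y) ^ q = x ^ q + y ^ q" for x y :: "'K alg_closure"
      by (rule freshmans_dream'[where n = "totient d"]) (use p prime in \<open>simp_all add: q_def\<close>)
  qed (rule q1)
  have "[q = 1] (mod d)" unfolding q_def
    by (rule euler_theorem) (use prime assms(6) prime_imp_coprime in blast)
  hence "q mod d = 1" using assms(4) by (simp add: cong_def)
  hence qd: "q = d * (q div d) + 1" by (metis mult_div_mod_eq)
  have roots: "c ^ q = c" if "c ^ d = 1" for c :: "'K alg_closure"
    by (subst qd) (simp add: power_add power_mult that)
  have d0: "of_nat d \<noteq> (0 :: 'K alg_closure)" using assms(6) p by (simp add: of_nat_eq_0_iff_char_dvd)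
  have nonconst: "s \<notin> \<kappa>" if "\<not> (\<exists>g\<in>ratfuns_over (algebraic_closure_in k). pgl2_conjugate (ffam d e s) g)" for s
    using that ffam_const_isotrivial[OF K, of s d e] unfolding \<kappa>_def by blast
  have bound: "finite (PrePer (ffam d e s) L) \<and> card (PrePer (ffam d e s) L) \<le> q * d ^ ((q + 1) * (m * D)) + 2"
    if s: "s \<notin> \<kappa>" and L: "extension_of_degree L D" and f: "ffam d e s \<in> ratfuns_over L" for s L D
  proof -
    have sL: "s \<in> L" by (rule ffam_coeff_field[OF f]) (use L ed in \<open>auto simp: extension_of_degree_def\<close>)
    have s0: "s \<noteq> 0" using s sfd_0[OF K] by auto
    \<comment> \<open>The points 0 and \<open>Infty\<close> are set apart; they account for the
      summand 2.\<close>
    define A where "A = {x \<in> L. x \<noteq> 0 \<and> preper s d e (Aff x)}"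
    \<comment> \<open>\<open>preper_bound\<close> treats finite sets of points, which generate a
      field over \<open>\<kappa>\<close> by finitely many elements. As its bound is uniform,
      \<open>A\<close> itself is finite.\<close>
    have "card G \<le> q * d ^ ((q + 1) * (m * D))" if G: "G \<subseteq> A" "finite G" for G
      by (rule preper_bound[OF s ed d0 roots G(2) _ h m[OF L]]) (use G sL in \<open>auto simp: A_def\<close>)
    from finite_if_finite_subsets_card_bdd[OF this] have A: "finite A" "card A \<le> q * d ^ ((q + 1) * (m * D))" by auto
    have sub: "PrePer (ffam d e s) L \<subseteq> insert Infty (insert (Aff 0) (Aff ` A))"
      unfolding PrePer_def proj_line_over_def rat_eval_ffam(2)[OF s0 ed] A_def preper_def by auto
    have "card (insert Infty (insert (Aff 0) (Aff ` A))) \<le> card (Aff ` A) + 2"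
      using A(1) by (simp add: card_insert_if)
    also have "\<dots> \<le> q * d ^ ((q + 1) * (m * D)) + 2" using A card_image_le[of A Aff] by simp
    finally show ?thesis using sub A(1) card_mono[OF _ sub] finite_subset[OF sub] by auto
  qed
  let ?F = "{ffam d e s | s. \<not> (\<exists>g\<in>ratfuns_over (algebraic_closure_in k). pgl2_conjugate (ffam d e s) g)}"
  show ?thesis unfolding SUBP_family_def SUBP_def
  proof (intro conjI allI impI)
    have "rat_degree f = d" if "f \<in> ?F" for f
    proof -
      obtain s where "f = ffam d e s" "s \<notin> \<kappa>" using \<open>f \<in> ?F\<close> nonconst by blast
      thus ?thesis using rat_eval_ffam(1)[OF _ ed, of s] sfd_0[OF K] by auto
    qed
    thus "\<exists>d>1. \<forall>f\<in>?F. rat_degree f = d" using assms(4) by (intro exI[of _ d]) auto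
  next
    fix D :: nat
    show "\<exists>B. \<forall>L f. extension_of_degree L D \<longrightarrow> f \<in> ?F \<longrightarrow> f \<in> ratfuns_over L \<longrightarrow>
        finite (PrePer f L) \<and> card (PrePer f L) \<le> B"
      using bound nonconst by (intro exI[of _ "q * d ^ ((q + 1) * (m * D)) + 2"]) blast
  qed
qed

end
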